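(* Let $X$ be a first-countable, causally simple Lorentzian pre-length space. (i) If $X$ is finitely compact, then it is timelike Cauchy complete. (ii) If $X$ is timelike Cauchy complete, then it satisfies Condition B. Moreover, if $X$ is a globally hyperbolic Kunzinger–Sämann (KS-)Lorentzian length space, or a separable, timelike path-connected Bykov–Minguzzi–Suhr Lorentzian metric space without chronological boundary, or a separable, timelike path-connected, globally hyperbolic Braun–McCann (BM-)length metric spacetime, then in addition to (i) and (ii), Condition B implies Condition A$^*$, and Condition A$^*$ implies Condition A.
   Context: Lorentzian pre-length spaces. An extended time separation function on a set $X$ is a map $\ell:X\times X\to\{-\infty\}\cup[0,\infty]$ with $\ell(x,x)\ge0$ and $\ell(x,y)+\ell(y,z)\le\ell(x,z)$ for all $x,y,z$ (convention $-\infty+\infty=-\infty$). Put $d=\max(0,\ell)$ (Lorentzian distance); $x\le y$ iff $\ell(x,y)\ge0$; $x\ll y$ iff $d(x,y)>0$; $J^+(x)=\{y:x\le y\}$, $J^-(x)=\{y:y\le x\}$, $I^+(x)=\{y:x\ll y\}$, $I^-(x)=\{y:y\ll x\}$, $J^\pm(K)=\bigcup_{x\in K}J^\pm(x)$. A Lorentzian pre-length space is such a pair $(X,\ell)$ with a topology on $X$ for which all $I^\pm(x)$ are open. It is causal if $\le$ is antisymmetric; causally simple if it is causal and all $J^\pm(x)$ are closed; globally hyperbolic if it is causal, $\le$ is closed in $X\times X$, and $J^+(K)\cap J^-(K)$ is compact for every compact $K\subset X$. Its chronological boundary is $\{x: I^+(x)=\emptyset\}\cup\{x: I^-(x)=\emptyset\}$.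 Curves are continuous maps from intervals $I\subset\mathbb{R}$ to $X$. A curve $\gamma$ is causal (timelike) if $t<s$ implies $\gamma(t)\le\gamma(s)$ ($\gamma(t)\ll\gamma(s)$). $X$ is causally (timelike) path-connected if any $x\le y$ ($x\ll y$) can be connected by a causal (timelike) curve. The length of a causal curve $\gamma:[a,b]\to X$ is $L(\gamma)=\inf\sum_i d(\gamma(t_i),\gamma(t_{i+1}))$ over all partitions $a=t_0<\dots<t_N=b$. $\gamma$ is maximal if $L(\gamma)=d(\gamma(a),\gamma(b))$. A (causal) geodesic is a causal curve that is locally maximal. A causal curve $\gamma:I\to X$ is future extendible if there exist an order-preserving homeomorphism $\varphi:I\to\hat I$ onto an interval, an interval $\tilde I\supset\hat I$ containing some $t$ with $t>s$ for all $s\in\hat I$, and a causal curve $\tilde\gamma:\tilde I\to X$ with $\tilde\gamma|_{\hat I}=\gamma\circ\varphi^{-1}$; otherwise it is future inextendible. The past versions are analogous. A timelike curve is future (past) inextendible if it is so as a causal curve. Completeness conditions. - Finitely compact: for every $B>0$, $x,y\in X$ and sequence $(x_j)$ in $X$ with either $x\ll y\le x_j$ and $d(x,x_j)\le B$ for all $j$, or $x_j\le y\ll x$ and $d(x_j,x)\le B$ for all $j$, the sequence $(x_j)$ has an accumulation point in $X$. - Timelike Cauchy complete: every sequence $(x_j)$ in $X$ converges in $X$ provided that either $x_j\ll x_{j+1}$ for all $j$ and $\sup_k d(x_j,x_{j+k})\to0$ as $j\to\infty$, or $x_{j+1}\ll x_j$ for all $j$ and $\sup_k d(x_{j+k},x_j)\to0$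 as $j\to\infty$. - Condition B: every future inextendible timelike curve $\gamma:I\to X$ is future Cauchy complete, i.e. if $d(\gamma(t_0),\gamma(\cdot))$ is bounded on $[t_0,\infty)\cap I$ for some $t_0\in I$, then $\sup I\in I$; and every past inextendible timelike curve is past Cauchy complete (defined analogously). - Condition A: for any $x\ll y$ and any future inextendible causal geodesic $\gamma:I\to X$ with $0\in I$, $\gamma(0)=y$, one has $d(x,\gamma(t))\to\infty$ as $t\nearrow\sup I$ or $\sup I\in I$; and for any $y\ll x$ and any past inextendible causal geodesic $\gamma:I\to X$ with $0\in I$, $\gamma(0)=y$, one has $d(\gamma(t),x)\to\infty$ as $t\searrow\inf I$ or $\inf I\in I$. - Condition A$^*$: the requirement of Condition A holds for all future inextendible and all past inextendible causal curves, not only geodesics. KS-Lorentzian length spaces. A KS-Lorentzian pre-length space is a Lorentzian pre-length space with a metric $\rho$ inducing its topology such that $d$ is lower semicontinuous; in this setting all curves, and all notions defined via curves, are understood in terms of curves that are locally Lipschitz with respect to $\rho$. It is a KS-Lorentzian length space if: (1) every point has a neighborhood $U$ such that $p_n,q_n\in U$, $p_n\le q_n$, $p_n\to p\in\overline U$, $q_n\to q\in\overline U$ imply $p\le q$; (2) it is causally and timelike path-connected; (3) (localizability) every $x$ has an open neighborhood $\Omega_x$ such that (a) for some $C>0$ all causal curves in $\Omega_x$ have $\rho$-arclength at most $C$, (b) $I^\pm(y)\cap\Omega_x\neq\emptyset$ for all $y\in\Omega_x$, and there is a continuous $\omega_x:\Omega_x\times\Omega_x\to[0,\infty)$ making $\Omega_x$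 with the restrictions of $\rho,\ll,\le$ a KS-Lorentzian pre-length space with Lorentzian distance $\omega_x$, (c) for all $p\le q$, $p\ne q$ in $\Omega_x$ there is a causal curve $\gamma_{p,q}$ in $\Omega_x$ from $p$ to $q$ of maximal length among causal curves from $p$ to $q$ in $\Omega_x$, and $L(\gamma_{p,q})=\omega_x(p,q)\le d(p,q)$; (4) for $x\ll y$, $d(x,y)$ is the supremum of the lengths of causal curves from $x$ to $y$. Bykov–Minguzzi–Suhr Lorentzian metric spaces. A set $X$ with $d:X\times X\to[0,\infty)$ such that (1) $d(x,y)+d(y,z)\le d(x,z)$ whenever $d(x,y),d(y,z)>0$; (2) there is a topology on $X$ for which $d$ is continuous and for all $x,y\in X$, $\varepsilon>0$ the set $\{(x',y'):d(x',y')\ge\varepsilon\}\cap(\overline{I(x,y)}\times\overline{I(x,y)})$ is compact, where $I(x,y)=\{z: d(x,z)>0,\ d(z,y)>0\}$; (3) for all $x\ne y$ there is $z$ with $d(x,z)\ne d(y,z)$ or $d(z,x)\ne d(z,y)$. It is equipped with some topology as in (2), and regarded as a Lorentzian pre-length space with $x\le y$ iff $d(z,x)\le d(z,y)$ and $d(y,z)\le d(x,z)$ for all $z\in X$, and $\ell(x,y)=d(x,y)$ if $x\le y$, $\ell(x,y)=-\infty$ otherwise. BM-length metric spacetimes. A first-countable, causal Lorentzian pre-length space such that (1) $\ell$ is upper semicontinuous and $d$ is lower semicontinuous; (2) every $x\in X$ equals $\gamma(1/2)$ for some timelike curve $\gamma:[0,1]\to X$; (3) for $x\ll y$, $d(x,y)$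 is the supremum of the lengths of (injective) causal curves from $x$ to $y$. *)

theory Defs
  imports "HOL-Analysis.Analysis"
begin

section \<open>Lorentzian pre-length spaces\<close>

text \<open>The set \<open>X\<close> is the carrier \<open>topspace T\<close> of an abstract topology \<open>T\<close>; the values of
  the time separation function \<open>l\<close> outside the carrier are irrelevant.\<close>

text \<open>In the type \<^typ>\<open>ereal\<close> one has \<open>-\<infinity> + \<infinity> = \<infinity>\<close>; Lorentzian geometry uses
  \<open>-\<infinity> + \<infinity> = -\<infinity>\<close>.\<close>

definition lor_plus :: "ereal \<Rightarrow> ereal \<Rightarrow> ereal" where
  "lor_plus a b = (if a = -\<infinity> \<or> b = -\<infinity> then -\<infinity> else a + b)"

definition time_separation :: "'a set \<Rightarrow> ('a \<Rightarrow> 'a \<Rightarrow> ereal) \<Rightarrow> bool" where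
  "time_separation X l \<longleftrightarrow>
     (\<forall>x\<in>X. \<forall>y\<in>X. l x y = -\<infinity> \<or> 0 \<le> l x y) \<and>
     (\<forall>x\<in>X. 0 \<le> l x x) \<and>
     (\<forall>x\<in>X. \<forall>y\<in>X. \<forall>z\<in>X. lor_plus (l x y) (l y z) \<le> l x z)"

definition lor_dist :: "('a \<Rightarrow> 'a \<Rightarrow> ereal) \<Rightarrow> 'a \<Rightarrow> 'a \<Rightarrow> ereal" where
  "lor_dist l x y = max 0 (l x y)"

definition causal_le :: "('a \<Rightarrow> 'a \<Rightarrow> ereal) \<Rightarrow> 'a \<Rightarrow> 'a \<Rightarrow> bool" where
  "causal_le l x y \<longleftrightarrow> 0 \<le> l x y"

definition chron_less :: "('a \<Rightarrow> 'a \<Rightarrow> ereal) \<Rightarrow> 'a \<Rightarrow> 'a \<Rightarrow> bool" where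
  "chron_less l x y \<longleftrightarrow> 0 < lor_dist l x y"

definition J_plus :: "'a topology \<Rightarrow> ('a \<Rightarrow> 'a \<Rightarrow> ereal) \<Rightarrow> 'a \<Rightarrow> 'a set" where
  "J_plus T l x = {y \<in> topspace T. causal_le l x y}"

definition J_minus :: "'a topology \<Rightarrow> ('a \<Rightarrow> 'a \<Rightarrow> ereal) \<Rightarrow> 'a \<Rightarrow> 'a set" where
  "J_minus T l x = {y \<in> topspace T. causal_le l y x}"

definition I_plus :: "'a topology \<Rightarrow> ('a \<Rightarrow> 'a \<Rightarrow> ereal) \<Rightarrow> 'a \<Rightarrow> 'a set" where
  "I_plus T l x = {y \<in> topspace T. chron_less l x y}"

definition I_minus :: "'a topology \<Rightarrow> ('a \<Rightarrow> 'a \<Rightarrow> ereal) \<Rightarrow> 'a \<Rightarrow> 'a set" where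
  "I_minus T l x = {y \<in> topspace T. chron_less l y x}"

definition lorentzian_pre_length_space :: "'a topology \<Rightarrow> ('a \<Rightarrow> 'a \<Rightarrow> ereal) \<Rightarrow> bool" where
  "lorentzian_pre_length_space T l \<longleftrightarrow>
     time_separation (topspace T) l \<and>
     (\<forall>x\<in>topspace T. openin T (I_plus T l x) \<and> openin T (I_minus T l x))"

definition causal_space :: "'a topology \<Rightarrow> ('a \<Rightarrow> 'a \<Rightarrow> ereal) \<Rightarrow> bool" where
  "causal_space T l \<longleftrightarrow>
     (\<forall>x\<in>topspace T. \<forall>y\<in>topspace T. causal_le l x y \<and> causal_le l y x \<longrightarrow> x = y)"

definition causally_simple :: "'a topology \<Rightarrow> ('a \<Rightarrow> 'a \<Rightarrow> ereal) \<Rightarrow> bool" where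
  "causally_simple T l \<longleftrightarrow>
     causal_space T l \<and>
     (\<forall>x\<in>topspace T. closedin T (J_plus T l x) \<and> closedin T (J_minus T l x))"

definition globally_hyperbolic :: "'a topology \<Rightarrow> ('a \<Rightarrow> 'a \<Rightarrow> ereal) \<Rightarrow> bool" where
  "globally_hyperbolic T l \<longleftrightarrow>
     causal_space T l \<and>
     closedin (prod_topology T T)
       {(x, y). x \<in> topspace T \<and> y \<in> topspace T \<and> causal_le l x y} \<and>
     (\<forall>K. compactin T K \<longrightarrow>
        compactin T ((\<Union>x\<in>K. J_plus T l x) \<inter> (\<Union>x\<in>K. J_minus T l x)))"

definition chronological_boundary :: "'a topology \<Rightarrow> ('a \<Rightarrow> 'a \<Rightarrow> ereal) \<Rightarrow> 'a set" where
  "chronological_boundary T l =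
     {x \<in> topspace T. I_plus T l x = {}} \<union> {x \<in> topspace T. I_minus T l x = {}}"


section \<open>Curves\<close>

text \<open>A class of curves is a predicate \<open>C I \<gamma>\<close> saying that \<open>\<gamma>\<close> restricted to the interval
  \<open>I\<close> is an admissible curve. All notions defined via curves take \<open>C\<close> as a parameter, because
  they refer to all continuous curves in general, but to the locally Lipschitz ones in
  the Kunzinger--Saemann setting.\<close>

type_synonym 'a curve_class = "real set \<Rightarrow> (real \<Rightarrow> 'a) \<Rightarrow> bool"

definition cont_curve :: "'a topology \<Rightarrow> 'a curve_class" where
  "cont_curve T I \<gamma> \<longleftrightarrow> is_interval I \<and> I \<noteq> {} \<and> continuous_map (top_of_set I) T \<gamma>"

definition lip_curve :: "'a metric \<Rightarrow> 'a curve_class" where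
  "lip_curve \<rho> I \<gamma> \<longleftrightarrow>
     cont_curve (mtopology_of \<rho>) I \<gamma> \<and>
     (\<forall>t\<in>I. \<exists>U. open U \<and> t \<in> U \<and>
        Lipschitz_continuous_map (submetric euclidean_metric (U \<inter> I)) \<rho> \<gamma>)"

definition causal_curve ::
  "'a curve_class \<Rightarrow> ('a \<Rightarrow> 'a \<Rightarrow> ereal) \<Rightarrow> real set \<Rightarrow> (real \<Rightarrow> 'a) \<Rightarrow> bool" where
  "causal_curve C l I \<gamma> \<longleftrightarrow> C I \<gamma> \<and> (\<forall>t\<in>I. \<forall>s\<in>I. t < s \<longrightarrow> causal_le l (\<gamma> t) (\<gamma> s))"

definition timelike_curve ::
  "'a curve_class \<Rightarrow> ('a \<Rightarrow> 'a \<Rightarrow> ereal) \<Rightarrow> real set \<Rightarrow> (real \<Rightarrow> 'a) \<Rightarrow> bool" where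
  "timelike_curve C l I \<gamma> \<longleftrightarrow> C I \<gamma> \<and> (\<forall>t\<in>I. \<forall>s\<in>I. t < s \<longrightarrow> chron_less l (\<gamma> t) (\<gamma> s))"

definition causally_path_connected ::
  "'a curve_class \<Rightarrow> 'a topology \<Rightarrow> ('a \<Rightarrow> 'a \<Rightarrow> ereal) \<Rightarrow> bool" where
  "causally_path_connected C T l \<longleftrightarrow>
     (\<forall>x\<in>topspace T. \<forall>y\<in>topspace T. causal_le l x y \<longrightarrow>
        (\<exists>a b \<gamma>. a < b \<and> causal_curve C l {a..b} \<gamma> \<and> \<gamma> a = x \<and> \<gamma> b = y))"

definition timelike_path_connected ::
  "'a curve_class \<Rightarrow> 'a topology \<Rightarrow> ('a \<Rightarrow> 'a \<Rightarrow> ereal) \<Rightarrow> bool" where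
  "timelike_path_connected C T l \<longleftrightarrow>
     (\<forall>x\<in>topspace T. \<forall>y\<in>topspace T. chron_less l x y \<longrightarrow>
        (\<exists>a b \<gamma>. a < b \<and> timelike_curve C l {a..b} \<gamma> \<and> \<gamma> a = x \<and> \<gamma> b = y))"

definition curve_length ::
  "('a \<Rightarrow> 'a \<Rightarrow> ereal) \<Rightarrow> real \<Rightarrow> real \<Rightarrow> (real \<Rightarrow> 'a) \<Rightarrow> ereal" where
  "curve_length l a b \<gamma> =
     Inf {\<Sum>i<N. lor_dist l (\<gamma> (t i)) (\<gamma> (t (Suc i))) | (N::nat) (t::nat \<Rightarrow> real).
            t 0 = a \<and> t N = b \<and> (\<forall>i<N. t i < t (Suc i))}"

definition maximal_curve ::
  "('a \<Rightarrow> 'a \<Rightarrow> ereal) \<Rightarrow> real \<Rightarrow> real \<Rightarrow> (real \<Rightarrow> 'a) \<Rightarrow> bool" where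
  "maximal_curve l a b \<gamma> \<longleftrightarrow> curve_length l a b \<gamma> = lor_dist l (\<gamma> a) (\<gamma> b)"

text \<open>Locally maximal: every parameter has a compact interval as neighbourhood in \<open>I\<close>
  on which the curve is maximal.\<close>

definition causal_geodesic ::
  "'a curve_class \<Rightarrow> ('a \<Rightarrow> 'a \<Rightarrow> ereal) \<Rightarrow> real set \<Rightarrow> (real \<Rightarrow> 'a) \<Rightarrow> bool" where
  "causal_geodesic C l I \<gamma> \<longleftrightarrow>
     causal_curve C l I \<gamma> \<and>
     (\<forall>t\<in>I. \<exists>a b U. a \<le> b \<and> {a..b} \<subseteq> I \<and> open U \<and> t \<in> U \<and> U \<inter> I \<subseteq> {a..b} \<and>
        maximal_curve l a b \<gamma>)"

definition future_extendible ::
  "'a curve_class \<Rightarrow> ('a \<Rightarrow> 'a \<Rightarrow> ereal) \<Rightarrow> real set \<Rightarrow> (real \<Rightarrow> 'a) \<Rightarrow> bool" where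
  "future_extendible C l I \<gamma> \<longleftrightarrow>
     (\<exists>\<phi> \<psi> I' J \<gamma>'.
        is_interval I' \<and> homeomorphism I I' \<phi> \<psi> \<and> strict_mono_on I \<phi> \<and>
        is_interval J \<and> I' \<subseteq> J \<and> (\<exists>t\<in>J. \<forall>s\<in>I'. s < t) \<and>
        causal_curve C l J \<gamma>' \<and> (\<forall>s\<in>I'. \<gamma>' s = \<gamma> (\<psi> s)))"

definition past_extendible ::
  "'a curve_class \<Rightarrow> ('a \<Rightarrow> 'a \<Rightarrow> ereal) \<Rightarrow> real set \<Rightarrow> (real \<Rightarrow> 'a) \<Rightarrow> bool" where
  "past_extendible C l I \<gamma> \<longleftrightarrow>
     (\<exists>\<phi> \<psi> I' J \<gamma>'.
        is_interval I' \<and> homeomorphism I I' \<phi> \<psi> \<and> strict_mono_on I \<phi> \<and>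
        is_interval J \<and> I' \<subseteq> J \<and> (\<exists>t\<in>J. \<forall>s\<in>I'. t < s) \<and>
        causal_curve C l J \<gamma>' \<and> (\<forall>s\<in>I'. \<gamma>' s = \<gamma> (\<psi> s)))"


section \<open>Completeness conditions\<close>

definition seq_accumulation_point :: "'a topology \<Rightarrow> (nat \<Rightarrow> 'a) \<Rightarrow> 'a \<Rightarrow> bool" where
  "seq_accumulation_point T x p \<longleftrightarrow>
     p \<in> topspace T \<and> (\<forall>U. openin T U \<and> p \<in> U \<longrightarrow> (\<exists>\<^sub>\<infinity>j. x j \<in> U))"

definition finitely_compact :: "'a topology \<Rightarrow> ('a \<Rightarrow> 'a \<Rightarrow> ereal) \<Rightarrow> bool" where
  "finitely_compact T l \<longleftrightarrow>
     (\<forall>(B::real) x y xs. 0 < B \<and> x \<in> topspace T \<and> y \<in> topspace T \<and> range xs \<subseteq> topspace T \<and>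
        ((chron_less l x y \<and> (\<forall>j. causal_le l y (xs j) \<and> lor_dist l x (xs j) \<le> ereal B)) \<or>
         (chron_less l y x \<and> (\<forall>j. causal_le l (xs j) y \<and> lor_dist l (xs j) x \<le> ereal B)))
        \<longrightarrow> (\<exists>p. seq_accumulation_point T xs p))"

definition timelike_cauchy_complete :: "'a topology \<Rightarrow> ('a \<Rightarrow> 'a \<Rightarrow> ereal) \<Rightarrow> bool" where
  "timelike_cauchy_complete T l \<longleftrightarrow>
     (\<forall>xs. range xs \<subseteq> topspace T \<and>
        (((\<forall>j. chron_less l (xs j) (xs (Suc j))) \<and>
          (\<lambda>j. SUP k. lor_dist l (xs j) (xs (j + k))) \<longlonglongrightarrow> 0) \<or>
         ((\<forall>j. chron_less l (xs (Suc j)) (xs j)) \<and>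
          (\<lambda>j. SUP k. lor_dist l (xs (j + k)) (xs j)) \<longlonglongrightarrow> 0))
        \<longrightarrow> (\<exists>p. limitin T xs p sequentially))"

text \<open>The suprema and infima of intervals are extended real numbers, as intervals may be
  unbounded.\<close>

definition sup_attained :: "real set \<Rightarrow> bool" where
  "sup_attained I \<longleftrightarrow> Sup (ereal ` I) \<in> ereal ` I"

definition inf_attained :: "real set \<Rightarrow> bool" where
  "inf_attained I \<longleftrightarrow> Inf (ereal ` I) \<in> ereal ` I"

text \<open>The filters \<open>t \<up> sup I\<close> and \<open>t \<down> inf I\<close> for \<open>t\<close> ranging over \<open>I\<close>.\<close>

definition toward_sup :: "real set \<Rightarrow> real filter" where
  "toward_sup I = filtercomap ereal (at (Sup (ereal ` I)) within ereal ` I)"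

definition toward_inf :: "real set \<Rightarrow> real filter" where
  "toward_inf I = filtercomap ereal (at (Inf (ereal ` I)) within ereal ` I)"

definition future_cauchy_complete ::
  "('a \<Rightarrow> 'a \<Rightarrow> ereal) \<Rightarrow> real set \<Rightarrow> (real \<Rightarrow> 'a) \<Rightarrow> bool" where
  "future_cauchy_complete l I \<gamma> \<longleftrightarrow>
     ((\<exists>t0\<in>I. \<exists>B::real. \<forall>t\<in>{t0..} \<inter> I. lor_dist l (\<gamma> t0) (\<gamma> t) \<le> ereal B) \<longrightarrow> sup_attained I)"

definition past_cauchy_complete ::
  "('a \<Rightarrow> 'a \<Rightarrow> ereal) \<Rightarrow> real set \<Rightarrow> (real \<Rightarrow> 'a) \<Rightarrow> bool" where
  "past_cauchy_complete l I \<gamma> \<longleftrightarrow>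
     ((\<exists>t0\<in>I. \<exists>B::real. \<forall>t\<in>{..t0} \<inter> I. lor_dist l (\<gamma> t) (\<gamma> t0) \<le> ereal B) \<longrightarrow> inf_attained I)"

definition condition_B :: "'a curve_class \<Rightarrow> ('a \<Rightarrow> 'a \<Rightarrow> ereal) \<Rightarrow> bool" where
  "condition_B C l \<longleftrightarrow>
     (\<forall>I \<gamma>. timelike_curve C l I \<gamma> \<and> \<not> future_extendible C l I \<gamma> \<longrightarrow>
        future_cauchy_complete l I \<gamma>) \<and>
     (\<forall>I \<gamma>. timelike_curve C l I \<gamma> \<and> \<not> past_extendible C l I \<gamma> \<longrightarrow>
        past_cauchy_complete l I \<gamma>)"

text \<open>The common requirement of Conditions A and A*, imposed on the causal curves in \<open>P\<close>.\<close>

definition escape_condition ::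
  "(real set \<Rightarrow> (real \<Rightarrow> 'a) \<Rightarrow> bool) \<Rightarrow> 'a curve_class \<Rightarrow> 'a topology \<Rightarrow>
     ('a \<Rightarrow> 'a \<Rightarrow> ereal) \<Rightarrow> bool" where
  "escape_condition P C T l \<longleftrightarrow>
     (\<forall>x\<in>topspace T. \<forall>y\<in>topspace T. chron_less l x y \<longrightarrow>
        (\<forall>I \<gamma>. P I \<gamma> \<and> \<not> future_extendible C l I \<gamma> \<and> 0 \<in> I \<and> \<gamma> 0 = y \<longrightarrow>
           ((\<lambda>t. lor_dist l x (\<gamma> t)) \<longlongrightarrow> \<infinity>) (toward_sup I) \<or> sup_attained I)) \<and>
     (\<forall>x\<in>topspace T. \<forall>y\<in>topspace T. chron_less l y x \<longrightarrow>
        (\<forall>I \<gamma>. P I \<gamma> \<and> \<not> past_extendible C l I \<gamma> \<and> 0 \<in> I \<and> \<gamma> 0 = y \<longrightarrow>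
           ((\<lambda>t. lor_dist l (\<gamma> t) x) \<longlongrightarrow> \<infinity>) (toward_inf I) \<or> inf_attained I))"

definition condition_A :: "'a curve_class \<Rightarrow> 'a topology \<Rightarrow> ('a \<Rightarrow> 'a \<Rightarrow> ereal) \<Rightarrow> bool" where
  "condition_A C T l \<longleftrightarrow> escape_condition (causal_geodesic C l) C T l"

definition condition_A_star :: "'a curve_class \<Rightarrow> 'a topology \<Rightarrow> ('a \<Rightarrow> 'a \<Rightarrow> ereal) \<Rightarrow> bool" where
  "condition_A_star C T l \<longleftrightarrow> escape_condition (causal_curve C l) C T l"


section \<open>Semicontinuity\<close>

definition lower_semicont :: "'b topology \<Rightarrow> ('b \<Rightarrow> ereal) \<Rightarrow> bool" where
  "lower_semicont S f \<longleftrightarrow> (\<forall>c. openin S {p \<in> topspace S. c < f p})"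

definition upper_semicont :: "'b topology \<Rightarrow> ('b \<Rightarrow> ereal) \<Rightarrow> bool" where
  "upper_semicont S f \<longleftrightarrow> (\<forall>c. openin S {p \<in> topspace S. f p < c})"


section \<open>Kunzinger--Saemann Lorentzian length spaces\<close>

definition KS_pre_length_space ::
  "'a topology \<Rightarrow> 'a metric \<Rightarrow> ('a \<Rightarrow> 'a \<Rightarrow> ereal) \<Rightarrow> bool" where
  "KS_pre_length_space T \<rho> l \<longleftrightarrow>
     lorentzian_pre_length_space T l \<and> mtopology_of \<rho> = T \<and>
     lower_semicont (prod_topology T T) (\<lambda>(x, y). lor_dist l x y)"

definition KS_locally_causally_closed :: "'a topology \<Rightarrow> ('a \<Rightarrow> 'a \<Rightarrow> ereal) \<Rightarrow> bool" where
  "KS_locally_causally_closed T l \<longleftrightarrow>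
     (\<forall>x\<in>topspace T. \<exists>U \<subseteq> topspace T. x \<in> T interior_of U \<and>
        (\<forall>ps qs p q. (\<forall>n::nat. ps n \<in> U \<and> qs n \<in> U \<and> causal_le l (ps n) (qs n)) \<and>
           p \<in> T closure_of U \<and> q \<in> T closure_of U \<and>
           limitin T ps p sequentially \<and> limitin T qs q sequentially
           \<longrightarrow> causal_le l p q))"

definition metric_arclength :: "'a metric \<Rightarrow> real set \<Rightarrow> (real \<Rightarrow> 'a) \<Rightarrow> ereal" where
  "metric_arclength \<rho> I \<gamma> =
     Sup {ereal (\<Sum>i<N. mdist \<rho> (\<gamma> (t i)) (\<gamma> (t (Suc i)))) | (N::nat) (t::nat \<Rightarrow> real).
            (\<forall>i\<le>N. t i \<in> I) \<and> (\<forall>i<N. t i < t (Suc i))}"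

text \<open>In clause (b), the time separation \<open>l'\<close> of \<open>\<Omega>\<close> encodes the triple consisting of the
  local Lorentzian distance \<open>\<omega>\<close> and the restrictions of the two relations of \<open>l\<close>. In clause (c),
  lengths are those measured with the global Lorentzian distance.\<close>

definition KS_localizing_neighbourhood ::
  "'a topology \<Rightarrow> 'a metric \<Rightarrow> ('a \<Rightarrow> 'a \<Rightarrow> ereal) \<Rightarrow> 'a set \<Rightarrow> bool" where
  "KS_localizing_neighbourhood T \<rho> l \<Omega> \<longleftrightarrow>
     openin T \<Omega> \<and>
     (\<exists>C::real. 0 < C \<and>
        (\<forall>I \<gamma>. causal_curve (lip_curve \<rho>) l I \<gamma> \<and> \<gamma> ` I \<subseteq> \<Omega> \<longrightarrow>
           metric_arclength \<rho> I \<gamma> \<le> ereal C)) \<and>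
     (\<forall>y\<in>\<Omega>. I_plus T l y \<inter> \<Omega> \<noteq> {} \<and> I_minus T l y \<inter> \<Omega> \<noteq> {}) \<and>
     (\<exists>\<omega> :: 'a \<Rightarrow> 'a \<Rightarrow> real.
        (\<forall>p\<in>\<Omega>. \<forall>q\<in>\<Omega>. 0 \<le> \<omega> p q) \<and>
        continuous_map (prod_topology (subtopology T \<Omega>) (subtopology T \<Omega>)) euclideanreal
          (\<lambda>(p, q). \<omega> p q) \<and>
        (\<exists>l'. KS_pre_length_space (subtopology T \<Omega>) (submetric \<rho> \<Omega>) l' \<and>
           (\<forall>p\<in>\<Omega>. \<forall>q\<in>\<Omega>. lor_dist l' p q = ereal (\<omega> p q) \<and>
              (causal_le l' p q \<longleftrightarrow> causal_le l p q) \<and>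
              (chron_less l' p q \<longleftrightarrow> chron_less l p q))) \<and>
        (\<forall>p\<in>\<Omega>. \<forall>q\<in>\<Omega>. causal_le l p q \<and> p \<noteq> q \<longrightarrow>
           (\<exists>a b \<gamma>. a < b \<and> causal_curve (lip_curve \<rho>) l {a..b} \<gamma> \<and> \<gamma> ` {a..b} \<subseteq> \<Omega> \<and>
              \<gamma> a = p \<and> \<gamma> b = q \<and>
              (\<forall>a' b' \<gamma>'. a' < b' \<and> causal_curve (lip_curve \<rho>) l {a'..b'} \<gamma>' \<and>
                 \<gamma>' ` {a'..b'} \<subseteq> \<Omega> \<and> \<gamma>' a' = p \<and> \<gamma>' b' = q \<longrightarrow>
                 curve_length l a' b' \<gamma>' \<le> curve_length l a b \<gamma>) \<and>
              curve_length l a b \<gamma> = ereal (\<omega> p q) \<and>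
              ereal (\<omega> p q) \<le> lor_dist l p q)))"

definition intrinsic_distance ::
  "'a curve_class \<Rightarrow> 'a topology \<Rightarrow> ('a \<Rightarrow> 'a \<Rightarrow> ereal) \<Rightarrow> bool" where
  "intrinsic_distance C T l \<longleftrightarrow>
     (\<forall>x\<in>topspace T. \<forall>y\<in>topspace T. chron_less l x y \<longrightarrow>
        lor_dist l x y = Sup {curve_length l a b \<gamma> | a b \<gamma>.
           a < b \<and> causal_curve C l {a..b} \<gamma> \<and> \<gamma> a = x \<and> \<gamma> b = y})"

definition KS_length_space ::
  "'a topology \<Rightarrow> 'a metric \<Rightarrow> ('a \<Rightarrow> 'a \<Rightarrow> ereal) \<Rightarrow> bool" where
  "KS_length_space T \<rho> l \<longleftrightarrow>
     KS_pre_length_space T \<rho> l \<and>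
     KS_locally_causally_closed T l \<and>
     causally_path_connected (lip_curve \<rho>) T l \<and>
     timelike_path_connected (lip_curve \<rho>) T l \<and>
     (\<forall>x\<in>topspace T. \<exists>\<Omega>. x \<in> \<Omega> \<and> KS_localizing_neighbourhood T \<rho> l \<Omega>) \<and>
     intrinsic_distance (lip_curve \<rho>) T l"


section \<open>Bykov--Minguzzi--Suhr Lorentzian metric spaces\<close>

definition BMS_diamond :: "'a set \<Rightarrow> ('a \<Rightarrow> 'a \<Rightarrow> real) \<Rightarrow> 'a \<Rightarrow> 'a \<Rightarrow> 'a set" where
  "BMS_diamond X d x y = {z \<in> X. 0 < d x z \<and> 0 < d z y}"

definition BMS_topology :: "'a set \<Rightarrow> ('a \<Rightarrow> 'a \<Rightarrow> real) \<Rightarrow> 'a topology \<Rightarrow> bool" where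
  "BMS_topology X d T \<longleftrightarrow>
     topspace T = X \<and>
     continuous_map (prod_topology T T) euclideanreal (\<lambda>(x, y). d x y) \<and>
     (\<forall>x\<in>X. \<forall>y\<in>X. \<forall>\<epsilon>>0.
        compactin (prod_topology T T)
          ({(x', y'). x' \<in> X \<and> y' \<in> X \<and> \<epsilon> \<le> d x' y'} \<inter>
           (T closure_of BMS_diamond X d x y) \<times> (T closure_of BMS_diamond X d x y)))"

definition BMS_space :: "'a set \<Rightarrow> ('a \<Rightarrow> 'a \<Rightarrow> real) \<Rightarrow> bool" where
  "BMS_space X d \<longleftrightarrow>
     (\<forall>x\<in>X. \<forall>y\<in>X. 0 \<le> d x y) \<and>
     (\<forall>x\<in>X. \<forall>y\<in>X. \<forall>z\<in>X. 0 < d x y \<and> 0 < d y z \<longrightarrow> d x y + d y z \<le> d x z) \<and>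
     (\<exists>T. BMS_topology X d T) \<and>
     (\<forall>x\<in>X. \<forall>y\<in>X. x \<noteq> y \<longrightarrow> (\<exists>z\<in>X. d x z \<noteq> d y z \<or> d z x \<noteq> d z y))"

definition BMS_time_separation :: "'a set \<Rightarrow> ('a \<Rightarrow> 'a \<Rightarrow> real) \<Rightarrow> 'a \<Rightarrow> 'a \<Rightarrow> ereal" where
  "BMS_time_separation X d x y =
     (if \<forall>z\<in>X. d z x \<le> d z y \<and> d y z \<le> d x z then ereal (d x y) else -\<infinity>)"

text \<open>A pair \<open>(T, l)\<close> that arises from a Lorentzian metric space.\<close>

definition BMS_lorentzian_metric_space :: "'a topology \<Rightarrow> ('a \<Rightarrow> 'a \<Rightarrow> ereal) \<Rightarrow> bool" where
  "BMS_lorentzian_metric_space T l \<longleftrightarrow>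
     (\<exists>d. BMS_space (topspace T) d \<and> BMS_topology (topspace T) d T \<and>
        (\<forall>x\<in>topspace T. \<forall>y\<in>topspace T. l x y = BMS_time_separation (topspace T) d x y))"


section \<open>Braun--McCann length metric spacetimes\<close>

text \<open>The curves in the supremum formula for \<open>d\<close> are not required to be injective. Since
  lengths never exceed \<open>d\<close>, the formula for injective curves implies the present one, so that
  both variants of the notion are covered.\<close>

definition BM_length_metric_spacetime :: "'a topology \<Rightarrow> ('a \<Rightarrow> 'a \<Rightarrow> ereal) \<Rightarrow> bool" where
  "BM_length_metric_spacetime T l \<longleftrightarrow>
     first_countable T \<and> lorentzian_pre_length_space T l \<and> causal_space T l \<and>
     upper_semicont (prod_topology T T) (\<lambda>(x, y). l x y) \<and>
     lower_semicont (prod_topology T T) (\<lambda>(x, y). lor_dist l x y) \<and>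
     (\<forall>x\<in>topspace T. \<exists>\<gamma>. timelike_curve (cont_curve T) l {0..1} \<gamma> \<and> \<gamma> (1/2) = x) \<and>
     intrinsic_distance (cont_curve T) T l"

end

(* A timelike curve on which the distance from a point stays bounded gives, by the reverse triangle
   inequality, Cauchy chronological chains, and antisymmetry together with the closedness of the
   causal cones shows that all their limits coincide; the curve can then be prolonged by its limit.
   For Condition A*, a causal curve is shadowed by a timelike curve through points chronologically
   before it and so close to it that a limit of the timelike curve bounds the causal curve from above.
   Compactness of the causal diamonds turns this bound into a limit of the causal curve itself.
   In the Lipschitz setting, prolonging requires arc length as a parameter, which is bounded
   because causal curves in a localizing neighbourhood have bounded length. *)

theory Submission
  imports Defs
begin

section \<open>Causal relations\<close>

text \<open>Condition B speaks of timelike curves only, whereas a causal curve may be null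
  everywhere, so Condition A* needs a timelike substitute for \<gamma>. A substitute running before
  \<gamma> inherits the distance bound, but its limit is an upper bound of the substitute alone;
  nothing yet relates this limit to \<gamma>. Hence the predicate \<open>capturing\<close>: the
  substitute must pass through neighbourhoods chosen in advance. They come from a countable dense
  set for continuous curves and from shrinking balls for Lipschitz ones. The order argument is the
  same for both kinds of curves and therefore runs in locales over an abstract class
  \<open>C\<close>. Limits are handled as accumulation points of sequences: compact sets provide
  them and closed cones retain them. Everything is proved towards the future and carried to the past
  by \<open>rev_sep\<close>.\<close>

lemma seq_accumulation_point_closedin:
  assumes "seq_accumulation_point T x p" and "closedin T A" and "\<forall>\<^sub>\<infinity>j. x j \<in> A"
  shows "p \<in> A"
proof (rule ccontr)
  assume "p \<notin> A"
  then have "openin T (topspace T - A)" "p \<in> topspace T - A"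
    using assms(1,2) by (auto simp: seq_accumulation_point_def)
  with assms(1) have "\<exists>\<^sub>\<infinity>j. x j \<in> topspace T - A"
    unfolding seq_accumulation_point_def by meson
  then have "\<exists>\<^sub>\<infinity>j. x j \<notin> A"
    by (rule frequently_elim1) simp
  with assms(3) show False
    by (simp add: frequently_def)
qed

text \<open>If no point accumulated, each would have a neighbourhood visited at finitely many
  indices only, and a finite subcover of \<open>K\<close> would leave finitely many indices in
  all.\<close>

lemma compactin_seq_accumulation_point:
  fixes x :: "nat \<Rightarrow> 'a"
  assumes K: "compactin T K" and x: "\<And>j. x j \<in> K"
  shows "\<exists>p. seq_accumulation_point T x p"
proof (rule ccontr)
  assume "\<nexists>p. seq_accumulation_point T x p"
  then have "\<forall>p\<in>topspace T. \<exists>U. openin T U \<and> p \<in> U \<and> finite {j. x j \<in> U}"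
    by (auto simp: seq_accumulation_point_def INFM_iff_infinite)
  then obtain U where U: "\<And>p. p \<in> topspace T \<Longrightarrow> openin T (U p) \<and> p \<in> U p \<and> finite {j. x j \<in> U p}"
    by metis
  have KT: "K \<subseteq> topspace T"
    using K by (rule compactin_subset_topspace)
  have "(\<forall>V\<in>U ` K. openin T V) \<and> K \<subseteq> \<Union>(U ` K)"
    using U KT by blast
  with K have "\<exists>F. finite F \<and> F \<subseteq> U ` K \<and> K \<subseteq> \<Union>F"
    unfolding compactin_def by blast
  then obtain F where F: "finite F" "F \<subseteq> U ` K" "K \<subseteq> \<Union>F"
    by blast
  have "j \<in> (\<Union>V\<in>F. {j. x j \<in> V})" for j
    using subsetD[OF F(3) x[of j]] by auto
  then have "UNIV = (\<Union>V\<in>F. {j. x j \<in> V})"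
    by (intro set_eqI) simp
  moreover have "finite (\<Union>V\<in>F. {j. x j \<in> V})"
    using F(1,2) U KT by auto
  ultimately show False
    by (metis infinite_UNIV_nat)
qed

text \<open>Swapping the arguments exchanges future and past, so each one-sided statement about
  \<open>l\<close> yields its mirror image when applied to \<open>rev_sep l\<close>.\<close>

definition rev_sep :: "('a \<Rightarrow> 'a \<Rightarrow> ereal) \<Rightarrow> 'a \<Rightarrow> 'a \<Rightarrow> ereal" where
  "rev_sep l x y = l y x"

lemma rev_sep_simps [simp]:
  "lor_dist (rev_sep l) x y = lor_dist l y x"
  "causal_le (rev_sep l) x y \<longleftrightarrow> causal_le l y x"
  "chron_less (rev_sep l) x y \<longleftrightarrow> chron_less l y x"
  "J_plus T (rev_sep l) x = J_minus T l x"
  "J_minus T (rev_sep l) x = J_plus T l x"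
  "I_plus T (rev_sep l) x = I_minus T l x"
  "I_minus T (rev_sep l) x = I_plus T l x"
  by (simp_all add: rev_sep_def lor_dist_def causal_le_def chron_less_def
      J_plus_def J_minus_def I_plus_def I_minus_def)

lemma lor_plus_commute: "lor_plus a b = lor_plus b a"
  by (simp add: lor_plus_def add.commute)

lemma time_separation_rev_sep: "time_separation X l \<Longrightarrow> time_separation X (rev_sep l)"
  unfolding time_separation_def rev_sep_def by (metis lor_plus_commute)

lemma lorentzian_pre_length_space_rev_sep:
  "lorentzian_pre_length_space T l \<Longrightarrow> lorentzian_pre_length_space T (rev_sep l)"
  unfolding lorentzian_pre_length_space_def by (simp add: time_separation_rev_sep)

lemma causally_simple_rev_sep: "causally_simple T l \<Longrightarrow> causally_simple T (rev_sep l)"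
  unfolding causally_simple_def causal_space_def by auto

lemma lor_dist_eq_if_causal_le: "causal_le l x y \<Longrightarrow> lor_dist l x y = l x y"
  by (simp add: causal_le_def lor_dist_def)

lemma chron_less_iff: "chron_less l x y \<longleftrightarrow> 0 < l x y"
  by (simp add: chron_less_def lor_dist_def less_max_iff_disj)

lemma chron_less_imp_causal_le: "chron_less l x y \<Longrightarrow> causal_le l x y"
  by (simp add: chron_less_iff causal_le_def)

lemma lor_dist_nonneg: "0 \<le> lor_dist l x y"
  by (simp add: lor_dist_def)

section \<open>Order relations and closed cones in a causally simple space\<close>

locale causally_simple_space =
  fixes T :: "'a topology" and l :: "'a \<Rightarrow> 'a \<Rightarrow> ereal"
  assumes pre_length: "lorentzian_pre_length_space T l"
    and simple: "causally_simple T l"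
begin

lemma rev: "causally_simple_space T (rev_sep l)"
  by (intro causally_simple_space.intro lorentzian_pre_length_space_rev_sep
      causally_simple_rev_sep pre_length simple)

lemma time_sep: "time_separation (topspace T) l"
  using pre_length by (simp add: lorentzian_pre_length_space_def)

lemma refl: "x \<in> topspace T \<Longrightarrow> causal_le l x x"
  using time_sep by (simp add: time_separation_def causal_le_def)

lemma antisym:
  "x \<in> topspace T \<Longrightarrow> y \<in> topspace T \<Longrightarrow> causal_le l x y \<Longrightarrow> causal_le l y x \<Longrightarrow> x = y"
  using simple by (simp add: causally_simple_def causal_space_def)

text \<open>Between causally related points \<open>l\<close> is nonnegative, so
  \<open>lor_plus\<close> is ordinary addition and \<open>lor_dist\<close> is \<open>l\<close>
  itself. For unrelated points the inequality can fail for \<open>lor_dist\<close>, hence the two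
  causal hypotheses.\<close>

lemma reverse_triangle:
  assumes "x \<in> topspace T" "y \<in> topspace T" "z \<in> topspace T"
    and "causal_le l x y" "causal_le l y z"
  shows "lor_dist l x y + lor_dist l y z \<le> lor_dist l x z" and "causal_le l x z"
proof -
  have "lor_plus (l x y) (l y z) \<le> l x z"
    using time_sep assms(1-3) by (simp add: time_separation_def)
  moreover have "0 \<le> l x y" "0 \<le> l y z"
    using assms(4,5) by (auto simp: causal_le_def)
  ultimately have *: "l x y + l y z \<le> l x z" "0 \<le> l x y + l y z"
    by (auto simp: lor_plus_def)
  then show "causal_le l x z"
    unfolding causal_le_def by (rule order_trans[rotated])
  with * assms(4,5) show "lor_dist l x y + lor_dist l y z \<le> lor_dist l x z"
    by (simp add: lor_dist_eq_if_causal_le)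
qed

lemma trans:
  "x \<in> topspace T \<Longrightarrow> y \<in> topspace T \<Longrightarrow> z \<in> topspace T \<Longrightarrow>
    causal_le l x y \<Longrightarrow> causal_le l y z \<Longrightarrow> causal_le l x z"
  by (rule reverse_triangle)

lemma lor_dist_mono_right:
  assumes "x \<in> topspace T" "y \<in> topspace T" "z \<in> topspace T"
    and "causal_le l x y" "causal_le l y z"
  shows "lor_dist l x y \<le> lor_dist l x z"
  using reverse_triangle(1)[OF assms] lor_dist_nonneg[of l y z]
  by (metis add.right_neutral add_left_mono order_trans)

lemma lor_dist_mono_left:
  assumes "x \<in> topspace T" "y \<in> topspace T" "z \<in> topspace T"
    and "causal_le l x y" "causal_le l y z"
  shows "lor_dist l y z \<le> lor_dist l x z"
  using reverse_triangle(1)[OF assms] lor_dist_nonneg[of l x y]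
  by (metis add.left_neutral add_right_mono order_trans)

lemma chron_causal_trans:
  assumes "x \<in> topspace T" "y \<in> topspace T" "z \<in> topspace T"
    and "chron_less l x y" "causal_le l y z"
  shows "chron_less l x z"
  using lor_dist_mono_right[OF assms(1-3) chron_less_imp_causal_le[OF assms(4)] assms(5)] assms(4)
  by (simp add: chron_less_def)

lemma causal_chron_trans:
  assumes "x \<in> topspace T" "y \<in> topspace T" "z \<in> topspace T"
    and "causal_le l x y" "chron_less l y z"
  shows "chron_less l x z"
  using lor_dist_mono_left[OF assms(1-4) chron_less_imp_causal_le[OF assms(5)]] assms(5)
  by (simp add: chron_less_def)

text \<open>Causal simplicity makes the cone \<open>J_plus T l y\<close> closed, and it holds almost
  all \<open>x j\<close>. This lemma and its mirror image, combined with \<open>antisym\<close>, are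
  the means by which limits are identified below.\<close>

lemma accumulation_point_ge:
  assumes "seq_accumulation_point T x p" and "y \<in> topspace T"
    and "\<And>j. x j \<in> topspace T" and "\<forall>\<^sub>\<infinity>j. causal_le l y (x j)"
  shows "causal_le l y p"
proof -
  have "closedin T (J_plus T l y)"
    using simple assms(2) by (simp add: causally_simple_def)
  from seq_accumulation_point_closedin[OF assms(1) this] assms(3,4) show ?thesis
    by (simp add: J_plus_def)
qed

lemma accumulation_point_le:
  assumes "seq_accumulation_point T x p" and "y \<in> topspace T"
    and "\<And>j. x j \<in> topspace T" and "\<forall>\<^sub>\<infinity>j. causal_le l (x j) y"
  shows "causal_le l p y"
  using causally_simple_space.accumulation_point_ge[OF rev assms(1-3)] assms(4) by simp

end

lemma limitin_imp_accumulation_point: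
  assumes "limitin T x p sequentially"
  shows "seq_accumulation_point T x p"
  using assms unfolding limitin_def seq_accumulation_point_def cofinite_eq_sequentially
  by (simp add: eventually_frequently)

lemma seq_accumulation_point_subseq:
  assumes acc: "seq_accumulation_point T (x \<circ> r) p" and r: "strict_mono (r :: nat \<Rightarrow> nat)"
  shows "seq_accumulation_point T x p"
  unfolding seq_accumulation_point_def
proof (intro conjI allI impI)
  show "p \<in> topspace T"
    using acc by (simp add: seq_accumulation_point_def)
  fix U assume "openin T U \<and> p \<in> U"
  then have "infinite {j. x (r j) \<in> U}"
    using acc by (simp add: seq_accumulation_point_def INFM_iff_infinite)
  moreover have "r ` {j. x (r j) \<in> U} \<subseteq> {j. x j \<in> U}"
    by auto
  ultimately show "\<exists>\<^sub>\<infinity>j. x j \<in> U"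
    unfolding INFM_iff_infinite
    by (meson finite_imageD inj_on_subset finite_subset r strict_mono_imp_inj_on subset_UNIV)
qed

section \<open>Finite compactness and timelike Cauchy completeness\<close>

definition future_finitely_compact :: "'a topology \<Rightarrow> ('a \<Rightarrow> 'a \<Rightarrow> ereal) \<Rightarrow> bool" where
  "future_finitely_compact T l \<longleftrightarrow>
     (\<forall>(B::real) x y xs. 0 < B \<and> x \<in> topspace T \<and> y \<in> topspace T \<and> range xs \<subseteq> topspace T \<and>
        chron_less l x y \<and> (\<forall>j. causal_le l y (xs j) \<and> lor_dist l x (xs j) \<le> ereal B)
        \<longrightarrow> (\<exists>p. seq_accumulation_point T xs p))"

lemma finitely_compact_iff:
  "finitely_compact T l \<longleftrightarrow> future_finitely_compact T l \<and> future_finitely_compact T (rev_sep l)"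
  unfolding finitely_compact_def future_finitely_compact_def rev_sep_simps by meson

definition future_timelike_cauchy_complete :: "'a topology \<Rightarrow> ('a \<Rightarrow> 'a \<Rightarrow> ereal) \<Rightarrow> bool" where
  "future_timelike_cauchy_complete T l \<longleftrightarrow>
     (\<forall>xs. range xs \<subseteq> topspace T \<and> (\<forall>j. chron_less l (xs j) (xs (Suc j))) \<and>
        (\<lambda>j. SUP k. lor_dist l (xs j) (xs (j + k))) \<longlonglongrightarrow> 0
        \<longrightarrow> (\<exists>p. limitin T xs p sequentially))"

lemma timelike_cauchy_complete_iff:
  "timelike_cauchy_complete T l \<longleftrightarrow>
     future_timelike_cauchy_complete T l \<and> future_timelike_cauchy_complete T (rev_sep l)"
  unfolding timelike_cauchy_complete_def future_timelike_cauchy_complete_def rev_sep_simps by meson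

context causally_simple_space
begin

lemma chron_chain_le:
  assumes "\<And>j. x j \<in> topspace T" and "\<And>j. chron_less l (x j) (x (Suc j))" and "i \<le> j"
  shows "causal_le l (x i) (x j)"
  using \<open>i \<le> j\<close>
proof (induction j rule: dec_induct)
  case base
  then show ?case by (simp add: refl assms(1))
next
  case (step n)
  then show ?case
    using trans[of "x i" "x n" "x (Suc n)"] assms(1) chron_less_imp_causal_le[OF assms(2)[of n]]
    by simp
qed

text \<open>A Cauchy chain has a tail at bounded distance from one of its points, so finite
  compactness gives every subsequence an accumulation point. Each such point lies above the whole
  chain, so any two lie above each other and agree. A sequence all of whose subsequences accumulate
  at the same single point converges to it.\<close>

lemma finitely_compact_imp_cauchy_complete:
  assumes fc: "future_finitely_compact T l"
  shows "future_timelike_cauchy_complete T l"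
  unfolding future_timelike_cauchy_complete_def
proof (intro allI impI, elim conjE)
  fix x
  assume "range x \<subseteq> topspace T" and chain: "\<forall>j. chron_less l (x j) (x (Suc j))"
    and lim: "(\<lambda>j. SUP k. lor_dist l (x j) (x (j + k))) \<longlonglongrightarrow> 0"
  then have xT: "\<And>j. x j \<in> topspace T"
    by blast
  have le: "causal_le l (x i) (x j)" if "i \<le> j" for i j
    using chron_chain_le[of x] xT chain that by blast
  have "\<forall>\<^sub>F j in sequentially. (SUP k. lor_dist l (x j) (x (j + k))) < 1"
    using order_tendstoD(2)[OF lim, of 1] by simp
  then obtain i where i: "(SUP k. lor_dist l (x i) (x (i + k))) < 1"
    by (auto simp: eventually_sequentially)
  have bd: "lor_dist l (x i) (x (i + k)) \<le> ereal 1" for k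
    using order.trans[OF SUP_upper[of k UNIV "\<lambda>k. lor_dist l (x i) (x (i + k))"] less_imp_le[OF i]]
    by (simp add: one_ereal_def[symmetric])
  have acc: "\<exists>p. seq_accumulation_point T (x \<circ> r) p" if r: "strict_mono r" for r :: "nat \<Rightarrow> nat"
  proof -
    \<comment> \<open>Finite compactness needs all points after \<open>x (Suc i)\<close>. A strictly
      increasing \<open>r\<close> satisfies \<open>n \<le> r n\<close>, so dropping
      \<open>Suc i\<close> terms of the subsequence achieves this.\<close>
    define s where "s = (\<lambda>j. r (j + Suc i))"
    have s: "Suc i \<le> s j" for j
      using strict_mono_imp_increasing[OF r, of "j + Suc i"] by (simp add: s_def)
    have "causal_le l (x (Suc i)) (x (s j))" "lor_dist l (x i) (x (s j)) \<le> ereal 1" for j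
      using le[OF s] bd[of "s j - i"] s[of j] by auto
    then have "\<exists>p. seq_accumulation_point T (x \<circ> s) p"
      using fc[unfolded future_finitely_compact_def, rule_format, of 1 "x i" "x (Suc i)" "x \<circ> s"]
        xT chain by auto
    moreover have "x \<circ> s = (x \<circ> r) \<circ> (\<lambda>j. j + Suc i)"
      by (auto simp: s_def)
    ultimately show ?thesis
      using seq_accumulation_point_subseq[of T "x \<circ> r" "\<lambda>j. j + Suc i"]
      by (auto simp: strict_mono_def)
  qed
  have upper: "causal_le l (x j) p" if "seq_accumulation_point T x p" for p j
    using accumulation_point_ge[OF that xT xT] le MOST_nat_le by blast
  have unique: "p = q" if "seq_accumulation_point T x p" "seq_accumulation_point T x q" for p q
  proof (rule antisym)
    show "p \<in> topspace T" "q \<in> topspace T"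
      using that by (auto simp: seq_accumulation_point_def)
    then show "causal_le l p q" "causal_le l q p"
      using accumulation_point_le[OF that(1) _ xT] accumulation_point_le[OF that(2) _ xT]
        upper[OF that(1)] upper[OF that(2)] by auto
  qed
  obtain p where p: "seq_accumulation_point T x p"
    using acc[of id] by (auto simp: strict_mono_def)
  have "limitin T x p sequentially"
    unfolding limitin_def
  proof (intro conjI allI impI, goal_cases)
    case 1
    then show ?case using p by (simp add: seq_accumulation_point_def)
  next
    case (2 U)
    show ?case
    proof (rule ccontr)
      \<comment> \<open>The terms outside \<open>U\<close> would form a subsequence accumulating in
        the closed complement of \<open>U\<close>, which the unique accumulation point
        \<open>p\<close> avoids.\<close>
      assume "\<not> (\<forall>\<^sub>F j in sequentially. x j \<in> U)"
      then have "infinite {j. x j \<notin> U}"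
        by (simp add: cofinite_eq_sequentially[symmetric] eventually_cofinite)
      from infinite_enumerate[OF this] obtain r :: "nat \<Rightarrow> nat"
        where r: "strict_mono r" "\<And>n. x (r n) \<notin> U"
        by auto
      obtain q where q: "seq_accumulation_point T (x \<circ> r) q"
        using acc[OF r(1)] by blast
      with r have "q = p"
        using unique[OF seq_accumulation_point_subseq p] by blast
      moreover have "q \<in> topspace T - U"
        using 2 xT r(2) by (intro seq_accumulation_point_closedin[OF q]) (auto simp: closedin_diff)
      ultimately show False using 2 by blast
    qed
  qed
  then show "\<exists>p. limitin T x p sequentially" ..
qed

end

section \<open>Open ends of curves\<close>

definition open_end :: "real set \<Rightarrow> bool" where
  "open_end I \<longleftrightarrow> (\<forall>t\<in>I. \<exists>s\<in>I. t < s)"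

text \<open>Convergence towards the upper end of \<open>I\<close>, expressed by tails inside
  \<open>I\<close> so that bounded and unbounded intervals are treated alike.\<close>

definition end_limit :: "'a topology \<Rightarrow> real set \<Rightarrow> (real \<Rightarrow> 'a) \<Rightarrow> 'a \<Rightarrow> bool" where
  "end_limit T I \<gamma> p \<longleftrightarrow>
     p \<in> topspace T \<and> (\<forall>W. openin T W \<and> p \<in> W \<longrightarrow> (\<exists>t\<in>I. \<forall>s\<in>I. t \<le> s \<longrightarrow> \<gamma> s \<in> W))"

lemma not_sup_attained_imp_open_end: "\<not> sup_attained I \<Longrightarrow> open_end I"
proof (rule ccontr)
  assume sup: "\<not> sup_attained I" and "\<not> open_end I"
  then obtain t where t: "t \<in> I" "\<And>s. s \<in> I \<Longrightarrow> s \<le> t"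
    by (auto simp: open_end_def not_less)
  then have "Sup (ereal ` I) = ereal t"
    by (intro cSup_eq_maximum) auto
  with t(1) sup show False
    by (simp add: sup_attained_def)
qed

text \<open>As the supremum is not attained, \<open>t\<close> lies strictly below it, and the
  extended reals above \<open>ereal t\<close> form a neighbourhood of the supremum, be it finite or
  infinite.\<close>

lemma eventually_toward_sup:
  assumes "\<not> sup_attained I" and "t \<in> I" and P: "\<And>s. s \<in> I \<Longrightarrow> t < s \<Longrightarrow> P s"
  shows "eventually P (toward_sup I)"
proof -
  have "ereal t \<le> Sup (ereal ` I)"
    using assms(2) by (intro Sup_upper) simp
  moreover have "ereal t \<noteq> Sup (ereal ` I)"
    using assms(1,2) by (metis imageI sup_attained_def)
  ultimately have "ereal t < Sup (ereal ` I)"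
    by simp
  then have "\<forall>\<^sub>F e in at (Sup (ereal ` I)) within ereal ` I. ereal t < e"
    by (rule order_tendstoD(1)[OF tendsto_ident_at])
  moreover have "\<forall>\<^sub>F e in at (Sup (ereal ` I)) within ereal ` I. e \<in> ereal ` I"
    by (simp add: eventually_at_filter)
  ultimately have "\<forall>\<^sub>F e in at (Sup (ereal ` I)) within ereal ` I. ereal t < e \<and> e \<in> ereal ` I"
    by (rule eventually_conj)
  then show ?thesis
    unfolding toward_sup_def eventually_filtercomap using P by force
qed

text \<open>The predicate \<open>P\<close> is meant for points at which something goes wrong, such
  as lying outside a neighbourhood: a failure recurring along \<open>I\<close> becomes a single
  sequence running to the end of \<open>I\<close>.\<close>

lemma cofinal_sequence:
  assumes "open_end I" and "I \<noteq> {}" and P: "\<And>t. t \<in> I \<Longrightarrow> \<exists>s\<in>I. t < s \<and> P s"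
  shows "\<exists>f::nat \<Rightarrow> real. strict_mono f \<and> (\<forall>n. f n \<in> I \<and> P (f n)) \<and> (\<forall>t\<in>I. \<exists>n. t < f n)"
proof -
  obtain g :: "nat \<Rightarrow> ereal" where g: "range g \<subseteq> ereal ` I" "Sup (ereal ` I) = (SUP n. g n)"
    using Sup_countable_SUP[of "ereal ` I"] assms(2) by blast
  then have "\<forall>n. \<exists>t\<in>I. g n = ereal t"
    by blast
  then obtain h where h: "\<And>n. h n \<in> I" "\<And>n. g n = ereal (h n)"
    by metis
  have next_point: "\<exists>s. (s \<in> I \<and> P s \<and> h (Suc n) < s) \<and> t < s" if "t \<in> I" for t n
  proof -
    \<comment> \<open>Passing the maximum keeps the chosen points strictly increasing and beyond
      \<open>h\<close>, whose values have the supremum of \<open>I\<close> as their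
      supremum.\<close>
    have "max t (h (Suc n)) \<in> I"
      using that h(1) by (simp add: max_def)
    from P[OF this] show ?thesis
      by auto
  qed
  have "\<exists>f. \<forall>n. (f n \<in> I \<and> P (f n) \<and> h n < f n) \<and> f n < f (Suc n)"
  proof (rule dependent_nat_choice)
    show "\<exists>s. s \<in> I \<and> P s \<and> h 0 < s"
      using P[OF h(1)] by blast
  next
    fix t n
    assume "t \<in> I \<and> P t \<and> h n < t"
    then show "\<exists>s. (s \<in> I \<and> P s \<and> h (Suc n) < s) \<and> t < s"
      using next_point[of t n] by simp
  qed
  then obtain f where f: "\<And>n. f n \<in> I \<and> P (f n) \<and> h n < f n" "\<And>n. f n < f (Suc n)"
    by blast
  have "\<exists>n. t < f n" if t: "t \<in> I" for t
  proof -
    obtain s where s: "s \<in> I" "t < s"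
      using assms(1) t unfolding open_end_def by blast
    then have "ereal t < Sup (ereal ` I)"
      using less_le_trans[of "ereal t" "ereal s"] Sup_upper[of "ereal s" "ereal ` I"] by simp
    then obtain n where "ereal t < g n"
      using g(2) by (auto simp: less_SUP_iff)
    then show ?thesis
      using f(1)[of n] h(2)[of n] by (intro exI[of _ n]) auto
  qed
  with f show ?thesis
    by (metis strict_mono_Suc_iff)
qed

section \<open>Curves described by neighbourhoods, and abstract classes of curves\<close>

lemma cont_curve_iff:
  "cont_curve T I \<gamma> \<longleftrightarrow> is_interval I \<and> I \<noteq> {} \<and> (\<forall>t\<in>I. \<gamma> t \<in> topspace T) \<and>
     (\<forall>t\<in>I. \<forall>W. openin T W \<and> \<gamma> t \<in> W \<longrightarrow> (\<exists>U. open U \<and> t \<in> U \<and> (\<forall>s\<in>U \<inter> I. \<gamma> s \<in> W)))"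
  (is "?l \<longleftrightarrow> ?r")
proof -
  have "continuous_map (top_of_set I) T \<gamma> \<longleftrightarrow> (\<forall>t\<in>I. \<gamma> t \<in> topspace T) \<and>
     (\<forall>t\<in>I. \<forall>W. openin T W \<and> \<gamma> t \<in> W \<longrightarrow> (\<exists>U. openin (top_of_set I) U \<and> t \<in> U \<and> (\<forall>s\<in>U. \<gamma> s \<in> W)))"
    unfolding continuous_map_eq_topcontinuous_at topcontinuous_at_def by auto
  also have "\<dots> \<longleftrightarrow> (\<forall>t\<in>I. \<gamma> t \<in> topspace T) \<and>
     (\<forall>t\<in>I. \<forall>W. openin T W \<and> \<gamma> t \<in> W \<longrightarrow> (\<exists>U. open U \<and> t \<in> U \<and> (\<forall>s\<in>U \<inter> I. \<gamma> s \<in> W)))"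
    unfolding openin_open by (intro conj_cong refl ball_cong all_cong imp_cong) blast
  finally show ?thesis
    unfolding cont_curve_def by simp
qed

lemma cont_curve_topspace: "cont_curve T I \<gamma> \<Longrightarrow> t \<in> I \<Longrightarrow> \<gamma> t \<in> topspace T"
  by (simp add: cont_curve_iff)

lemma timelike_curve_imp_causal_curve: "timelike_curve C l I \<gamma> \<Longrightarrow> causal_curve C l I \<gamma>"
  by (simp add: timelike_curve_def causal_curve_def chron_less_imp_causal_le)

text \<open>What the order argument demands of a class of curves. The assumption
  \<open>extend\<close> hides the reparametrization: a limit is simply attached to a continuous
  curve on a bounded interval, while a Lipschitz curve must first be given a parameter in which it
  stays Lipschitz at its end.\<close>

locale curve_space = causally_simple_space T l
  for C :: "'a curve_class" and T :: "'a topology" and l :: "'a \<Rightarrow> 'a \<Rightarrow> ereal" +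
  assumes continuous: "C I \<gamma> \<Longrightarrow> cont_curve T I \<gamma>"
    and extend: "causal_curve C l I \<gamma> \<Longrightarrow> open_end I \<Longrightarrow> end_limit T I \<gamma> p \<Longrightarrow>
      \<forall>t\<in>I. causal_le l (\<gamma> t) p \<Longrightarrow> future_extendible C l I \<gamma>"
begin

lemma causal_curve_topspace:
  assumes "causal_curve C l I \<gamma>" "t \<in> I"
  shows "\<gamma> t \<in> topspace T"
  using assms continuous[of I \<gamma>] cont_curve_topspace[of T I \<gamma> t] by (simp add: causal_curve_def)

lemma causal_curve_le:
  assumes "causal_curve C l I \<gamma>" "t \<in> I" "s \<in> I" "t \<le> s"
  shows "causal_le l (\<gamma> t) (\<gamma> s)"
proof (cases "t = s")
  case True
  then show ?thesis
    using refl[OF causal_curve_topspace[OF assms(1,2)]] by simp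
qed (use assms in \<open>auto simp: causal_curve_def\<close>)

lemma cofinal_accumulation_point_ge:
  assumes \<gamma>: "causal_curve C l I \<gamma>" and f: "\<And>n. f n \<in> I" "strict_mono (f :: nat \<Rightarrow> real)"
    and cof: "\<forall>t\<in>I. \<exists>n. t < f n" and acc: "seq_accumulation_point T (\<gamma> \<circ> f) p" and "t \<in> I"
  shows "causal_le l (\<gamma> t) p"
proof (rule accumulation_point_ge[OF acc])
  obtain n where n: "t < f n"
    using cof \<open>t \<in> I\<close> by blast
  have "causal_le l (\<gamma> t) ((\<gamma> \<circ> f) j)" if "n \<le> j" for j
    using causal_curve_le[OF \<gamma> \<open>t \<in> I\<close> f(1)[of j]] n strict_mono_mono[OF f(2), THEN monoD, OF that]
    by simp
  then show "\<forall>\<^sub>\<infinity>j. causal_le l (\<gamma> t) ((\<gamma> \<circ> f) j)"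
    using MOST_nat_le by blast
qed (use causal_curve_topspace[OF \<gamma>] f(1) \<open>t \<in> I\<close> in auto)

text \<open>If \<gamma> did not converge to \<open>p\<close>, a cofinal sequence would avoid some
  neighbourhood of \<open>p\<close>; by assumption this sequence has an accumulation point, which
  antisymmetry forces to be \<open>p\<close>.\<close>

lemma end_limit_unique_accumulation:
  assumes \<gamma>: "causal_curve C l I \<gamma>" and I: "open_end I" "I \<noteq> {}" and p: "p \<in> topspace T"
    and acc: "\<And>f::nat \<Rightarrow> real. strict_mono f \<Longrightarrow> (\<And>n. f n \<in> I) \<Longrightarrow> (\<forall>t\<in>I. \<exists>n. t < f n) \<Longrightarrow>
      \<exists>q. seq_accumulation_point T (\<gamma> \<circ> f) q \<and> causal_le l q p \<and> causal_le l p q"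
  shows "end_limit T I \<gamma> p"
proof (rule ccontr)
  assume "\<not> end_limit T I \<gamma> p"
  then obtain W where W: "openin T W" "p \<in> W" and "\<And>t. t \<in> I \<Longrightarrow> \<exists>s\<in>I. t \<le> s \<and> \<gamma> s \<notin> W"
    using p by (auto simp: end_limit_def)
  then have "\<exists>s\<in>I. t < s \<and> \<gamma> s \<notin> W" if "t \<in> I" for t
    using I(1) that unfolding open_end_def by (meson less_le_trans)
  from cofinal_sequence[OF I this] obtain f :: "nat \<Rightarrow> real"
    where f: "strict_mono f" "\<And>n. f n \<in> I" "\<And>n. \<gamma> (f n) \<notin> W" "\<forall>t\<in>I. \<exists>n. t < f n"
    by blast
  obtain q where q: "seq_accumulation_point T (\<gamma> \<circ> f) q" "q = p"
    using acc[OF f(1,2,4)] antisym[OF _ p] by (auto simp: seq_accumulation_point_def)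
  then have "\<exists>\<^sub>\<infinity>j. \<gamma> (f j) \<in> W"
    using W by (auto simp: seq_accumulation_point_def)
  with f(3) show False by simp
qed

section \<open>Cauchy complete timelike curves\<close>

text \<open>The distances \<open>g n\<close> from the starting point increase and are bounded, hence
  converge to some \<open>L\<close>. The reverse triangle inequality bounds the distance from the
  \<open>j\<close>-th point to any later one by \<open>L - g j\<close>, which tends to zero.\<close>

lemma timelike_sequence_converges:
  assumes tcc: "future_timelike_cauchy_complete T l" and \<gamma>: "timelike_curve C l I \<gamma>"
    and t0: "t0 \<in> I" and bd: "\<forall>t\<in>{t0..} \<inter> I. lor_dist l (\<gamma> t0) (\<gamma> t) \<le> ereal B"
    and f: "strict_mono (f :: nat \<Rightarrow> real)" "\<And>n. f n \<in> I" "\<And>n. t0 < f n"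
  shows "\<exists>p. limitin T (\<gamma> \<circ> f) p sequentially"
proof -
  note causal = timelike_curve_imp_causal_curve[OF \<gamma>]
  define g where "g = (\<lambda>n. real_of_ereal (lor_dist l (\<gamma> t0) (\<gamma> (f n))))"
  have g: "lor_dist l (\<gamma> t0) (\<gamma> (f n)) = ereal (g n)" "g n \<le> B" for n
  proof -
    have *: "lor_dist l (\<gamma> t0) (\<gamma> (f n)) \<le> ereal B"
      using bd f(2,3)[of n] by auto
    then show "lor_dist l (\<gamma> t0) (\<gamma> (f n)) = ereal (g n)"
      using lor_dist_nonneg[of l "\<gamma> t0" "\<gamma> (f n)"]
      by (cases "lor_dist l (\<gamma> t0) (\<gamma> (f n))") (auto simp: g_def)
    with * show "g n \<le> B" by simp
  qed
  have add: "ereal (g j) + lor_dist l (\<gamma> (f j)) (\<gamma> (f k)) \<le> ereal (g k)" if "j \<le> k" for j k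
    unfolding g(1)[symmetric]
    using f(3)[of j] strict_mono_mono[OF f(1), THEN monoD, OF that]
    by (intro reverse_triangle(1) causal_curve_topspace[OF causal] causal_curve_le[OF causal] t0 f(2))
      simp_all
  have "incseq g"
  proof (rule monoI)
    fix j k :: nat assume "j \<le> k"
    from add[OF this] lor_dist_nonneg[of l "\<gamma> (f j)" "\<gamma> (f k)"] show "g j \<le> g k"
      by (cases "lor_dist l (\<gamma> (f j)) (\<gamma> (f k))") auto
  qed
  then obtain L where L: "g \<longlonglongrightarrow> L" "\<And>n. g n \<le> L"
    using incseq_convergent[of g B] g(2) by blast
  have le: "lor_dist l (\<gamma> (f j)) (\<gamma> (f (j + k))) \<le> ereal (L - g j)" for j k
    using add[of j "j + k"] L(2)[of "j + k"]
    by (cases "lor_dist l (\<gamma> (f j)) (\<gamma> (f (j + k)))") auto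
  have "(\<lambda>j. SUP k. lor_dist l (\<gamma> (f j)) (\<gamma> (f (j + k)))) \<longlonglongrightarrow> 0"
  proof (rule tendsto_sandwich[of "\<lambda>_. 0" _ _ "\<lambda>j. ereal (L - g j)"])
    have "(\<lambda>j. L - g j) \<longlonglongrightarrow> L - L"
      by (intro tendsto_intros L(1))
    then show "(\<lambda>j. ereal (L - g j)) \<longlonglongrightarrow> 0"
      by (simp add: zero_ereal_def)
  qed (auto intro!: always_eventually SUP_least le SUP_upper2 lor_dist_nonneg)
  moreover have "chron_less l (\<gamma> (f j)) (\<gamma> (f (Suc j)))" for j
    using \<gamma> f by (simp add: timelike_curve_def strict_mono_Suc_iff)
  moreover have "range (\<gamma> \<circ> f) \<subseteq> topspace T"
    using causal_curve_topspace[OF causal] f(2) by auto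
  ultimately show ?thesis
    using tcc[unfolded future_timelike_cauchy_complete_def, rule_format, of "\<gamma> \<circ> f"] by auto
qed

definition (in -) future_condition_B :: "'a curve_class \<Rightarrow> ('a \<Rightarrow> 'a \<Rightarrow> ereal) \<Rightarrow> bool" where
  "future_condition_B C l \<longleftrightarrow>
     (\<forall>I \<gamma>. timelike_curve C l I \<gamma> \<and> \<not> future_extendible C l I \<gamma> \<longrightarrow> future_cauchy_complete l I \<gamma>)"

lemma cauchy_complete_imp_condition_B:
  assumes tcc: "future_timelike_cauchy_complete T l"
  shows "future_condition_B C l"
  unfolding future_condition_B_def future_cauchy_complete_def
proof (intro allI impI, elim conjE bexE exE, rule ccontr)
  fix I \<gamma> t0 B
  assume \<gamma>: "timelike_curve C l I \<gamma>" and inext: "\<not> future_extendible C l I \<gamma>"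
    and t0: "t0 \<in> I" and bd: "\<forall>t\<in>{t0..} \<inter> I. lor_dist l (\<gamma> t0) (\<gamma> t) \<le> ereal B"
    and "\<not> sup_attained I"
  then have I: "open_end I" "I \<noteq> {}"
    using not_sup_attained_imp_open_end by auto
  note causal = timelike_curve_imp_causal_curve[OF \<gamma>]
  have tail: "\<exists>p. limitin T (\<gamma> \<circ> f) p sequentially"
    if f: "strict_mono f" "\<And>n. f n \<in> I" "\<forall>t\<in>I. \<exists>n. t < f n" for f :: "nat \<Rightarrow> real"
  proof -
    \<comment> \<open>The distance bound holds only after \<open>t0\<close>; the finitely many
      earlier terms do not affect the limit.\<close>
    obtain n where n: "t0 < f n"
      using f(3) t0 by blast
    have "\<exists>p. limitin T (\<gamma> \<circ> (\<lambda>k. f (k + n))) p sequentially"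
    proof (rule timelike_sequence_converges[OF tcc \<gamma> t0 bd])
      show "t0 < f (k + n)" for k
        using n strict_mono_mono[OF f(1), THEN monoD, of n "k + n"] by simp
    qed (use f in \<open>auto simp: strict_mono_def\<close>)
    then show ?thesis
      using limitin_sequentially_offset_rev[of T "\<gamma> \<circ> f" n] by (auto simp: o_def)
  qed
  have "\<exists>s\<in>I. t < s \<and> True" if "t \<in> I" for t
    using I(1) that by (simp add: open_end_def)
  from cofinal_sequence[OF I this] obtain f :: "nat \<Rightarrow> real"
    where f: "strict_mono f" "\<And>n. f n \<in> I" "\<forall>t\<in>I. \<exists>n. t < f n"
    by blast
  obtain p where "limitin T (\<gamma> \<circ> f) p sequentially"
    using tail[OF f] by blast
  then have p: "seq_accumulation_point T (\<gamma> \<circ> f) p"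
    by (rule limitin_imp_accumulation_point)
  then have pT: "p \<in> topspace T"
    by (simp add: seq_accumulation_point_def)
  have le_p: "causal_le l (\<gamma> t) p" if "t \<in> I" for t
    by (rule cofinal_accumulation_point_ge[OF causal f(2,1,3) p that])
  have "end_limit T I \<gamma> p"
  proof (rule end_limit_unique_accumulation[OF causal I pT])
    fix h :: "nat \<Rightarrow> real" assume h: "strict_mono h" "\<And>n. h n \<in> I" "\<forall>t\<in>I. \<exists>n. t < h n"
    obtain q where "limitin T (\<gamma> \<circ> h) q sequentially"
      using tail[OF h] by blast
    then have q: "seq_accumulation_point T (\<gamma> \<circ> h) q"
      by (rule limitin_imp_accumulation_point)
    have "causal_le l (\<gamma> t) q" if "t \<in> I" for t
      by (rule cofinal_accumulation_point_ge[OF causal h(2,1,3) q that])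
    \<comment> \<open>Each of the two limits bounds the whole curve from above, in particular the
      sequence converging to the other limit.\<close>
    with le_p have "causal_le l q p" "causal_le l p q"
      using accumulation_point_le[OF q pT] accumulation_point_le[OF p, of q] q
        causal_curve_topspace[OF causal] f(2) h(2) by (auto simp: seq_accumulation_point_def)
    with q show "\<exists>q. seq_accumulation_point T (\<gamma> \<circ> h) q \<and> causal_le l q p \<and> causal_le l p q"
      by blast
  qed
  with extend[OF causal I(1)] le_p inext show False
    by blast
qed

end

section \<open>Escape of inextendible causal curves\<close>

text \<open>The points \<open>w j\<close> are chosen chronologically before \<open>y j\<close> on a timelike curve;
  the neighbourhoods \<open>U j\<close> make every upper limit point of \<open>w\<close> an upper bound of \<open>y\<close>.\<close>

definition capturing :: "'a topology \<Rightarrow> ('a \<Rightarrow> 'a \<Rightarrow> ereal) \<Rightarrow> (nat \<Rightarrow> 'a) \<Rightarrow> (nat \<Rightarrow> 'a set) \<Rightarrow> bool" where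
  "capturing T l y U \<longleftrightarrow> (\<forall>j. openin T (U j) \<and> y j \<in> U j) \<and>
     (\<forall>w p. (\<forall>j. w j \<in> U j \<and> causal_le l (w j) p) \<and> limitin T w p sequentially \<longrightarrow>
        (\<forall>j. causal_le l (y j) p))"

text \<open>A timelike curve from \<open>x\<close> to \<open>y\<close> is in \<open>U\<close>
  shortly before it arrives, and its interior points lie chronologically between its ends.\<close>

lemma (in curve_space) chron_less_dense:
  assumes path: "timelike_path_connected C T l"
    and "x \<in> topspace T" "y \<in> topspace T" "chron_less l x y" "openin T U" "y \<in> U"
  shows "\<exists>z\<in>U. chron_less l x z \<and> chron_less l z y"
proof -
  obtain a b c where c: "a < b" "timelike_curve C l {a..b} c" "c a = x" "c b = y"
    using path assms(2-4) unfolding timelike_path_connected_def by blast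
  then have "cont_curve T {a..b} c"
    using continuous by (simp add: timelike_curve_def)
  then obtain V where V: "open V" "b \<in> V" "\<forall>s\<in>V \<inter> {a..b}. c s \<in> U"
    using assms(5,6) c(1,4) unfolding cont_curve_iff by (metis atLeastAtMost_iff less_imp_le order_refl)
  then obtain e where e: "e > 0" "ball b e \<subseteq> V"
    by (meson open_contains_ball)
  \<comment> \<open>The midpoint keeps \<open>s\<close> after \<open>a\<close>, and
    \<open>b - e / 2\<close> keeps it in the ball around \<open>b\<close>.\<close>
  define s where "s = max ((a + b) / 2) (b - e / 2)"
  have s: "a < s" "s < b" "s \<in> V"
    using e(1) c(1) subsetD[OF e(2), of s] by (auto simp: s_def dist_real_def max_def field_simps)
  then show ?thesis
    using V(3) c by (intro bexI[of _ "c s"]) (auto simp: timelike_curve_def)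
qed

text \<open>The first four assumptions allow timelike segments to be joined into one admissible ray,
  \<open>diamond\<close> supplies accumulation points of the given causal curve, and
  \<open>capture\<close> supplies the neighbourhoods that tie the ray to this curve.\<close>

locale escape_space = curve_space C T l
  for C :: "'a curve_class" and T :: "'a topology" and l :: "'a \<Rightarrow> 'a \<Rightarrow> ereal" +
  assumes cong: "C I \<gamma> \<Longrightarrow> (\<And>t. t \<in> I \<Longrightarrow> \<gamma> t = \<gamma>' t) \<Longrightarrow> C I \<gamma>'"
    and affine: "C {a..b} \<gamma> \<Longrightarrow> a < b \<Longrightarrow> C {c..c + 1} (\<lambda>t. \<gamma> (a + (t - c) * (b - a)))"
    and concat: "(\<And>n::nat. C {real n..real n + 1} \<gamma>) \<Longrightarrow> C {0..} \<gamma>"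
    and path_connected: "timelike_path_connected C T l"
    and diamond: "x \<in> topspace T \<Longrightarrow> y \<in> topspace T \<Longrightarrow> compactin T (J_plus T l x \<inter> J_minus T l y)"
    and capture: "(\<And>j. u j \<in> topspace T) \<Longrightarrow> (\<And>i j. i \<le> j \<Longrightarrow> causal_le l (u i) (u j)) \<Longrightarrow>
      x \<in> topspace T \<Longrightarrow> chron_less l x (u 0) \<Longrightarrow> \<exists>U. capturing T l u U"
begin

lemma concatenate_timelike:
  assumes zT: "\<And>n. z n \<in> topspace T" and z: "\<And>n. chron_less l (z n) (z (Suc n))"
  shows "\<exists>\<sigma>. timelike_curve C l {0..} \<sigma> \<and> (\<forall>n. \<sigma> (real n) = z n)"
proof -
  have "\<exists>d. C {real n..real n + 1} d \<and>
      (\<forall>t\<in>{real n..real n + 1}. \<forall>s\<in>{real n..real n + 1}. t < s \<longrightarrow> chron_less l (d t) (d s)) \<and>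
      d (real n) = z n \<and> d (real n + 1) = z (Suc n)" for n
  proof -
    obtain a b c where c: "a < b" "timelike_curve C l {a..b} c" "c a = z n" "c b = z (Suc n)"
      using path_connected zT z unfolding timelike_path_connected_def by blast
    define d where "d = (\<lambda>t. c (a + (t - real n) * (b - a)))"
    have "C {real n..real n + 1} d"
      unfolding d_def using c(1,2) by (intro affine) (auto simp: timelike_curve_def)
    moreover have "chron_less l (d t) (d s)"
      if "t \<in> {real n..real n + 1}" "s \<in> {real n..real n + 1}" "t < s" for t s
    proof -
      have "a + (u - real n) * (b - a) \<in> {a..b}" if "u \<in> {real n..real n + 1}" for u
      proof -
        define w where "w = (u - real n) * (b - a)"
        have "w \<le> 1 * (b - a)"
          unfolding w_def using that c(1) by (intro mult_right_mono) auto
        moreover have "0 \<le> w"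
          using that c(1) by (simp add: w_def)
        ultimately show ?thesis
          unfolding w_def[symmetric] by simp
      qed
      moreover have "a + (t - real n) * (b - a) < a + (s - real n) * (b - a)"
        using that c(1) by simp
      ultimately show ?thesis
        using c(2) that unfolding d_def timelike_curve_def by blast
    qed
    moreover have "d (real n) = z n" "d (real n + 1) = z (Suc n)"
      using c(3,4) by (simp_all add: d_def)
    ultimately show ?thesis by blast
  qed
  then obtain d where d: "\<And>n. C {real n..real n + 1} (d n)"
    "\<And>n t s. t \<in> {real n..real n + 1} \<Longrightarrow> s \<in> {real n..real n + 1} \<Longrightarrow> t < s \<Longrightarrow> chron_less l (d n t) (d n s)"
    "\<And>n. d n (real n) = z n" "\<And>n. d n (real n + 1) = z (Suc n)"
    by metis
  \<comment> \<open>At an integer the floor selects the piece starting there. The preceding piece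
    ends at the same point \<open>z\<close>, so \<sigma> agrees with every piece on its whole closed
    interval.\<close>
  define \<sigma> where "\<sigma> = (\<lambda>t. d (nat \<lfloor>t\<rfloor>) t)"
  have \<sigma>: "\<sigma> t = d n t" if "t \<in> {real n..real n + 1}" for n t
  proof (cases "t = real n + 1")
    case True
    then have "nat \<lfloor>t\<rfloor> = Suc n"
      by linarith
    then show ?thesis
      using d(3)[of "Suc n"] d(4)[of n] True by (simp add: \<sigma>_def add.commute)
  next
    case False
    then have "nat \<lfloor>t\<rfloor> = n"
      using that False by (simp add: floor_eq_iff nat_eq_iff)
    then show ?thesis
      by (simp add: \<sigma>_def)
  qed
  have \<sigma>z: "\<sigma> (real n) = z n" for n
    using \<sigma>[of "real n" n] d(3) by simp
  have "C {real n..real n + 1} \<sigma>" for n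
    by (rule cong[OF d(1)]) (simp add: \<sigma>)
  then have C\<sigma>: "C {0..} \<sigma>"
    by (rule concat)
  have \<sigma>T: "\<sigma> t \<in> topspace T" if "0 \<le> t" for t
    using cont_curve_topspace[OF continuous[OF C\<sigma>]] that by simp
  have piece: "chron_less l (\<sigma> t) (\<sigma> s)" if "t \<in> {real n..real n + 1}" "s \<in> {real n..real n + 1}" "t < s" for n t s
    using \<sigma>[OF that(1)] \<sigma>[OF that(2)] d(2)[OF that] by simp
  have "chron_less l (\<sigma> t) (\<sigma> s)" if ts: "0 \<le> t" "t < s" for t s
  proof -
    define n m where "n = nat \<lfloor>t\<rfloor>" and "m = nat \<lfloor>s\<rfloor>"
    have n: "real n \<le> t" "t < real n + 1" and m: "real m \<le> s" "s < real m + 1"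
      using ts by (simp_all add: n_def m_def)
    \<comment> \<open>Parameters in different unit intervals are compared through the integers
      \<open>n + 1\<close> and \<open>m\<close>. The first leg is chronological, so causal relations
      suffice for the rest.\<close>
    show ?thesis
    proof (cases "s \<le> real n + 1")
      case True
      then show ?thesis
        using n ts by (intro piece[of t n s]) auto
    next
      case False
      then have "Suc n \<le> m"
        using m by linarith
      moreover have n1: "real n + 1 = real (Suc n)"
        by simp
      ultimately have "causal_le l (\<sigma> (real n + 1)) (\<sigma> (real m))"
        using chron_chain_le[of z "Suc n" m] zT z unfolding n1 \<sigma>z by blast
      moreover have "chron_less l (\<sigma> t) (\<sigma> (real n + 1))"
        using n by (intro piece[of t n]) auto
      ultimately have *: "chron_less l (\<sigma> t) (\<sigma> (real m))"
        using chron_causal_trans[OF \<sigma>T[of t] \<sigma>T[of "real n + 1"] \<sigma>T[of "real m"]] ts by simp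
      show ?thesis
      proof (cases "s = real m")
        case False
        then have "chron_less l (\<sigma> (real m)) (\<sigma> s)"
          using m by (intro piece[of _ m]) auto
        with * show ?thesis
          using chron_causal_trans[OF \<sigma>T[of t] \<sigma>T[of "real m"] \<sigma>T[of s]] ts
          by (simp add: chron_less_imp_causal_le)
      qed (use * in simp)
    qed
  qed
  with C\<sigma> \<sigma>z show ?thesis
    by (auto simp: timelike_curve_def)
qed

text \<open>In the extension the parameters \<phi>(n) increase and stay below some \<open>t\<close>
  in the interval \<open>J\<close>. Their limit \<open>L\<close> therefore lies in \<open>J\<close>,
  possibly well before \<open>t\<close>, and continuity of the extension at \<open>L\<close> gives
  the limit of \<sigma>.\<close>

lemma future_extendible_limit:
  assumes ext: "future_extendible C l {0..} \<sigma>"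
  shows "\<exists>p. limitin T (\<lambda>n. \<sigma> (real n)) p sequentially \<and> (\<forall>n::nat. causal_le l (\<sigma> (real n)) p)"
proof -
  obtain \<phi> \<psi> I' J \<gamma>' t where homeo: "homeomorphism {0..} I' \<phi> \<psi>" and mono: "strict_mono_on {0..} \<phi>"
    and J: "is_interval J" "I' \<subseteq> J" "t \<in> J" "\<forall>s\<in>I'. s < t"
    and \<gamma>': "causal_curve C l J \<gamma>'" "\<forall>s\<in>I'. \<gamma>' s = \<sigma> (\<psi> s)"
    using ext unfolding future_extendible_def by (elim exE conjE bexE) (rule that)
  have img: "\<phi> u \<in> I'" and \<psi>\<phi>: "\<psi> (\<phi> u) = u" if "0 \<le> u" for u
    using homeo that unfolding homeomorphism_def by auto
  have \<sigma>: "\<sigma> (real n) = \<gamma>' (\<phi> (real n))" for n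
    using \<gamma>'(2) img[of "real n"] \<psi>\<phi>[of "real n"] by simp
  have incr: "\<phi> u < \<phi> v" if "0 \<le> u" "u < v" for u v
    using strict_mono_onD[OF mono, of u v] that by simp
  have "incseq (\<lambda>n. \<phi> (real n))"
    using incr by (intro incseq_SucI less_imp_le) simp
  moreover have "\<phi> (real n) \<le> t" for n
    using J(4) img[of "real n"] by (simp add: less_imp_le)
  ultimately obtain L where L: "(\<lambda>n. \<phi> (real n)) \<longlonglongrightarrow> L" "\<And>n. \<phi> (real n) \<le> L"
    using incseq_convergent[of "\<lambda>n. \<phi> (real n)" t] by blast
  have lt: "\<phi> (real n) < L" for n
    using incr[of "real n" "real (Suc n)"] L(2)[of "Suc n"] by simp
  have "L \<le> t"
    using L(1) \<open>\<And>n. \<phi> (real n) \<le> t\<close> by (meson LIMSEQ_le_const2)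
  then have LJ: "L \<in> J"
    using mem_is_interval_1_I[OF J(1), of "\<phi> 0" t L] J(2,3) img[of 0] lt[of 0] by auto
  have "limitin (top_of_set J) (\<lambda>n. \<phi> (real n)) L sequentially"
    using L(1) LJ J(2) img by (auto simp: limitin_subtopology intro!: always_eventually)
  moreover have "continuous_map (top_of_set J) T \<gamma>'"
    using continuous \<gamma>'(1) by (simp add: causal_curve_def cont_curve_def)
  ultimately have "limitin T (\<gamma>' \<circ> (\<lambda>n. \<phi> (real n))) (\<gamma>' L) sequentially"
    by (rule continuous_map_limit[rotated])
  moreover have "causal_le l (\<sigma> (real n)) (\<gamma>' L)" for n
    unfolding \<sigma> using lt J(2) img[of "real n"] LJ
    by (intro causal_curve_le[OF \<gamma>'(1)]) (auto simp: less_imp_le)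
  ultimately show ?thesis
    by (auto simp: o_def \<sigma>)
qed

text \<open>The core of the passage from Condition B to Condition A*: as Condition B applies to
  timelike curves, it is applied to a ray \<sigma> running before \<gamma>, and the conclusion is
  carried back to \<gamma>.\<close>

lemma bounded_causal_curve_extendible:
  assumes B: "future_condition_B C l"
    and \<gamma>: "causal_curve C l I \<gamma>" and I: "open_end I" and t0: "t0 \<in> I"
    and x: "x \<in> topspace T" "chron_less l x (\<gamma> t0)"
    and bd: "\<And>t. t \<in> I \<Longrightarrow> t0 \<le> t \<Longrightarrow> lor_dist l x (\<gamma> t) \<le> ereal b"
  shows "future_extendible C l I \<gamma>"
proof -
  have "\<exists>s\<in>I. t < s \<and> t0 < s" if "t \<in> I" for t
    using I t0 that unfolding open_end_def by (metis less_trans linorder_neqE_linordered_idom)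
  from cofinal_sequence[OF I _ this] obtain f :: "nat \<Rightarrow> real"
    where f: "strict_mono f" "\<And>n. f n \<in> I" "\<And>n. t0 < f n" "\<forall>t\<in>I. \<exists>n. t < f n"
    using t0 by blast
  define y where "y = \<gamma> \<circ> f"
  have yT: "y j \<in> topspace T" for j
    using causal_curve_topspace[OF \<gamma> f(2)] by (simp add: y_def)
  have y_le: "causal_le l (y i) (y j)" if "i \<le> j" for i j
    using causal_curve_le[OF \<gamma> f(2,2)] strict_mono_mono[OF f(1), THEN monoD, OF that]
    by (simp add: y_def)
  have xy: "chron_less l x (y j)" for j
    using chron_causal_trans[OF x(1) causal_curve_topspace[OF \<gamma> t0] yT x(2)]
      causal_curve_le[OF \<gamma> t0 f(2)] f(3)[of j] by (simp add: y_def less_imp_le)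
  obtain U where U: "capturing T l y U"
    using capture[of y x] yT y_le x(1) xy by blast
  \<comment> \<open>The indices are offset: \<open>z (Suc n)\<close> is taken in \<open>U n\<close>
    and before \<open>y n\<close>, which places it before \<open>y (Suc n)\<close> and keeps the
    induction going. Starting at \<open>x\<close> lets the bound on distances from \<open>x\<close>
    speak about \<sigma>.\<close>
  have "\<exists>z. \<forall>n. (z n \<in> topspace T \<and> chron_less l (z n) (y n) \<and> (n = 0 \<longrightarrow> z n = x)) \<and>
      (chron_less l (z n) (z (Suc n)) \<and> chron_less l (z (Suc n)) (y n) \<and> z (Suc n) \<in> U n)"
  proof (rule dependent_nat_choice)
    show "\<exists>z. z \<in> topspace T \<and> chron_less l z (y 0) \<and> (0 = 0 \<longrightarrow> z = x)"
      using x(1) xy by blast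
    fix z and n :: nat
    assume z: "z \<in> topspace T \<and> chron_less l z (y n) \<and> (n = 0 \<longrightarrow> z = x)"
    have Un: "openin T (U n)" "y n \<in> U n"
      using U by (auto simp: capturing_def)
    obtain z' where z': "z' \<in> U n" "chron_less l z z'" "chron_less l z' (y n)"
      using chron_less_dense[OF path_connected _ yT _ Un] z by blast
    moreover have "z' \<in> topspace T"
      using z'(1) Un(1) openin_subset by blast
    moreover have "chron_less l z' (y (Suc n))"
      using chron_causal_trans[OF \<open>z' \<in> topspace T\<close> yT yT z'(3) y_le] by simp
    ultimately show "\<exists>z'. (z' \<in> topspace T \<and> chron_less l z' (y (Suc n)) \<and> (Suc n = 0 \<longrightarrow> z' = x)) \<and>
        chron_less l z z' \<and> chron_less l z' (y n) \<and> z' \<in> U n"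
      by blast
  qed
  then obtain z where z: "\<And>n. z n \<in> topspace T" "\<And>n. chron_less l (z n) (y n)" "z 0 = x"
    "\<And>n. chron_less l (z n) (z (Suc n))" "\<And>n. z (Suc n) \<in> U n"
    by blast
  obtain \<sigma> where \<sigma>: "timelike_curve C l {0..} \<sigma>" "\<And>n. \<sigma> (real n) = z n"
    using concatenate_timelike[of z] z(1,4) by blast
  note \<sigma>_causal = timelike_curve_imp_causal_curve[OF \<sigma>(1)]
  \<comment> \<open>Up to parameter \<open>n\<close> the ray stays before \<open>z n\<close>, hence
    before \<open>y n\<close>, so its distance from \<open>x\<close> is at most that of a point of
    \<gamma>.\<close>
  have "lor_dist l (\<sigma> 0) (\<sigma> t) \<le> ereal b" if "0 \<le> t" for t
  proof -
    obtain n :: nat where n: "t \<le> real n"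
      using real_arch_simple by blast
    have "lor_dist l x (\<sigma> t) \<le> lor_dist l x (y n)"
    proof (rule lor_dist_mono_right)
      show "causal_le l x (\<sigma> t)"
        using causal_curve_le[OF \<sigma>_causal, of 0 t] that \<sigma>(2)[of 0] z(3) by simp
      have "causal_le l (\<sigma> t) (z n)"
        using causal_curve_le[OF \<sigma>_causal, of t "real n"] that n \<sigma>(2)[of n] by simp
      then show "causal_le l (\<sigma> t) (y n)"
        using trans[OF causal_curve_topspace[OF \<sigma>_causal] z(1) yT] that z(2)
        by (simp add: chron_less_imp_causal_le)
    qed (use x(1) yT causal_curve_topspace[OF \<sigma>_causal] that in auto)
    also have "\<dots> \<le> ereal b"
      using bd f(2,3) by (simp add: y_def less_imp_le)
    finally show ?thesis
      using \<sigma>(2)[of 0] z(3) by simp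
  qed
  \<comment> \<open>A bounded ray on an unbounded parameter interval violates the conclusion of
    Condition B, so it must be extendible.\<close>
  moreover have "\<not> sup_attained {0..}"
  proof
    assume "sup_attained {0..}"
    then obtain u where "0 \<le> u" "Sup (ereal ` {0..}) = ereal u"
      by (auto simp: sup_attained_def)
    moreover have "ereal (u + 1) \<le> Sup (ereal ` {0..})"
      using \<open>0 \<le> u\<close> by (intro Sup_upper) simp
    ultimately show False by simp
  qed
  ultimately have "\<not> future_cauchy_complete l {0..} \<sigma>"
    unfolding future_cauchy_complete_def by (auto intro!: bexI[of _ 0])
  then have "future_extendible C l {0..} \<sigma>"
    using B \<sigma>(1) unfolding future_condition_B_def by blast
  then obtain p where lim: "limitin T z p sequentially" and zp: "\<And>n. causal_le l (z n) p"
    using future_extendible_limit[of \<sigma>] by (auto simp: \<sigma>(2))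
  then have pT: "p \<in> topspace T"
    by (simp add: limitin_topspace)
  have yp: "causal_le l (y j) p" for j
  proof -
    \<comment> \<open>The shifted sequence is the one lying in the neighbourhoods \<open>U\<close>;
      its limit \<open>p\<close> therefore dominates \<gamma> and not only \<sigma>.\<close>
    have "limitin T (\<lambda>n. z (Suc n)) p sequentially"
      using limitin_sequentially_offset[OF lim, of 1] by simp
    with z(5) zp show ?thesis
      using U[unfolded capturing_def, THEN conjunct2, rule_format, of "\<lambda>n. z (Suc n)" p j] by blast
  qed
  have \<gamma>p: "causal_le l (\<gamma> t) p" if t: "t \<in> I" for t
  proof -
    obtain n where "t < f n"
      using f(4) t by blast
    then have "causal_le l (\<gamma> t) (y n)"
      using causal_curve_le[OF \<gamma> t f(2)] by (simp add: y_def)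
    then show ?thesis
      using trans[OF causal_curve_topspace[OF \<gamma> t] yT pT] yp by blast
  qed
  have "end_limit T I \<gamma> p"
  proof (rule end_limit_unique_accumulation[OF \<gamma> I _ pT])
    fix h :: "nat \<Rightarrow> real" assume h: "strict_mono h" "\<And>n. h n \<in> I" "\<forall>t\<in>I. \<exists>n. t < h n"
    have hT: "\<And>n. \<gamma> (h n) \<in> topspace T"
      using causal_curve_topspace[OF \<gamma> h(2)] .
    have "(\<gamma> \<circ> h) n \<in> J_plus T l (\<gamma> (h 0)) \<inter> J_minus T l p" for n
      using hT \<gamma>p[OF h(2)] causal_curve_le[OF \<gamma> h(2,2)] strict_mono_mono[OF h(1), THEN monoD, of 0 n]
      by (simp add: J_plus_def J_minus_def)
    then obtain q where q: "seq_accumulation_point T (\<gamma> \<circ> h) q"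
      using compactin_seq_accumulation_point[OF diamond[OF hT pT]] by blast
    then have qT: "q \<in> topspace T"
      by (simp add: seq_accumulation_point_def)
    \<comment> \<open>The accumulation point \<open>q\<close> of \<gamma> lies above every
      \<open>y n\<close>, hence above every \<open>z n\<close> and their limit \<open>p\<close>;
      conversely \<open>p\<close> bounds \<gamma> and therefore \<open>q\<close>.\<close>
    have "causal_le l (y n) q" for n
      using cofinal_accumulation_point_ge[OF \<gamma> h(2,1,3) q f(2)] by (simp add: y_def)
    then have "causal_le l (z n) q" for n
      by (rule trans[OF z(1) yT qT chron_less_imp_causal_le[OF z(2)]])
    then have "causal_le l p q"
      using accumulation_point_le[OF limitin_imp_accumulation_point[OF lim] qT z(1)] by simp
    moreover have "causal_le l q p"
      using accumulation_point_le[OF q pT] hT \<gamma>p[OF h(2)] by simp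
    ultimately show "\<exists>q. seq_accumulation_point T (\<gamma> \<circ> h) q \<and> causal_le l q p \<and> causal_le l p q"
      using q by blast
  qed (use t0 in blast)
  then show ?thesis
    using extend[OF \<gamma> I] \<gamma>p by blast
qed

definition (in -) future_escape ::
  "(real set \<Rightarrow> (real \<Rightarrow> 'a) \<Rightarrow> bool) \<Rightarrow> 'a curve_class \<Rightarrow> 'a topology \<Rightarrow> ('a \<Rightarrow> 'a \<Rightarrow> ereal) \<Rightarrow> bool" where
  "future_escape P C T l \<longleftrightarrow>
     (\<forall>x\<in>topspace T. \<forall>y\<in>topspace T. chron_less l x y \<longrightarrow>
        (\<forall>I \<gamma>. P I \<gamma> \<and> \<not> future_extendible C l I \<gamma> \<and> 0 \<in> I \<and> \<gamma> 0 = y \<longrightarrow>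
           ((\<lambda>t. lor_dist l x (\<gamma> t)) \<longlongrightarrow> \<infinity>) (toward_sup I) \<or> sup_attained I))"

text \<open>Distances from \<open>x\<close> grow along \<gamma>, so exceeding a value once means
  exceeding it from then on; unboundedness and divergence to infinity coincide.\<close>

lemma condition_B_imp_escape:
  assumes B: "future_condition_B C l"
  shows "future_escape (causal_curve C l) C T l"
  unfolding future_escape_def
proof (intro ballI allI impI, elim conjE, rule disjCI)
  fix x y I \<gamma>
  assume x: "x \<in> topspace T" "chron_less l x y" and \<gamma>: "causal_curve C l I \<gamma>" "\<gamma> 0 = y"
    and inext: "\<not> future_extendible C l I \<gamma>" and I: "0 \<in> I" "\<not> sup_attained I"
  show "((\<lambda>t. lor_dist l x (\<gamma> t)) \<longlongrightarrow> \<infinity>) (toward_sup I)"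
    unfolding tendsto_PInfty
  proof
    fix r :: real
    have "\<exists>t\<in>I. 0 \<le> t \<and> ereal r < lor_dist l x (\<gamma> t)"
      using bounded_causal_curve_extendible[OF B \<gamma>(1) not_sup_attained_imp_open_end[OF I(2)] I(1) x(1)]
        x(2) \<gamma>(2) inext by (metis not_le)
    then obtain t where t: "t \<in> I" "0 \<le> t" "ereal r < lor_dist l x (\<gamma> t)"
      by blast
    have "causal_le l x (\<gamma> t)"
      using x chron_causal_trans[of x y "\<gamma> t"] causal_curve_le[OF \<gamma>(1) I(1) t(1,2)] \<gamma>(2)
        causal_curve_topspace[OF \<gamma>(1)] I(1) t(1) by (auto intro!: chron_less_imp_causal_le)
    then have "ereal r < lor_dist l x (\<gamma> s)" if "s \<in> I" "t < s" for s
      using lor_dist_mono_right[OF x(1) causal_curve_topspace[OF \<gamma>(1) t(1)] causal_curve_topspace[OF \<gamma>(1) that(1)]]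
        causal_curve_le[OF \<gamma>(1) t(1) that(1)] that(2) t(3) by (simp add: less_le_trans)
    with eventually_toward_sup[OF I(2) t(1)]
    show "\<forall>\<^sub>F t in toward_sup I. ereal r < lor_dist l x (\<gamma> t)" .
  qed
qed

end

section \<open>Time reversal\<close>

definition reverse_curve :: "(real \<Rightarrow> 'a) \<Rightarrow> real \<Rightarrow> 'a" where
  "reverse_curve \<gamma> t = \<gamma> (- t)"

lemma reverse_reverse_curve [simp]: "reverse_curve (reverse_curve \<gamma>) = \<gamma>"
  by (simp add: reverse_curve_def fun_eq_iff)

definition reversible :: "'a curve_class \<Rightarrow> bool" where
  "reversible C \<longleftrightarrow> (\<forall>I \<gamma>. C I \<gamma> \<longrightarrow> C (uminus ` I) (reverse_curve \<gamma>))"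

lemma causal_curve_reverse:
  assumes "reversible C"
  shows "causal_curve C (rev_sep l) (uminus ` I) (reverse_curve \<gamma>) \<longleftrightarrow> causal_curve C l I \<gamma>"
proof -
  have "C (uminus ` I) (reverse_curve \<gamma>) \<longleftrightarrow> C I \<gamma>"
    using assms[unfolded reversible_def, rule_format, of I \<gamma>]
      assms[unfolded reversible_def, rule_format, of "uminus ` I" "reverse_curve \<gamma>"]
    by (auto simp: image_image)
  then show ?thesis
    unfolding causal_curve_def by (auto simp: reverse_curve_def)
qed

lemma timelike_curve_reverse:
  assumes "reversible C"
  shows "timelike_curve C (rev_sep l) (uminus ` I) (reverse_curve \<gamma>) \<longleftrightarrow> timelike_curve C l I \<gamma>"
proof -
  have "C (uminus ` I) (reverse_curve \<gamma>) \<longleftrightarrow> C I \<gamma>"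
    using assms[unfolded reversible_def, rule_format, of I \<gamma>]
      assms[unfolded reversible_def, rule_format, of "uminus ` I" "reverse_curve \<gamma>"]
    by (auto simp: image_image)
  then show ?thesis
    unfolding timelike_curve_def by (auto simp: reverse_curve_def)
qed

lemma homeomorphism_uminus: "homeomorphism (S :: real set) (uminus ` S) uminus uminus"
  by (auto simp: homeomorphism_def image_image intro!: continuous_intros)

lemma is_interval_uminus: "is_interval (S :: real set) \<Longrightarrow> is_interval (uminus ` S)"
  by (simp add: is_interval_neg_translationI[of S 0, simplified])

text \<open>Extendibility with the position of the new parameter left open: one reversal lemma then
  covers both directions of time.\<close>

definition extendible_beyond ::
  "(real \<Rightarrow> real \<Rightarrow> bool) \<Rightarrow> 'a curve_class \<Rightarrow> ('a \<Rightarrow> 'a \<Rightarrow> ereal) \<Rightarrow> real set \<Rightarrow> (real \<Rightarrow> 'a) \<Rightarrow> bool" where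
  "extendible_beyond R C l I \<gamma> \<longleftrightarrow>
     (\<exists>\<phi> \<psi> I' J \<gamma>'.
        is_interval I' \<and> homeomorphism I I' \<phi> \<psi> \<and> strict_mono_on I \<phi> \<and>
        is_interval J \<and> I' \<subseteq> J \<and> (\<exists>t\<in>J. \<forall>s\<in>I'. R s t) \<and>
        causal_curve C l J \<gamma>' \<and> (\<forall>s\<in>I'. \<gamma>' s = \<gamma> (\<psi> s)))"

lemma extendible_beyond_reverse:
  assumes C: "reversible C" and ext: "extendible_beyond R C l I \<gamma>"
    and R: "\<And>s t. R s t \<Longrightarrow> R' (- s) (- t)"
  shows "extendible_beyond R' C (rev_sep l) (uminus ` I) (reverse_curve \<gamma>)"
proof -
  obtain \<phi> \<psi> I' J \<gamma>' t where h: "is_interval I'" "homeomorphism I I' \<phi> \<psi>"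
    and mono: "strict_mono_on I \<phi>"
    and J: "is_interval J" "I' \<subseteq> J" "t \<in> J" "\<forall>s\<in>I'. R s t"
    and \<gamma>': "causal_curve C l J \<gamma>'" "\<forall>s\<in>I'. \<gamma>' s = \<gamma> (\<psi> s)"
    using ext unfolding extendible_beyond_def by (elim exE conjE bexE) (rule that)
  have "homeomorphism (uminus ` I) I (uminus :: real \<Rightarrow> real) uminus"
    using homeomorphism_uminus[of I] by (simp add: homeomorphism_symD)
  \<comment> \<open>The reflected reparametrization sends t to -\<phi>(-t); reflecting on both sides
    preserves monotonicity.\<close>
  from homeomorphism_compose[OF homeomorphism_compose[OF this h(2)] homeomorphism_uminus]
  have "homeomorphism (uminus ` I) (uminus ` I') (uminus \<circ> (\<phi> \<circ> uminus)) ((uminus \<circ> \<psi>) \<circ> uminus)"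
    by (simp add: o_assoc)
  moreover have "strict_mono_on (uminus ` I) (uminus \<circ> (\<phi> \<circ> uminus))"
    using mono by (auto simp: strict_mono_on_def)
  moreover have "causal_curve C (rev_sep l) (uminus ` J) (reverse_curve \<gamma>')"
    using causal_curve_reverse[OF C] \<gamma>'(1) by blast
  moreover have "\<exists>t\<in>uminus ` J. \<forall>s\<in>uminus ` I'. R' s t"
    using J(3,4) R by blast
  moreover have "\<forall>s\<in>uminus ` I'. reverse_curve \<gamma>' s = reverse_curve \<gamma> (((uminus \<circ> \<psi>) \<circ> uminus) s)"
    using \<gamma>'(2) by (simp add: reverse_curve_def)
  moreover have "is_interval (uminus ` I')" "is_interval (uminus ` J)" "uminus ` I' \<subseteq> uminus ` J"
    using is_interval_uminus h(1) J(1,2) by auto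
  ultimately show ?thesis
    unfolding extendible_beyond_def by blast
qed

lemma future_extendible_eq: "future_extendible C l I \<gamma> = extendible_beyond (\<lambda>s t. s < t) C l I \<gamma>"
  by (simp add: future_extendible_def extendible_beyond_def)

lemma past_extendible_eq: "past_extendible C l I \<gamma> = extendible_beyond (\<lambda>s t. t < s) C l I \<gamma>"
  by (simp add: past_extendible_def extendible_beyond_def)

lemma future_extendible_reverse:
  assumes C: "reversible C"
  shows "future_extendible C (rev_sep l) (uminus ` I) (reverse_curve \<gamma>) \<longleftrightarrow> past_extendible C l I \<gamma>"
proof
  assume "future_extendible C (rev_sep l) (uminus ` I) (reverse_curve \<gamma>)"
  then have "extendible_beyond (\<lambda>s t. t < s) C (rev_sep (rev_sep l)) (uminus ` uminus ` I)
      (reverse_curve (reverse_curve \<gamma>))"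
    unfolding future_extendible_eq by (rule extendible_beyond_reverse[OF C]) simp
  then show "past_extendible C l I \<gamma>"
    by (simp add: past_extendible_eq image_image rev_sep_def[abs_def])
next
  assume "past_extendible C l I \<gamma>"
  then show "future_extendible C (rev_sep l) (uminus ` I) (reverse_curve \<gamma>)"
    unfolding future_extendible_eq past_extendible_eq by (rule extendible_beyond_reverse[OF C]) simp
qed

lemma Inf_uminus_image: "Inf (ereal ` I) = - Sup (ereal ` uminus ` I)"
proof -
  have "ereal ` uminus ` I = uminus ` ereal ` I"
    by (simp add: image_image)
  then show ?thesis
    by (simp add: ereal_Inf_uminus_image_eq[symmetric] image_image ereal_Sup_uminus_image_eq)
qed

lemma sup_attained_uminus: "sup_attained (uminus ` I) \<longleftrightarrow> inf_attained I"
proof -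
  have "- Sup (ereal ` uminus ` I) \<in> ereal ` I \<longleftrightarrow> Sup (ereal ` uminus ` I) \<in> uminus ` ereal ` I"
    by (metis ereal_uminus_uminus imageE imageI)
  moreover have "uminus ` ereal ` I = ereal ` uminus ` I"
    by (simp add: image_image)
  ultimately show ?thesis
    unfolding sup_attained_def inf_attained_def Inf_uminus_image by simp
qed

text \<open>Composing a limit at the supremum of the reflected interval with this reflection gives
  the limit at the infimum of \<open>I\<close>.\<close>

lemma filterlim_uminus_toward: "filterlim uminus (toward_sup (uminus ` I)) (toward_inf I)"
proof -
  let ?A = "ereal ` I" and ?B = "ereal ` uminus ` I"
  have "filterlim uminus (at (Sup ?B) within ?B) (at (Inf ?A) within ?A)"
    unfolding filterlim_at
  proof
    have "((\<lambda>e. - e) \<longlongrightarrow> - Inf ?A) (at (Inf ?A) within ?A)"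
      by (intro tendsto_uminus_ereal tendsto_ident_at)
    then show "(uminus \<longlongrightarrow> Sup ?B) (at (Inf ?A) within ?A)"
      by (simp add: Inf_uminus_image)
    show "\<forall>\<^sub>F e in at (Inf ?A) within ?A. - e \<in> ?B \<and> - e \<noteq> Sup ?B"
      unfolding eventually_at_filter Inf_uminus_image
      by (intro always_eventually allI impI conjI) (auto simp: ereal_uminus_eq_reorder)
  qed
  then show ?thesis
    unfolding filterlim_iff toward_sup_def toward_inf_def eventually_filtercomap
    by (metis uminus_ereal.simps(1))
qed

lemma future_cauchy_complete_reverse:
  "future_cauchy_complete (rev_sep l) (uminus ` I) (reverse_curve \<gamma>) \<longleftrightarrow> past_cauchy_complete l I \<gamma>"
proof -
  have *: "{- t..} \<inter> uminus ` I = uminus ` ({..t} \<inter> I)" for t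
    by force
  show ?thesis
    unfolding future_cauchy_complete_def past_cauchy_complete_def sup_attained_uminus
    by (simp add: * reverse_curve_def)
qed

lemma condition_B_iff_future:
  assumes C: "reversible C"
  shows "condition_B C l \<longleftrightarrow> future_condition_B C l \<and> future_condition_B C (rev_sep l)"
proof -
  have "future_condition_B C (rev_sep l) \<longleftrightarrow>
      (\<forall>I \<gamma>. timelike_curve C (rev_sep l) (uminus ` I) (reverse_curve \<gamma>) \<and>
        \<not> future_extendible C (rev_sep l) (uminus ` I) (reverse_curve \<gamma>) \<longrightarrow>
        future_cauchy_complete (rev_sep l) (uminus ` I) (reverse_curve \<gamma>))" (is "_ \<longleftrightarrow> ?r")
  proof
    \<comment> \<open>Every curve is the reflection of its reflection, so quantifying over reflected
      curves reaches all of them.\<close>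
    assume ?r
    show "future_condition_B C (rev_sep l)"
      unfolding future_condition_B_def
    proof (intro allI)
      fix I :: "real set" and \<gamma> :: "real \<Rightarrow> 'a"
      show "timelike_curve C (rev_sep l) I \<gamma> \<and> \<not> future_extendible C (rev_sep l) I \<gamma> \<longrightarrow>
          future_cauchy_complete (rev_sep l) I \<gamma>"
        using \<open>?r\<close>[rule_format, of "uminus ` I" "reverse_curve \<gamma>"] by (simp add: image_image)
    qed
  qed (simp add: future_condition_B_def)
  then show ?thesis
    unfolding condition_B_def future_condition_B_def[of C l] timelike_curve_reverse[OF C]
      future_extendible_reverse[OF C] future_cauchy_complete_reverse by simp
qed

definition past_escape ::
  "(real set \<Rightarrow> (real \<Rightarrow> 'a) \<Rightarrow> bool) \<Rightarrow> 'a curve_class \<Rightarrow> 'a topology \<Rightarrow> ('a \<Rightarrow> 'a \<Rightarrow> ereal) \<Rightarrow> bool" where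
  "past_escape P C T l \<longleftrightarrow>
     (\<forall>x\<in>topspace T. \<forall>y\<in>topspace T. chron_less l y x \<longrightarrow>
        (\<forall>I \<gamma>. P I \<gamma> \<and> \<not> past_extendible C l I \<gamma> \<and> 0 \<in> I \<and> \<gamma> 0 = y \<longrightarrow>
           ((\<lambda>t. lor_dist l (\<gamma> t) x) \<longlongrightarrow> \<infinity>) (toward_inf I) \<or> inf_attained I))"

lemma condition_A_star_if_future:
  assumes C: "reversible C" and esc: "future_escape (causal_curve C l) C T l"
    "future_escape (causal_curve C (rev_sep l)) C T (rev_sep l)"
  shows "condition_A_star C T l"
proof -
  have "past_escape (causal_curve C l) C T l"
    unfolding past_escape_def
  proof (intro ballI allI impI)
    fix x y I \<gamma>
    assume xy: "x \<in> topspace T" "y \<in> topspace T" "chron_less l y x"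
      and \<gamma>: "causal_curve C l I \<gamma> \<and> \<not> past_extendible C l I \<gamma> \<and> 0 \<in> I \<and> \<gamma> 0 = y"
    then have "causal_curve C (rev_sep l) (uminus ` I) (reverse_curve \<gamma>)"
      "\<not> future_extendible C (rev_sep l) (uminus ` I) (reverse_curve \<gamma>)"
      using future_extendible_reverse[OF C] causal_curve_reverse[OF C] by blast+
    moreover have "0 \<in> uminus ` I" "reverse_curve \<gamma> 0 = y"
      using \<gamma> by (auto simp: reverse_curve_def image_iff)
    ultimately have "((\<lambda>t. lor_dist (rev_sep l) x (reverse_curve \<gamma> t)) \<longlongrightarrow> \<infinity>) (toward_sup (uminus ` I)) \<or>
        sup_attained (uminus ` I)"
      using esc(2) xy unfolding future_escape_def by simp
    moreover have "((\<lambda>t. lor_dist l (\<gamma> t) x) \<longlongrightarrow> \<infinity>) (toward_inf I)"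
      if "((\<lambda>t. lor_dist (rev_sep l) x (reverse_curve \<gamma> t)) \<longlongrightarrow> \<infinity>) (toward_sup (uminus ` I))"
      using filterlim_compose[OF that filterlim_uminus_toward] by (simp add: reverse_curve_def)
    ultimately show "((\<lambda>t. lor_dist l (\<gamma> t) x) \<longlongrightarrow> \<infinity>) (toward_inf I) \<or> inf_attained I"
      by (auto simp: sup_attained_uminus)
  qed
  with esc(1) show ?thesis
    by (simp add: condition_A_star_def escape_condition_def future_escape_def past_escape_def)
qed

lemma condition_A_star_imp_condition_A: "condition_A_star C T l \<Longrightarrow> condition_A C T l"
  by (simp add: condition_A_star_def condition_A_def escape_condition_def causal_geodesic_def)

section \<open>Prolonging a curve by its limit\<close>

text \<open>An increasing homeomorphism of the real line onto (-1, 1): it gives an unbounded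
  interval a finite end to which a limit can be attached.\<close>

definition squash :: "real \<Rightarrow> real" where
  "squash t = t / (1 + \<bar>t\<bar>)"

lemma squash_less_1: "\<bar>squash t\<bar> < 1"
  by (simp add: squash_def abs_if field_simps)

lemma unsquash: "squash t / (1 - \<bar>squash t\<bar>) = t"
proof -
  have "1 + \<bar>t\<bar> > 0" by simp
  then have "\<bar>squash t\<bar> = \<bar>t\<bar> / (1 + \<bar>t\<bar>)" "1 - \<bar>t\<bar> / (1 + \<bar>t\<bar>) = 1 / (1 + \<bar>t\<bar>)"
    by (simp_all add: squash_def abs_divide field_simps)
  then show ?thesis
    using \<open>1 + \<bar>t\<bar> > 0\<close> by (simp add: squash_def)
qed

text \<open>Clearing denominators on the right leaves
  \<open>s - t + \<bar>t\<bar> * s - \<bar>s\<bar> * t\<close>. The last two terms cancel when the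
  signs agree and add up to something nonnegative otherwise. The estimate says that the inverse of
  \<open>squash\<close> is Lipschitz on compact parts of (-1, 1).\<close>

lemma squash_diff:
  assumes "t \<le> s"
  shows "s - t \<le> (1 + \<bar>s\<bar>) * (1 + \<bar>t\<bar>) * (squash s - squash t)"
proof -
  have p: "1 + \<bar>t\<bar> > 0" "1 + \<bar>s\<bar> > 0"
    by simp_all
  have "(1 + \<bar>s\<bar>) * (1 + \<bar>t\<bar>) * (squash s - squash t) =
      (1 + \<bar>t\<bar>) * ((1 + \<bar>s\<bar>) * squash s) - (1 + \<bar>s\<bar>) * ((1 + \<bar>t\<bar>) * squash t)"
    by (simp add: algebra_simps)
  also have "\<dots> = (1 + \<bar>t\<bar>) * s - (1 + \<bar>s\<bar>) * t"
    using p by (simp add: squash_def)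
  also have "\<dots> \<ge> s - t"
  proof (cases "0 \<le> t \<or> s \<le> 0")
    case False
    then have "0 \<le> s * (- t)" by (intro mult_nonneg_nonneg) auto
    with False show ?thesis by (simp add: algebra_simps)
  qed (use assms in \<open>auto simp: algebra_simps\<close>)
  finally show ?thesis .
qed

lemma squash_mono: "t \<le> s \<Longrightarrow> squash t \<le> squash s"
  using squash_diff[of t s]
  by (smt (verit) mult_pos_pos mult_nonneg_nonpos2 mult.commute abs_ge_zero mult_pos_neg)

lemma continuous_on_squash: "continuous_on S squash"
  unfolding squash_def by (intro continuous_intros) (auto simp: add_nonneg_eq_0_iff)

text \<open>The growth condition makes the inverse reparametrization locally Lipschitz.\<close>

locale reparametrization =
  fixes I :: "real set" and \<phi> :: "real \<Rightarrow> real"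
  assumes interval: "is_interval I" and nonempty: "I \<noteq> {}" and end_open: "open_end I"
    and cont: "continuous_on I \<phi>"
    and expand: "t \<in> I \<Longrightarrow> s \<in> I \<Longrightarrow> t \<le> s \<Longrightarrow> squash s - squash t \<le> \<phi> s - \<phi> t"
    and bounded: "bdd_above (\<phi> ` I)"
begin

definition \<psi> :: "real \<Rightarrow> real" where "\<psi> = inv_into I \<phi>"

definition top :: real where "top = Sup (\<phi> ` I)"

lemma strict_mono: "strict_mono_on I \<phi>"
proof (rule strict_mono_onI)
  fix t s assume ts: "t \<in> I" "s \<in> I" "t < s"
  then have "squash t \<noteq> squash s"
    using squash_diff[of t s] by auto
  then have "squash t < squash s"
    using squash_mono[of t s] ts(3) by simp
  then show "\<phi> t < \<phi> s"
    using expand[OF ts(1,2)] ts(3) by simp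
qed

lemma \<psi>_\<phi>: "t \<in> I \<Longrightarrow> \<psi> (\<phi> t) = t"
  unfolding \<psi>_def by (rule inv_into_f_f[OF strict_mono_on_imp_inj_on[OF strict_mono]])

lemma le_iff: "t \<in> I \<Longrightarrow> s \<in> I \<Longrightarrow> \<phi> t \<le> \<phi> s \<longleftrightarrow> t \<le> s"
  using strict_mono_onD[OF strict_mono] by (metis less_eq_real_def not_less order_less_irrefl)

lemma less_top: "t \<in> I \<Longrightarrow> \<phi> t < top"
proof -
  assume t: "t \<in> I"
  then obtain s where "s \<in> I" "t < s"
    using end_open unfolding open_end_def by blast
  then have "\<phi> t < \<phi> s" "\<phi> s \<le> top"
    using strict_mono_onD[OF strict_mono t] cSup_upper[OF _ bounded] by (auto simp: top_def)
  then show ?thesis by simp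
qed

lemma top_approx: "u < top \<Longrightarrow> \<exists>t\<in>I. u < \<phi> t"
  unfolding top_def using less_cSup_iff[OF _ bounded, of u] nonempty by auto

lemma interval_image: "is_interval (\<phi> ` I)"
  using connected_continuous_image[OF cont] interval by (simp add: is_interval_connected_1)

lemma interval_insert_top: "is_interval (insert top (\<phi> ` I))"
  unfolding is_interval_1
proof (intro ballI allI impI)
  fix a b u assume a: "a \<in> insert top (\<phi> ` I)" and b: "b \<in> insert top (\<phi> ` I)" and u: "a \<le> u \<and> u \<le> b"
  show "u \<in> insert top (\<phi> ` I)"
  proof (cases "u < top")
    case True
    then obtain t where "t \<in> I" "u < \<phi> t"
      using top_approx by blast
    moreover have "a \<in> \<phi> ` I"
      using a u True by auto
    ultimately have "u \<in> \<phi> ` I"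
      using mem_is_interval_1_I[OF interval_image, of a "\<phi> t" u] u by auto
    then show ?thesis by simp
  next
    case False
    then have "u = top"
      using b u less_top by fastforce
    then show ?thesis by simp
  qed
qed

text \<open>By \<open>expand\<close>, \<open>squash\<close> after the inverse of \<phi> is
  nonexpanding. Undoing \<open>squash\<close> by its explicit inverse then makes \<psi> continuous,
  and \<open>squash_diff\<close> makes it locally Lipschitz.\<close>

lemma inverse_squash_lipschitz:
  assumes "t \<in> I" "s \<in> I"
  shows "\<bar>squash t - squash s\<bar> \<le> \<bar>\<phi> t - \<phi> s\<bar>"
  using expand[OF assms] expand[OF assms(2,1)] squash_mono[of t s] squash_mono[of s t] by linarith

lemma continuous_inverse: "continuous_on (\<phi> ` I) \<psi>"
proof -
  have "continuous_on (\<phi> ` I) (\<lambda>u. squash (\<psi> u))"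
    unfolding continuous_on_iff dist_real_def
    using inverse_squash_lipschitz by (auto simp: \<psi>_\<phi>) (meson le_less_trans)
  then have "continuous_on (\<phi> ` I) (\<lambda>u. squash (\<psi> u) / (1 - \<bar>squash (\<psi> u)\<bar>))"
    using squash_less_1 by (intro continuous_intros) (auto simp: less_imp_neq[symmetric] diff_eq_eq)
  then show ?thesis
    by (simp add: unsquash)
qed

lemma homeomorphism: "homeomorphism I (\<phi> ` I) \<phi> \<psi>"
  using cont continuous_inverse by (auto simp: homeomorphism_def \<psi>_\<phi> image_image)

lemma inverse_locally_lipschitz:
  assumes "t \<in> I" and V: "open V" "t \<in> V"
  shows "\<exists>U K. open U \<and> \<phi> t \<in> U \<and> 0 \<le> K \<and> (\<forall>s\<in>I. \<phi> s \<in> U \<longrightarrow> s \<in> V) \<and>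
    (\<forall>s\<in>I. \<forall>r\<in>I. \<phi> s \<in> U \<longrightarrow> \<phi> r \<in> U \<longrightarrow> \<bar>s - r\<bar> \<le> K * \<bar>\<phi> s - \<phi> r\<bar>)"
proof -
  have "open (V \<inter> ball t 1)" "\<psi> (\<phi> t) \<in> V \<inter> ball t 1"
    using V assms(1) by (auto simp: \<psi>_\<phi>)
  then obtain U where U: "open U" "\<phi> t \<in> U" "\<forall>v\<in>\<phi> ` I. v \<in> U \<longrightarrow> \<psi> v \<in> V \<inter> ball t 1"
    using continuous_inverse assms(1) unfolding continuous_on_topological by (metis imageI)
  then have near: "s \<in> V" "\<bar>s\<bar> \<le> \<bar>t\<bar> + 1" if "s \<in> I" "\<phi> s \<in> U" for s
    using that \<psi>_\<phi>[OF that(1)] by (fastforce simp: dist_real_def)+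
  \<comment> \<open>Points sent into \<open>U\<close> lie within 1 of \<open>t\<close>, so both
    factors in \<open>squash_diff\<close> are at most \<open>2 + \<bar>t\<bar>\<close>.\<close>
  define K where "K = (2 + \<bar>t\<bar>) * (2 + \<bar>t\<bar>)"
  have *: "s - r \<le> K * \<bar>\<phi> s - \<phi> r\<bar>"
    if sr: "s \<in> I" "r \<in> I" "\<phi> s \<in> U" "\<phi> r \<in> U" "r \<le> s" for s r
  proof -
    have "s - r \<le> (1 + \<bar>s\<bar>) * (1 + \<bar>r\<bar>) * (squash s - squash r)"
      by (rule squash_diff[OF sr(5)])
    also have "\<dots> \<le> K * (squash s - squash r)"
      unfolding K_def using near[OF sr(1,3)] near[OF sr(2,4)] squash_mono[OF sr(5)]
      by (intro mult_right_mono mult_mono) auto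
    also have "\<dots> \<le> K * \<bar>\<phi> s - \<phi> r\<bar>"
      using inverse_squash_lipschitz[OF sr(1,2)] by (intro mult_left_mono) (auto simp: K_def)
    finally show ?thesis .
  qed
  have "\<bar>s - r\<bar> \<le> K * \<bar>\<phi> s - \<phi> r\<bar>" if sr: "s \<in> I" "r \<in> I" "\<phi> s \<in> U" "\<phi> r \<in> U" for s r
    using *[OF sr] *[OF sr(2,1,4,3)] by (cases "r \<le> s") (auto simp: abs_minus_commute)
  moreover have "0 \<le> K"
    by (simp add: K_def)
  ultimately show ?thesis
    using U(1,2) near(1) by blast
qed

definition prolonged :: "(real \<Rightarrow> 'a) \<Rightarrow> 'a \<Rightarrow> real \<Rightarrow> 'a" where
  "prolonged \<gamma> p u = (if u < top then \<gamma> (\<psi> u) else p)"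

lemma prolonged_\<phi>: "t \<in> I \<Longrightarrow> prolonged \<gamma> p (\<phi> t) = \<gamma> t"
  by (simp add: prolonged_def less_top \<psi>_\<phi>)

lemma prolonged_top: "prolonged \<gamma> p top = p"
  by (simp add: prolonged_def)

lemma cont_curve_prolonged:
  assumes \<gamma>: "cont_curve T I \<gamma>" and lim: "end_limit T I \<gamma> p"
  shows "cont_curve T (insert top (\<phi> ` I)) (prolonged \<gamma> p)"
  unfolding cont_curve_iff
proof (intro conjI ballI allI impI, goal_cases)
  case (3 u)
  then show ?case
    using cont_curve_topspace[OF \<gamma>] lim by (auto simp: prolonged_\<phi> prolonged_top end_limit_def)
next
  case (4 u W)
  show ?case
  proof (cases "u = top")
    case True
    then obtain t where t: "t \<in> I" "\<And>s. s \<in> I \<Longrightarrow> t \<le> s \<Longrightarrow> \<gamma> s \<in> W"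
      using lim 4 by (auto simp: end_limit_def prolonged_top)
    have "\<gamma> s \<in> W" if "s \<in> I" "\<phi> t < \<phi> s" for s
      using t(2)[OF that(1)] le_iff[OF t(1) that(1)] that(2) by simp
    then have "prolonged \<gamma> p v \<in> W" if "v \<in> {\<phi> t<..} \<inter> insert top (\<phi> ` I)" for v
      using that 4 True by (auto simp: prolonged_\<phi>)
    then show ?thesis
      using less_top[OF t(1)] True by (intro exI[of _ "{\<phi> t<..}"]) auto
  next
    case False
    then obtain t where t: "t \<in> I" "u = \<phi> t"
      using 4 by auto
    then obtain V where V: "open V" "t \<in> V" "\<forall>s\<in>V \<inter> I. \<gamma> s \<in> W"
      using \<gamma> 4 unfolding cont_curve_iff by (metis prolonged_\<phi>)
    obtain U where U: "open U" "\<phi> t \<in> U" "\<And>s. s \<in> I \<Longrightarrow> \<phi> s \<in> U \<Longrightarrow> s \<in> V"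
      using inverse_locally_lipschitz[OF t(1) V(1,2)] by blast
    have "prolonged \<gamma> p v \<in> W" if "v \<in> (U \<inter> {..<top}) \<inter> insert top (\<phi> ` I)" for v
      using that V(3) U(3) by (auto simp: prolonged_\<phi>)
    then show ?thesis
      using U(1,2) t less_top by (intro exI[of _ "U \<inter> {..<top}"]) auto
  qed
qed (auto simp: interval_insert_top)

text \<open>Shared by both curve classes: \<phi> and its inverse witness extendibility, and each
  class only has to show that the prolonged curve is admissible.\<close>

lemma future_extendible_prolonged:
  assumes \<gamma>: "causal_curve C l I \<gamma>" and le: "\<forall>t\<in>I. causal_le l (\<gamma> t) p"
    and C: "C (insert top (\<phi> ` I)) (prolonged \<gamma> p)"
  shows "future_extendible C l I \<gamma>"
proof -
  have "causal_le l (prolonged \<gamma> p u) (prolonged \<gamma> p v)"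
    if uv: "u \<in> insert top (\<phi> ` I)" "v \<in> insert top (\<phi> ` I)" "u < v" for u v
  proof -
    obtain t where t: "t \<in> I" "u = \<phi> t"
      using uv less_top by (metis imageE insertE less_asym)
    show ?thesis
    proof (cases "v = top")
      case False
      then obtain s where "s \<in> I" "v = \<phi> s"
        using uv by auto
      then show ?thesis
        using t uv(3) \<gamma> le_iff[of s t] by (auto simp: prolonged_\<phi> causal_curve_def not_le[symmetric])
    qed (use t le in \<open>simp add: prolonged_\<phi> prolonged_top\<close>)
  qed
  with C have "causal_curve C l (insert top (\<phi> ` I)) (prolonged \<gamma> p)"
    by (simp add: causal_curve_def)
  moreover have "\<forall>u\<in>\<phi> ` I. prolonged \<gamma> p u = \<gamma> (\<psi> u)" "\<forall>u\<in>\<phi> ` I. u < top"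
    using less_top by (auto simp: prolonged_def)
  ultimately show ?thesis
    unfolding future_extendible_def using interval_image homeomorphism strict_mono interval_insert_top
    by blast
qed

end

text \<open>For continuous curves \<open>squash\<close> itself is the parameter, with
  \<open>expand\<close> holding as an equality.\<close>

lemma cont_curve_extend:
  assumes \<gamma>: "causal_curve (cont_curve T) l I \<gamma>" and I: "open_end I" and lim: "end_limit T I \<gamma> p"
    and le: "\<forall>t\<in>I. causal_le l (\<gamma> t) p"
  shows "future_extendible (cont_curve T) l I \<gamma>"
proof -
  have c: "cont_curve T I \<gamma>"
    using \<gamma> by (simp add: causal_curve_def)
  interpret reparametrization I squash
  proof
    show "is_interval I" "I \<noteq> {}"
      using c by (auto simp: cont_curve_iff)
    show "bdd_above (squash ` I)"
      using squash_less_1 by (intro bdd_aboveI[of _ 1]) (auto simp: abs_less_iff less_imp_le)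
  qed (use I continuous_on_squash in auto)
  show ?thesis
    by (rule future_extendible_prolonged[OF \<gamma> le cont_curve_prolonged[OF c lim]])
qed

section \<open>Arc length as a parameter\<close>

lemma lip_curve_iff:
  "lip_curve \<rho> I \<gamma> \<longleftrightarrow> cont_curve (mtopology_of \<rho>) I \<gamma> \<and>
     (\<forall>t\<in>I. \<exists>U K. open U \<and> t \<in> U \<and> 0 \<le> K \<and>
        (\<forall>s\<in>U \<inter> I. \<forall>r\<in>U \<inter> I. mdist \<rho> (\<gamma> s) (\<gamma> r) \<le> K * \<bar>s - r\<bar>))"
proof -
  have L: "Lipschitz_continuous_map (submetric euclidean_metric (U \<inter> I)) \<rho> \<gamma> \<longleftrightarrow>
      (\<exists>K. 0 \<le> K \<and> (\<forall>s\<in>U \<inter> I. \<forall>r\<in>U \<inter> I. mdist \<rho> (\<gamma> s) (\<gamma> r) \<le> K * \<bar>s - r\<bar>))"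
    if "cont_curve (mtopology_of \<rho>) I \<gamma>" for U
  proof -
    have "\<gamma> \<in> U \<inter> I \<rightarrow> mspace \<rho>"
      using cont_curve_topspace[OF that] by auto
    moreover have "(\<exists>K>0. \<forall>s\<in>U \<inter> I. \<forall>r\<in>U \<inter> I. mdist \<rho> (\<gamma> s) (\<gamma> r) \<le> K * \<bar>s - r\<bar>)"
      if K: "0 \<le> K" "\<forall>s\<in>U \<inter> I. \<forall>r\<in>U \<inter> I. mdist \<rho> (\<gamma> s) (\<gamma> r) \<le> K * \<bar>s - r\<bar>" for K
    \<comment> \<open>The characterization \<open>Lipschitz_continuous_map_pos\<close> asks for a
      positive constant, and \<open>K\<close> may be zero.\<close>
    proof (intro exI[of _ "K + 1"] conjI ballI)
      fix s r assume "s \<in> U \<inter> I" "r \<in> U \<inter> I"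
      then have "mdist \<rho> (\<gamma> s) (\<gamma> r) \<le> K * \<bar>s - r\<bar>"
        using K(2) by blast
      also have "\<dots> \<le> (K + 1) * \<bar>s - r\<bar>"
        by (intro mult_right_mono) auto
      finally show "mdist \<rho> (\<gamma> s) (\<gamma> r) \<le> (K + 1) * \<bar>s - r\<bar>" .
    qed (use K(1) in simp)
    ultimately show ?thesis
      unfolding Lipschitz_continuous_map_pos by (simp add: dist_real_def) (meson less_imp_le)
  qed
  then show ?thesis
    unfolding lip_curve_def
    by (rule_tac conj_cong[OF refl], rule_tac ball_cong[OF refl], simp only: L, blast)
qed

section \<open>Partitions, and the arc length function of a ray of finite length\<close>

definition partition_of :: "(nat \<Rightarrow> real) \<Rightarrow> nat \<Rightarrow> real \<Rightarrow> real \<Rightarrow> bool" where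
  "partition_of q N a b \<longleftrightarrow> q 0 = a \<and> q N = b \<and> (\<forall>i<N. q i < q (Suc i))"

lemma increasing_upto:
  fixes q :: "nat \<Rightarrow> real"
  assumes "\<forall>i<N. q i < q (Suc i)" "i \<le> j" "j \<le> N"
  shows "q i \<le> q j"
  using assms(2,3)
proof (induction j rule: dec_induct)
  case (step n)
  then show ?case
    using assms(1) by (meson Suc_le_lessD less_imp_le order_trans le_SucI Suc_leD)
qed simp

lemma partition_of_between:
  assumes "partition_of q N a b" "i \<le> N"
  shows "q i \<in> {a..b}"
  using assms increasing_upto[of N q 0 i] increasing_upto[of N q i N] by (auto simp: partition_of_def)

text \<open>The length is bounded only from \<open>a\<close> on. In the application this is where
  the curve has entered a neighbourhood of its limit in which causal curves have bounded
  length.\<close>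

locale rectifiable_ray =
  fixes \<rho> :: "'a metric" and I :: "real set" and \<gamma> :: "real \<Rightarrow> 'a" and a C :: real
  assumes lip: "lip_curve \<rho> I \<gamma>" and a: "a \<in> I"
    and sums: "(\<And>i. i \<le> N \<Longrightarrow> q i \<in> I \<inter> {a..}) \<Longrightarrow> (\<And>i. i < N \<Longrightarrow> q i < q (Suc i)) \<Longrightarrow>
      (\<Sum>i<N. mdist \<rho> (\<gamma> (q i)) (\<gamma> (q (Suc i)))) \<le> C"
begin

definition sums_upto :: "real \<Rightarrow> real set" where
  "sums_upto t = {\<Sum>i<N. mdist \<rho> (\<gamma> (q i)) (\<gamma> (q (Suc i))) | N q. partition_of q N a t}"

definition arc :: "real \<Rightarrow> real" where
  "arc t = Sup (sums_upto t)"

lemma interval_I: "is_interval I"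
  using lip by (simp add: lip_curve_def cont_curve_def)

lemma between_I: "t \<in> I \<Longrightarrow> s \<in> {a..t} \<Longrightarrow> s \<in> I"
  using mem_is_interval_1_I[OF interval_I a, of t s] by simp

lemma \<gamma>_mspace: "t \<in> I \<Longrightarrow> \<gamma> t \<in> mspace \<rho>"
  using lip cont_curve_topspace[of "mtopology_of \<rho>" I \<gamma> t] by (simp add: lip_curve_def)

lemma sums_upto_le: "t \<in> I \<Longrightarrow> x \<in> sums_upto t \<Longrightarrow> x \<le> C"
proof -
  assume t: "t \<in> I" and "x \<in> sums_upto t"
  then obtain N q where x: "x = (\<Sum>i<N. mdist \<rho> (\<gamma> (q i)) (\<gamma> (q (Suc i))))" and q: "partition_of q N a t"
    by (auto simp: sums_upto_def)
  show "x \<le> C"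
    unfolding x using partition_of_between[OF q] between_I[OF t] q
    by (intro sums) (auto simp: partition_of_def)
qed

lemma sums_upto_nonempty: "a \<le> t \<Longrightarrow> sums_upto t \<noteq> {}"
proof -
  assume "a \<le> t"
  \<comment> \<open>Partitions are strictly increasing, so the degenerate interval has the partition
    with no step.\<close>
  then have "partition_of (\<lambda>i. if i = 0 then a else t) (if a = t then 0 else 1) a t"
    by (auto simp: partition_of_def)
  then show ?thesis
    unfolding sums_upto_def by blast
qed

lemma sums_upto_bdd: "t \<in> I \<Longrightarrow> bdd_above (sums_upto t)"
  using sums_upto_le by (intro bdd_aboveI)

lemma arc_le: "t \<in> I \<Longrightarrow> a \<le> t \<Longrightarrow> arc t \<le> C"
  unfolding arc_def using sums_upto_nonempty sums_upto_le by (intro cSup_least) auto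

lemma arc_nonneg: "t \<in> I \<Longrightarrow> a \<le> t \<Longrightarrow> 0 \<le> arc t"
proof -
  assume t: "t \<in> I" "a \<le> t"
  then obtain x where x: "x \<in> sums_upto t"
    using sums_upto_nonempty by blast
  then have "0 \<le> x"
    by (auto simp: sums_upto_def intro!: sum_nonneg)
  also have "x \<le> arc t"
    unfolding arc_def using x sums_upto_bdd[OF t(1)] by (rule cSup_upper)
  finally show ?thesis .
qed

text \<open>Appending \<open>s\<close> to a partition ending at \<open>t\<close> gives one ending at
  \<open>s\<close>. Strictness of partitions is the reason for treating \<open>t = s\<close>
  apart.\<close>

lemma arc_superadditive:
  assumes "t \<in> I" "s \<in> I" "a \<le> t" "t \<le> s"
  shows "arc t + mdist \<rho> (\<gamma> t) (\<gamma> s) \<le> arc s"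
proof (cases "t = s")
  case True
  moreover have "mdist \<rho> (\<gamma> s) (\<gamma> s) = 0"
    using \<gamma>_mspace[OF assms(2)] by (simp add: mdist_zero)
  ultimately show ?thesis by simp
next
  case False
  then have "t < s" using assms by simp
  have "x + mdist \<rho> (\<gamma> t) (\<gamma> s) \<le> arc s" if x: "x \<in> sums_upto t" for x
  proof -
    obtain N q where x: "x = (\<Sum>i<N. mdist \<rho> (\<gamma> (q i)) (\<gamma> (q (Suc i))))" and q: "partition_of q N a t"
      using x by (auto simp: sums_upto_def)
    define r where "r = q(Suc N := s)"
    have "partition_of r (Suc N) a s"
      using q \<open>t < s\<close> by (auto simp: partition_of_def r_def less_Suc_eq)
    moreover have "(\<Sum>i<Suc N. mdist \<rho> (\<gamma> (r i)) (\<gamma> (r (Suc i)))) = x + mdist \<rho> (\<gamma> t) (\<gamma> s)"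
      using q by (simp add: r_def x partition_of_def)
    ultimately have "x + mdist \<rho> (\<gamma> t) (\<gamma> s) \<in> sums_upto s"
      unfolding sums_upto_def by (metis (mono_tags, lifting) mem_Collect_eq)
    then show ?thesis
      unfolding arc_def using sums_upto_bdd[OF assms(2)] by (rule cSup_upper)
  qed
  then have "arc t \<le> arc s - mdist \<rho> (\<gamma> t) (\<gamma> s)"
    unfolding arc_def[of t] using sums_upto_nonempty[OF assms(3)] by (intro cSup_least) (auto simp: le_diff_eq)
  then show ?thesis by simp
qed

text \<open>This gives the continuity of arc length without its subadditivity, so that
  partitions need not be refined.\<close>

lemma arc_least:
  assumes "a \<le> t" and g: "\<And>u v. u \<in> {a..t} \<Longrightarrow> v \<in> {a..t} \<Longrightarrow> u \<le> v \<Longrightarrow> mdist \<rho> (\<gamma> u) (\<gamma> v) \<le> g v - g u"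
  shows "arc t \<le> g t - g a"
  unfolding arc_def
proof (rule cSup_least[OF sums_upto_nonempty[OF assms(1)]])
  fix x assume "x \<in> sums_upto t"
  then obtain N q where x: "x = (\<Sum>i<N. mdist \<rho> (\<gamma> (q i)) (\<gamma> (q (Suc i))))" and q: "partition_of q N a t"
    by (auto simp: sums_upto_def)
  have "x \<le> (\<Sum>i<N. g (q (Suc i)) - g (q i))"
    unfolding x using partition_of_between[OF q] q
    by (intro sum_mono g) (auto simp: partition_of_def less_imp_le Suc_le_eq)
  also have "\<dots> = g t - g a"
    using q by (simp add: sum_lessThan_telescope[of "\<lambda>i. g (q i)"] partition_of_def)
  finally show "x \<le> g t - g a" .
qed

lemma arc_mono: "t \<in> I \<Longrightarrow> s \<in> I \<Longrightarrow> a \<le> t \<Longrightarrow> t \<le> s \<Longrightarrow> arc t \<le> arc s"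
  using arc_superadditive[of t s] mdist_nonneg[of \<rho> "\<gamma> t" "\<gamma> s"] by linarith

text \<open>Before \<open>t\<close> distances are controlled by \<open>arc\<close>, after
  \<open>t\<close> by the slope \<open>K\<close>. Gluing the two at \<open>t\<close> gives a
  function \<open>g\<close> to which \<open>arc_least\<close> applies.\<close>

lemma arc_locally_lipschitz:
  assumes t: "t \<in> I" "a \<le> t" and s: "s \<in> I" "t \<le> s" and K: "0 \<le> K"
    and lipK: "\<And>u v. u \<in> {t..s} \<Longrightarrow> v \<in> {t..s} \<Longrightarrow> mdist \<rho> (\<gamma> u) (\<gamma> v) \<le> K * \<bar>u - v\<bar>"
  shows "arc s - arc t \<le> K * (s - t)"
proof -
  define g where "g = (\<lambda>u. arc (min u t) + K * (max u t - t))"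
  have "mdist \<rho> (\<gamma> u) (\<gamma> v) \<le> g v - g u" if uv: "u \<in> {a..s}" "v \<in> {a..s}" "u \<le> v" for u v
  proof -
    have I: "u \<in> I" "v \<in> I"
      using uv between_I[OF s(1)] by auto
    consider "v \<le> t" | "t \<le> u" | "u \<le> t" "t \<le> v"
      by linarith
    then show ?thesis
    proof cases
      case 1
      then show ?thesis
        using arc_superadditive[OF I] uv by (simp add: g_def min_def max_def)
    next
      case 2
      then show ?thesis
        using lipK[of u v] uv by (simp add: g_def min_absorb2 max_absorb1 right_diff_distrib)
    next
      case 3
      have "mdist \<rho> (\<gamma> u) (\<gamma> v) \<le> mdist \<rho> (\<gamma> u) (\<gamma> t) + mdist \<rho> (\<gamma> t) (\<gamma> v)"
        using \<gamma>_mspace I t(1) by (intro mdist_triangle)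
      also have "\<dots> \<le> (arc t - arc u) + K * (v - t)"
        using arc_superadditive[OF I(1) t(1)] lipK[of t v] uv 3 s by (intro add_mono) auto
      also have "\<dots> \<le> g v - g u"
        using 3 by (simp add: g_def)
      finally show ?thesis .
    qed
  qed
  then have "arc s \<le> g s - g a"
    using t s by (intro arc_least) auto
  \<comment> \<open>This number is \<open>g a\<close>; its sign suffices to pass from
    \<open>g s - g a\<close> to \<open>g s\<close>.\<close>
  moreover have "0 \<le> arc (min a t)"
    using t arc_nonneg[OF a] by (simp add: min_def)
  ultimately show ?thesis
    using t s by (simp add: g_def)
qed

lemma continuous_on_arc: "continuous_on (I \<inter> {a..}) arc"
  unfolding continuous_on_iff
proof (intro ballI allI impI)
  fix t and e :: real assume t: "t \<in> I \<inter> {a..}" and "0 < e"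
  obtain U K where U: "open U" "t \<in> U" and K: "0 \<le> K"
    "\<forall>s\<in>U \<inter> I. \<forall>r\<in>U \<inter> I. mdist \<rho> (\<gamma> s) (\<gamma> r) \<le> K * \<bar>s - r\<bar>"
    using lip t unfolding lip_curve_iff by blast
  then obtain d where d: "0 < d" "ball t d \<subseteq> U"
    by (meson open_contains_ball)
  have lipK: "mdist \<rho> (\<gamma> u) (\<gamma> v) \<le> K * \<bar>u - v\<bar>"
    if "u \<in> I" "v \<in> I" "\<bar>u - t\<bar> < d" "\<bar>v - t\<bar> < d" for u v
    using K(2) that subsetD[OF d(2), of u] subsetD[OF d(2), of v] by (auto simp: dist_real_def abs_minus_commute)
  have *: "\<bar>arc s - arc r\<bar> \<le> K * \<bar>s - r\<bar>"
    if sr: "r \<in> I" "s \<in> I" "a \<le> r" "r \<le> s" "\<bar>r - t\<bar> < d" "\<bar>s - t\<bar> < d" for r s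
  proof -
    have "arc s - arc r \<le> K * (s - r)"
      using sr between_I[OF sr(2)] by (intro arc_locally_lipschitz K(1) lipK) auto
    with arc_mono[OF sr(1-4)] sr(4) show ?thesis by simp
  qed
  \<comment> \<open>Dividing by \<open>K + 1\<close> rather than \<open>K\<close> covers a vanishing
    Lipschitz constant.\<close>
  have "dist (arc s) (arc t) < e"
    if s: "s \<in> I \<inter> {a..}" "dist s t < min d (e / (K + 1))" for s
  proof -
    have "\<bar>arc s - arc t\<bar> \<le> K * \<bar>s - t\<bar>"
      using *[of s t] *[of t s] s t d(1) by (cases "s \<le> t") (auto simp: dist_real_def abs_minus_commute)
    also have "\<dots> \<le> (K + 1) * \<bar>s - t\<bar>"
      by (intro mult_right_mono) auto
    also have "\<dots> < e"
      using s(2) K(1) by (simp add: dist_real_def less_divide_eq mult.commute)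
    finally show ?thesis
      by (simp add: dist_real_def)
  qed
  then show "\<exists>d>0. \<forall>s\<in>I \<inter> {a..}. dist s t < d \<longrightarrow> dist (arc s) (arc t) < e"
    using d(1) \<open>0 < e\<close> K(1) by (intro exI[of _ "min d (e / (K + 1))"]) auto
qed

text \<open>The summands have separate tasks: arc length makes \<gamma> 1-Lipschitz in the new
  parameter from \<open>a\<close> on, and \<open>squash\<close> keeps the parameter strictly
  increasing where \<gamma> rests. The maximum freezes arc length before \<open>a\<close>.\<close>

definition arc_param :: "real \<Rightarrow> real" where
  "arc_param t = squash t + arc (max t a)"

lemma continuous_on_arc_param: "continuous_on I arc_param"
proof -
  have "continuous_on I (\<lambda>t. arc (max t a))"
    using a by (intro continuous_on_compose2[OF continuous_on_arc] continuous_intros) (auto simp: max_def)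
  then show ?thesis
    unfolding arc_param_def by (intro continuous_on_add continuous_on_squash)
qed

lemma max_I: "t \<in> I \<Longrightarrow> max t a \<in> I"
  using a by (simp add: max_def)

lemma arc_param_expand:
  assumes "t \<in> I" "s \<in> I" "t \<le> s"
  shows "squash s - squash t \<le> arc_param s - arc_param t"
  using arc_mono[OF max_I[OF assms(1)] max_I[OF assms(2)]] assms(3) by (simp add: arc_param_def)

lemma arc_param_control:
  assumes "t \<in> I" "s \<in> I" "a \<le> t" "t \<le> s"
  shows "mdist \<rho> (\<gamma> t) (\<gamma> s) \<le> arc_param s - arc_param t"
  using arc_superadditive[OF assms] assms(3,4) squash_mono[OF assms(4)] by (simp add: arc_param_def)

lemma arc_param_bdd: "bdd_above (arc_param ` I)"
proof (intro bdd_aboveI[of _ "1 + C"])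
  fix x assume "x \<in> arc_param ` I"
  then obtain t where "t \<in> I" "x = arc_param t"
    by blast
  then show "x \<le> 1 + C"
    using arc_le[OF max_I] squash_less_1[of t] by (fastforce simp: arc_param_def)
qed

text \<open>Beyond \<open>arc_param a\<close> the prolonged curve is 1-Lipschitz up to and including
  the limit. At other parameters the local constants of \<gamma> and of the inverse
  reparametrization multiply.\<close>

lemma lip_curve_prolonged:
  assumes I: "open_end I" and lim: "end_limit (mtopology_of \<rho>) I \<gamma> p"
  shows "reparametrization I arc_param"
    and "lip_curve \<rho> (insert (reparametrization.top I arc_param) (arc_param ` I))
      (reparametrization.prolonged I arc_param \<gamma> p)"
proof -
  show "reparametrization I arc_param"
    using a I interval_I continuous_on_arc_param arc_param_expand arc_param_bdd
    by unfold_locales auto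
  then interpret reparametrization I arc_param .
  have p: "p \<in> mspace \<rho>"
    using lim by (simp add: end_limit_def)
  \<comment> \<open>The distance to the limit is at most the remaining parameter length: pass
    through a later point of \<gamma> within \<open>e\<close> of \<open>p\<close>.\<close>
  have to_p: "mdist \<rho> (\<gamma> t) p \<le> top - arc_param t" if t: "t \<in> I" "a \<le> t" for t
  proof (rule field_le_epsilon)
    fix e :: real assume "0 < e"
    interpret M: Metric_space "mspace \<rho>" "mdist \<rho>"
      by simp
    have "openin (mtopology_of \<rho>) (M.mball p e)" "p \<in> M.mball p e"
      using p \<open>0 < e\<close> by (simp_all add: mtopology_of_def)
    then obtain t' where t': "t' \<in> I" "\<And>s. s \<in> I \<Longrightarrow> t' \<le> s \<Longrightarrow> \<gamma> s \<in> M.mball p e"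
      using lim unfolding end_limit_def by blast
    define s where "s = max t t'"
    have s: "s \<in> I" "t \<le> s" "\<gamma> s \<in> M.mball p e"
      using t t' by (auto simp: s_def max_def)
    have "mdist \<rho> (\<gamma> t) p \<le> mdist \<rho> (\<gamma> t) (\<gamma> s) + mdist \<rho> (\<gamma> s) p"
      using \<gamma>_mspace t s p by (intro mdist_triangle)
    also have "\<dots> \<le> (arc_param s - arc_param t) + e"
      using arc_param_control[OF t(1) s(1) t(2) s(2)] s(3) by (simp add: mdist_commute)
    also have "\<dots> \<le> top - arc_param t + e"
      using less_top[OF s(1)] by simp
    finally show "mdist \<rho> (\<gamma> t) p \<le> top - arc_param t + e" .
  qed
  show "lip_curve \<rho> (insert top (arc_param ` I)) (prolonged \<gamma> p)"
    unfolding lip_curve_iff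
  proof (intro conjI ballI)
    show "cont_curve (mtopology_of \<rho>) (insert top (arc_param ` I)) (prolonged \<gamma> p)"
      using lip lim by (intro cont_curve_prolonged) (auto simp: lip_curve_def)
    fix u assume u: "u \<in> insert top (arc_param ` I)"
    show "\<exists>U K. open U \<and> u \<in> U \<and> 0 \<le> K \<and> (\<forall>v\<in>U \<inter> insert top (arc_param ` I).
        \<forall>w\<in>U \<inter> insert top (arc_param ` I). mdist \<rho> (prolonged \<gamma> p v) (prolonged \<gamma> p w) \<le> K * \<bar>v - w\<bar>)"
    proof (cases "u = top")
      case True
      have *: "mdist \<rho> (prolonged \<gamma> p v) (prolonged \<gamma> p w) \<le> w - v"
        if vw: "v \<in> {arc_param a<..} \<inter> insert top (arc_param ` I)"
          "w \<in> {arc_param a<..} \<inter> insert top (arc_param ` I)" "v \<le> w" for v w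
      proof (cases "v = top")
        case True
        then have "w = top"
          using vw less_top by fastforce
        moreover have "mdist \<rho> p p = 0"
          using p by (simp add: mdist_zero)
        ultimately show ?thesis
          using True by (simp add: prolonged_top)
      next
        case False
        then obtain t where t: "t \<in> I" "v = arc_param t"
          using vw by auto
        then have at: "a \<le> t"
          using vw(1) le_iff[OF a t(1)] by simp
        show ?thesis
        proof (cases "w = top")
          case True
          then show ?thesis
            using t to_p[OF t(1) at] by (simp add: prolonged_\<phi> prolonged_top)
        next
          case False
          then obtain s where s: "s \<in> I" "w = arc_param s"
            using vw by auto
          then have "t \<le> s"
            using vw(3) t le_iff by simp
          then show ?thesis
            using s t arc_param_control[OF t(1) s(1) at] by (simp add: prolonged_\<phi>)
        qed
      qed
      have "mdist \<rho> (prolonged \<gamma> p v) (prolonged \<gamma> p w) \<le> 1 * \<bar>v - w\<bar>"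
        if "v \<in> {arc_param a<..} \<inter> insert top (arc_param ` I)"
          "w \<in> {arc_param a<..} \<inter> insert top (arc_param ` I)" for v w
        using *[OF that] *[OF that(2,1)] by (cases "v \<le> w") (auto simp: mdist_commute)
      then show ?thesis
        using True less_top[OF a] by (intro exI[of _ "{arc_param a<..}"] exI[of _ 1]) auto
    next
      case False
      then obtain t where t: "t \<in> I" "u = arc_param t"
        using u by auto
      then obtain V K where V: "open V" "t \<in> V" and K: "0 \<le> K"
        "\<forall>s\<in>V \<inter> I. \<forall>r\<in>V \<inter> I. mdist \<rho> (\<gamma> s) (\<gamma> r) \<le> K * \<bar>s - r\<bar>"
        using lip unfolding lip_curve_iff by blast
      obtain U L where U: "open U" "arc_param t \<in> U" "0 \<le> L" "\<And>s. s \<in> I \<Longrightarrow> arc_param s \<in> U \<Longrightarrow> s \<in> V"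
        "\<And>s r. s \<in> I \<Longrightarrow> r \<in> I \<Longrightarrow> arc_param s \<in> U \<Longrightarrow> arc_param r \<in> U \<Longrightarrow>
          \<bar>s - r\<bar> \<le> L * \<bar>arc_param s - arc_param r\<bar>"
        using inverse_locally_lipschitz[OF t(1) V] by blast
      have "mdist \<rho> (prolonged \<gamma> p v) (prolonged \<gamma> p w) \<le> (K * L) * \<bar>v - w\<bar>"
        if vw: "v \<in> (U \<inter> {..<top}) \<inter> insert top (arc_param ` I)"
          "w \<in> (U \<inter> {..<top}) \<inter> insert top (arc_param ` I)" for v w
      proof -
        obtain s r where sr: "s \<in> I" "r \<in> I" "v = arc_param s" "w = arc_param r"
          using vw by auto
        then have "mdist \<rho> (\<gamma> s) (\<gamma> r) \<le> K * \<bar>s - r\<bar>"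
          using that U(4) by (intro K(2)[rule_format]) auto
        also have "\<dots> \<le> K * (L * \<bar>v - w\<bar>)"
          unfolding sr(3,4) using that sr U(5) by (intro mult_left_mono K(1)) auto
        finally show ?thesis
          using sr by (simp add: prolonged_\<phi> mult.assoc)
      qed
      then show ?thesis
        using U(1-3) K(1) t less_top by (intro exI[of _ "U \<inter> {..<top}"] exI[of _ "K * L"]) auto
    qed
  qed
qed

end

section \<open>Continuous and locally Lipschitz curves\<close>

lemma cont_curve_nhd:
  assumes "cont_curve T I \<gamma>" "t \<in> I" "openin T W" "\<gamma> t \<in> W"
  shows "\<exists>U. open U \<and> t \<in> U \<and> (\<forall>s\<in>U \<inter> I. \<gamma> s \<in> W)"
  using assms by (simp add: cont_curve_iff)

lemma lip_curve_nhd: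
  assumes "lip_curve \<rho> I \<gamma>" "t \<in> I"
  shows "\<exists>U K. open U \<and> t \<in> U \<and> 0 \<le> K \<and>
    (\<forall>s\<in>U \<inter> I. \<forall>r\<in>U \<inter> I. mdist \<rho> (\<gamma> s) (\<gamma> r) \<le> K * \<bar>s - r\<bar>)"
  using assms by (simp add: lip_curve_iff)

lemma cont_curve_compose:
  assumes \<gamma>: "cont_curve T I \<gamma>" and h: "continuous_on UNIV h" "h ` J \<subseteq> I"
    and J: "is_interval J" "J \<noteq> {}"
  shows "cont_curve T J (\<lambda>t. \<gamma> (h t))"
  unfolding cont_curve_iff
proof (intro conjI ballI allI impI)
  fix t assume "t \<in> J"
  then show "\<gamma> (h t) \<in> topspace T"
    using cont_curve_topspace[OF \<gamma>] h(2) by blast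
next
  fix t W assume t: "t \<in> J" and W: "openin T W \<and> \<gamma> (h t) \<in> W"
  then obtain U where U: "open U" "h t \<in> U" "\<forall>s\<in>U \<inter> I. \<gamma> s \<in> W"
    using cont_curve_nhd[OF \<gamma>, of "h t" W] h(2) by blast
  have "\<forall>s\<in>h -` U \<inter> J. \<gamma> (h s) \<in> W"
    using U(3) h(2) by auto
  then show "\<exists>V. open V \<and> t \<in> V \<and> (\<forall>s\<in>V \<inter> J. \<gamma> (h s) \<in> W)"
    using open_vimage[OF U(1) h(1)] U(2) by blast
qed (use J in auto)

lemma lip_curve_compose:
  assumes \<gamma>: "lip_curve \<rho> I \<gamma>" and h: "\<And>t s. \<bar>h t - h s\<bar> \<le> K * \<bar>t - s\<bar>" "h ` J \<subseteq> I" and "0 \<le> K"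
    and J: "is_interval J" "J \<noteq> {}"
  shows "lip_curve \<rho> J (\<lambda>t. \<gamma> (h t))"
  unfolding lip_curve_iff
proof (intro conjI ballI)
  have "K-lipschitz_on UNIV h"
    using h(1) \<open>0 \<le> K\<close> by (auto simp: lipschitz_on_def dist_real_def)
  then have cont: "continuous_on UNIV h"
    by (rule lipschitz_on_continuous_on)
  show "cont_curve (mtopology_of \<rho>) J (\<lambda>t. \<gamma> (h t))"
    using \<gamma> by (intro cont_curve_compose[OF _ cont h(2) J]) (simp add: lip_curve_iff)
  fix t assume "t \<in> J"
  then have "h t \<in> I"
    using h(2) by blast
  from lip_curve_nhd[OF \<gamma> this] obtain U L where U: "open U" "h t \<in> U" "0 \<le> L"
    and L: "\<forall>s\<in>U \<inter> I. \<forall>r\<in>U \<inter> I. mdist \<rho> (\<gamma> s) (\<gamma> r) \<le> L * \<bar>s - r\<bar>"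
    by (elim exE conjE) (rule that)
  have "mdist \<rho> (\<gamma> (h s)) (\<gamma> (h r)) \<le> (L * K) * \<bar>s - r\<bar>" if "s \<in> h -` U \<inter> J" "r \<in> h -` U \<inter> J" for s r
  proof -
    have "mdist \<rho> (\<gamma> (h s)) (\<gamma> (h r)) \<le> L * \<bar>h s - h r\<bar>"
      using that h(2) by (intro L[rule_format]) auto
    also have "\<dots> \<le> L * (K * \<bar>s - r\<bar>)"
      by (intro mult_left_mono h(1) U(3))
    finally show ?thesis by (simp add: mult.assoc)
  qed
  then show "\<exists>V M. open V \<and> t \<in> V \<and> 0 \<le> M \<and>
      (\<forall>s\<in>V \<inter> J. \<forall>r\<in>V \<inter> J. mdist \<rho> (\<gamma> (h s)) (\<gamma> (h r)) \<le> M * \<bar>s - r\<bar>)"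
    using open_vimage[OF U(1) cont] U(2,3) \<open>0 \<le> K\<close>
    by (intro exI[of _ "h -` U"] exI[of _ "L * K"] conjI ballI) simp_all
qed

lemma reversible_cont_curve: "reversible (cont_curve T)"
  unfolding reversible_def
proof (intro allI impI)
  fix I \<gamma> assume \<gamma>: "cont_curve T I \<gamma>"
  then have "cont_curve T (uminus ` I) (\<lambda>t. \<gamma> (- t))"
    by (rule cont_curve_compose) (use \<gamma> is_interval_uminus in \<open>auto simp: cont_curve_iff intro!: continuous_intros\<close>)
  then show "cont_curve T (uminus ` I) (reverse_curve \<gamma>)"
    by (simp add: reverse_curve_def[abs_def])
qed

lemma reversible_lip_curve: "reversible (lip_curve \<rho>)"
  unfolding reversible_def
proof (intro allI impI)
  fix I \<gamma> assume \<gamma>: "lip_curve \<rho> I \<gamma>"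
  then have "lip_curve \<rho> (uminus ` I) (\<lambda>t. \<gamma> (- t))"
    by (rule lip_curve_compose[where K = 1])
      (use \<gamma> is_interval_uminus in \<open>auto simp: lip_curve_iff cont_curve_iff\<close>)
  then show "lip_curve \<rho> (uminus ` I) (reverse_curve \<gamma>)"
    by (simp add: reverse_curve_def[abs_def])
qed

lemma cont_curve_cong:
  assumes "cont_curve T I \<gamma>" "\<And>t. t \<in> I \<Longrightarrow> \<gamma> t = \<gamma>' t"
  shows "cont_curve T I \<gamma>'"
  using assms unfolding cont_curve_def by (auto intro: continuous_map_eq)

lemma lip_curve_cong:
  assumes "lip_curve \<rho> I \<gamma>" "\<And>t. t \<in> I \<Longrightarrow> \<gamma> t = \<gamma>' t"
  shows "lip_curve \<rho> I \<gamma>'"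
proof -
  have "cont_curve (mtopology_of \<rho>) I \<gamma>'"
    using assms(1) by (intro cont_curve_cong[OF _ assms(2)]) (simp add: lip_curve_def)
  then show ?thesis
    using assms unfolding lip_curve_iff by simp
qed

lemma affine_unit_interval:
  fixes a b c :: real
  assumes "a < b"
  shows "(\<lambda>t. a + (t - c) * (b - a)) ` {c..c + 1} \<subseteq> {a..b}"
proof (intro subsetI, elim imageE)
  fix x t assume t: "t \<in> {c..c + 1}" and x: "x = a + (t - c) * (b - a)"
  have "(t - c) * (b - a) \<le> 1 * (b - a)" "0 \<le> (t - c) * (b - a)"
    using t assms by (intro mult_right_mono mult_nonneg_nonneg; simp)+
  with x show "x \<in> {a..b}" by simp
qed

lemma cont_curve_affine:
  assumes "cont_curve T {a..b} \<gamma>" "a < b"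
  shows "cont_curve T {c..c + 1} (\<lambda>t. \<gamma> (a + (t - c) * (b - a)))"
  using affine_unit_interval[OF assms(2)]
  by (intro cont_curve_compose[OF assms(1)]) (auto intro!: continuous_intros simp: is_interval_cc)

lemma lip_curve_affine:
  assumes "lip_curve \<rho> {a..b} \<gamma>" "a < b"
  shows "lip_curve \<rho> {c..c + 1} (\<lambda>t. \<gamma> (a + (t - c) * (b - a)))"
proof (rule lip_curve_compose[OF assms(1), where K = "b - a"])
  show "\<bar>(a + (t - c) * (b - a)) - (a + (s - c) * (b - a))\<bar> \<le> (b - a) * \<bar>t - s\<bar>" for t s
  proof -
    have "(a + (t - c) * (b - a)) - (a + (s - c) * (b - a)) = (b - a) * (t - s)"
      by (simp add: algebra_simps)
    then show ?thesis
      using assms(2) by (simp add: abs_mult)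
  qed
qed (use assms affine_unit_interval[OF assms(2)] in \<open>auto simp: is_interval_cc\<close>)

text \<open>Near \<open>t\<close> the ray consists of a left piece \<open>m\<close> and a right
  piece \<open>n\<close>, distinct only if \<open>t\<close> is a positive integer. Concatenation
  thus reduces to gluing two pieces at one point.\<close>

lemma unit_intervals_cover_locally:
  assumes "0 \<le> t"
  shows "\<exists>N (m::nat) (n::nat). open N \<and> t \<in> N \<and> t \<in> {real m..real m + 1} \<and> t \<in> {real n..real n + 1} \<and>
    (\<forall>s\<in>N \<inter> {0..}. s \<le> t \<longrightarrow> s \<in> {real m..real m + 1}) \<and> (\<forall>s\<in>N \<inter> {0..}. t \<le> s \<longrightarrow> s \<in> {real n..real n + 1})"
proof -
  define n where "n = nat \<lfloor>t\<rfloor>"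
  have n: "real n \<le> t" "t < real n + 1"
    using assms by (simp_all add: n_def)
  show ?thesis
  proof (cases "t = real n \<and> n \<noteq> 0")
    case True
    then have "real (n - 1) = real n - 1"
      by (simp add: of_nat_diff)
    then show ?thesis
      using True by (intro exI[of _ "{real n - 1<..<real n + 1}"] exI[of _ "n - 1"] exI[of _ n]) auto
  next
    case False
    show ?thesis
    proof (cases "n = 0")
      case True
      then show ?thesis
        using n by (intro exI[of _ "{-1<..<1}"] exI[of _ 0]) auto
    next
      case n0: False
      then show ?thesis
        using n False by (intro exI[of _ "{real n<..<real n + 1}"] exI[of _ n]) auto
    qed
  qed
qed

lemma cont_curve_concat:
  assumes pieces: "\<And>n::nat. cont_curve T {real n..real n + 1} \<gamma>"
  shows "cont_curve T {0..} \<gamma>"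
  unfolding cont_curve_iff
proof (intro conjI ballI allI impI)
  fix t :: real assume "t \<in> {0..}"
  then have "0 \<le> t" by simp
  then obtain N m n where N: "open N" "t \<in> N" and t: "t \<in> {real m..real m + 1}" "t \<in> {real n..real n + 1}"
    and cover: "\<forall>s\<in>N \<inter> {0..}. s \<le> t \<longrightarrow> s \<in> {real m..real m + 1}"
      "\<forall>s\<in>N \<inter> {0..}. t \<le> s \<longrightarrow> s \<in> {real n..real n + 1}"
    using unit_intervals_cover_locally[OF \<open>0 \<le> t\<close>] by (elim exE conjE) (rule that)
  show "\<gamma> t \<in> topspace T"
    using cont_curve_topspace[OF pieces t(1)] .
  fix W assume W: "openin T W \<and> \<gamma> t \<in> W"
  obtain U where U: "open U" "t \<in> U" "\<forall>s\<in>U \<inter> {real m..real m + 1}. \<gamma> s \<in> W"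
    using cont_curve_nhd[OF pieces t(1)] W by blast
  obtain V where V: "open V" "t \<in> V" "\<forall>s\<in>V \<inter> {real n..real n + 1}. \<gamma> s \<in> W"
    using cont_curve_nhd[OF pieces t(2)] W by blast
  have "\<gamma> s \<in> W" if "s \<in> (N \<inter> U \<inter> V) \<inter> {0..}" for s
  proof (cases "s \<le> t")
    case True
    then show ?thesis
      using that cover(1) U(3) by blast
  next
    case False
    then have "t \<le> s" by simp
    then show ?thesis
      using that cover(2) V(3) by blast
  qed
  then show "\<exists>U. open U \<and> t \<in> U \<and> (\<forall>s\<in>U \<inter> {0..}. \<gamma> s \<in> W)"
    using N U(1,2) V(1,2) by (intro exI[of _ "N \<inter> U \<inter> V"]) auto
qed (auto simp: is_interval_ci)

text \<open>Points on opposite sides of \<open>t\<close> are compared through \<gamma> at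
  \<open>t\<close>; since \<open>t\<close> lies between their parameters, the two parameter
  distances add up exactly and the constant \<open>K + L\<close> serves all cases.\<close>

lemma lip_curve_concat:
  assumes pieces: "\<And>n::nat. lip_curve \<rho> {real n..real n + 1} \<gamma>"
  shows "lip_curve \<rho> {0..} \<gamma>"
  unfolding lip_curve_iff
proof (intro conjI ballI)
  show cont: "cont_curve (mtopology_of \<rho>) {0..} \<gamma>"
    using pieces by (intro cont_curve_concat) (simp add: lip_curve_def)
  fix t :: real assume "t \<in> {0..}"
  then have "0 \<le> t" by simp
  then obtain N m n where N: "open N" "t \<in> N" and t: "t \<in> {real m..real m + 1}" "t \<in> {real n..real n + 1}"
    and cover: "\<forall>s\<in>N \<inter> {0..}. s \<le> t \<longrightarrow> s \<in> {real m..real m + 1}"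
      "\<forall>s\<in>N \<inter> {0..}. t \<le> s \<longrightarrow> s \<in> {real n..real n + 1}"
    using unit_intervals_cover_locally[OF \<open>0 \<le> t\<close>] by (elim exE conjE) (rule that)
  obtain U K where U: "open U" "t \<in> U" "0 \<le> K"
    "\<forall>s\<in>U \<inter> {real m..real m + 1}. \<forall>r\<in>U \<inter> {real m..real m + 1}. mdist \<rho> (\<gamma> s) (\<gamma> r) \<le> K * \<bar>s - r\<bar>"
    using lip_curve_nhd[OF pieces t(1)] by (elim exE conjE) (rule that)
  obtain V L where V: "open V" "t \<in> V" "0 \<le> L"
    "\<forall>s\<in>V \<inter> {real n..real n + 1}. \<forall>r\<in>V \<inter> {real n..real n + 1}. mdist \<rho> (\<gamma> s) (\<gamma> r) \<le> L * \<bar>s - r\<bar>"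
    using lip_curve_nhd[OF pieces t(2)] by (elim exE conjE) (rule that)
  define A where "A = (N \<inter> U \<inter> V) \<inter> {0..}"
  have K: "mdist \<rho> (\<gamma> s) (\<gamma> r) \<le> (K + L) * \<bar>s - r\<bar>" if "s \<in> A" "r \<in> A" "s \<le> t" "r \<le> t" for s r
  proof -
    have "mdist \<rho> (\<gamma> s) (\<gamma> r) \<le> K * \<bar>s - r\<bar>"
      using U(4) cover(1) that unfolding A_def by blast
    also have "\<dots> \<le> (K + L) * \<bar>s - r\<bar>"
      using V(3) by (intro mult_right_mono) auto
    finally show ?thesis .
  qed
  have L: "mdist \<rho> (\<gamma> s) (\<gamma> r) \<le> (K + L) * \<bar>s - r\<bar>" if "s \<in> A" "r \<in> A" "t \<le> s" "t \<le> r" for s r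
  proof -
    have "mdist \<rho> (\<gamma> s) (\<gamma> r) \<le> L * \<bar>s - r\<bar>"
      using V(4) cover(2) that unfolding A_def by blast
    also have "\<dots> \<le> (K + L) * \<bar>s - r\<bar>"
      using U(3) by (intro mult_right_mono) auto
    finally show ?thesis .
  qed
  have tA: "t \<in> A"
    using N U V \<open>0 \<le> t\<close> by (simp add: A_def)
  have across: "mdist \<rho> (\<gamma> s) (\<gamma> r) \<le> (K + L) * \<bar>s - r\<bar>" if "s \<in> A" "r \<in> A" "s \<le> t" "t \<le> r" for s r
  proof -
    have "mdist \<rho> (\<gamma> s) (\<gamma> r) \<le> mdist \<rho> (\<gamma> s) (\<gamma> t) + mdist \<rho> (\<gamma> t) (\<gamma> r)"
      using cont_curve_topspace[OF cont] that \<open>0 \<le> t\<close> by (intro mdist_triangle) (auto simp: A_def)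
    also have "\<dots> \<le> (K + L) * \<bar>s - t\<bar> + (K + L) * \<bar>t - r\<bar>"
      using K[of s t] L[of t r] that tA by (intro add_mono) auto
    also have "\<dots> = (K + L) * \<bar>s - r\<bar>"
      using that by (simp add: abs_if algebra_simps)
    finally show ?thesis .
  qed
  have "mdist \<rho> (\<gamma> s) (\<gamma> r) \<le> (K + L) * \<bar>s - r\<bar>" if "s \<in> A" "r \<in> A" for s r
    using K[OF that] L[OF that] across[OF that] across[OF that(2,1)]
    by (cases "s \<le> t"; cases "r \<le> t") (auto simp: mdist_commute abs_minus_commute)
  then show "\<exists>U K. open U \<and> t \<in> U \<and> 0 \<le> K \<and>
      (\<forall>s\<in>U \<inter> {0..}. \<forall>r\<in>U \<inter> {0..}. mdist \<rho> (\<gamma> s) (\<gamma> r) \<le> K * \<bar>s - r\<bar>)"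
    using N U(1-3) V(1-3) unfolding A_def
    by (intro exI[of _ "N \<inter> U \<inter> V"] exI[of _ "K + L"] conjI ballI) (simp_all add: open_Int)
qed

text \<open>Clause (a) of localizability on its own, in a form that passes to
  \<open>rev_sep\<close>.\<close>

definition locally_bounded_arclength :: "'a metric \<Rightarrow> ('a \<Rightarrow> 'a \<Rightarrow> ereal) \<Rightarrow> bool" where
  "locally_bounded_arclength \<rho> l \<longleftrightarrow>
     (\<forall>x\<in>mspace \<rho>. \<exists>\<Omega> C::real. openin (mtopology_of \<rho>) \<Omega> \<and> x \<in> \<Omega> \<and>
        (\<forall>I \<gamma>. causal_curve (lip_curve \<rho>) l I \<gamma> \<and> \<gamma> ` I \<subseteq> \<Omega> \<longrightarrow> metric_arclength \<rho> I \<gamma> \<le> ereal C))"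

lemma metric_arclength_reverse:
  "metric_arclength \<rho> I \<gamma> \<le> metric_arclength \<rho> (uminus ` I) (reverse_curve \<gamma>)"
  unfolding metric_arclength_def
proof (rule Sup_subset_mono, rule subsetI)
  fix x assume "x \<in> {ereal (\<Sum>i<N. mdist \<rho> (\<gamma> (t i)) (\<gamma> (t (Suc i)))) |N t. (\<forall>i\<le>N. t i \<in> I) \<and> (\<forall>i<N. t i < t (Suc i))}"
  then obtain N t where x: "x = ereal (\<Sum>i<N. mdist \<rho> (\<gamma> (t i)) (\<gamma> (t (Suc i))))"
    and t: "\<forall>i\<le>N. t i \<in> I" "\<forall>i<N. t i < t (Suc i)"
    unfolding mem_Collect_eq by (elim exE conjE) (rule that)
  \<comment> \<open>The partition is both reflected and run backwards, so that it increases
    again.\<close>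
  define q where "q = (\<lambda>i. - t (N - i))"
  have "(\<Sum>i<N. mdist \<rho> (\<gamma> (t i)) (\<gamma> (t (Suc i)))) =
      (\<Sum>i<N. mdist \<rho> (\<gamma> (t (N - Suc i))) (\<gamma> (t (Suc (N - Suc i)))))"
    by (rule sum.nat_diff_reindex[symmetric])
  also have "\<dots> = (\<Sum>i<N. mdist \<rho> (reverse_curve \<gamma> (q i)) (reverse_curve \<gamma> (q (Suc i))))"
    by (intro sum.cong) (auto simp: q_def reverse_curve_def mdist_commute Suc_diff_Suc)
  finally have "x = ereal (\<Sum>i<N. mdist \<rho> (reverse_curve \<gamma> (q i)) (reverse_curve \<gamma> (q (Suc i))))"
    using x by simp
  moreover have "\<forall>i\<le>N. q i \<in> uminus ` I"
    using t(1) by (simp add: q_def)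
  moreover have "\<forall>i<N. q i < q (Suc i)"
  proof (intro allI impI)
    fix i assume "i < N"
    then have "t (N - Suc i) < t (Suc (N - Suc i))" "Suc (N - Suc i) = N - i"
      using t(2) by auto
    then show "q i < q (Suc i)"
      by (simp add: q_def)
  qed
  ultimately show "x \<in> {ereal (\<Sum>i<N. mdist \<rho> (reverse_curve \<gamma> (t i)) (reverse_curve \<gamma> (t (Suc i)))) |N t.
      (\<forall>i\<le>N. t i \<in> uminus ` I) \<and> (\<forall>i<N. t i < t (Suc i))}"
    by blast
qed

lemma locally_bounded_arclength_rev_sep:
  assumes "locally_bounded_arclength \<rho> l"
  shows "locally_bounded_arclength \<rho> (rev_sep l)"
  unfolding locally_bounded_arclength_def
proof
  fix x assume "x \<in> mspace \<rho>"
  from bspec[OF assms[unfolded locally_bounded_arclength_def] this] obtain \<Omega> and C :: real where \<Omega>: "openin (mtopology_of \<rho>) \<Omega>" "x \<in> \<Omega>"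
    and C: "\<forall>I \<gamma>. causal_curve (lip_curve \<rho>) l I \<gamma> \<and> \<gamma> ` I \<subseteq> \<Omega> \<longrightarrow> metric_arclength \<rho> I \<gamma> \<le> ereal C"
    by (elim exE conjE) (rule that)
  have "metric_arclength \<rho> I \<gamma> \<le> ereal C"
    if \<gamma>: "causal_curve (lip_curve \<rho>) (rev_sep l) I \<gamma>" "\<gamma> ` I \<subseteq> \<Omega>" for I \<gamma>
  proof -
    have "causal_curve (lip_curve \<rho>) l (uminus ` I) (reverse_curve \<gamma>)"
      using causal_curve_reverse[OF reversible_lip_curve, of \<rho> "rev_sep l" I \<gamma>] \<gamma>(1)
      by (simp add: rev_sep_def[abs_def])
    moreover have "reverse_curve \<gamma> ` uminus ` I \<subseteq> \<Omega>"
      using \<gamma>(2) by (auto simp: reverse_curve_def)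
    ultimately have "metric_arclength \<rho> (uminus ` I) (reverse_curve \<gamma>) \<le> ereal C"
      using C by blast
    with metric_arclength_reverse show ?thesis
      by (rule order_trans)
  qed
  then show "\<exists>\<Omega> C. openin (mtopology_of \<rho>) \<Omega> \<and> x \<in> \<Omega> \<and>
      (\<forall>I \<gamma>. causal_curve (lip_curve \<rho>) (rev_sep l) I \<gamma> \<and> \<gamma> ` I \<subseteq> \<Omega> \<longrightarrow> metric_arclength \<rho> I \<gamma> \<le> ereal C)"
    using \<Omega> by (intro exI[of _ \<Omega>] exI[of _ C]) simp
qed

lemma lip_curve_extend:
  assumes bd: "locally_bounded_arclength \<rho> l"
    and \<gamma>: "causal_curve (lip_curve \<rho>) l I \<gamma>" and I: "open_end I"
    and lim: "end_limit (mtopology_of \<rho>) I \<gamma> p" and le: "\<forall>t\<in>I. causal_le l (\<gamma> t) p"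
  shows "future_extendible (lip_curve \<rho>) l I \<gamma>"
proof -
  have lip: "lip_curve \<rho> I \<gamma>"
    using \<gamma> by (simp add: causal_curve_def)
  have "p \<in> mspace \<rho>"
    using lim by (simp add: end_limit_def)
  from bspec[OF bd[unfolded locally_bounded_arclength_def] this]
  obtain \<Omega> and C :: real where \<Omega>: "openin (mtopology_of \<rho>) \<Omega>" "p \<in> \<Omega>"
    and C: "\<forall>I \<gamma>. causal_curve (lip_curve \<rho>) l I \<gamma> \<and> \<gamma> ` I \<subseteq> \<Omega> \<longrightarrow> metric_arclength \<rho> I \<gamma> \<le> ereal C"
    by (elim exE conjE) (rule that)
  \<comment> \<open>From \<open>a\<close> on the curve stays in the neighbourhood of
    \<open>p\<close> where \<open>C\<close> bounds arc length, so its tail has finite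
    length.\<close>
  obtain a where a: "a \<in> I" "\<And>s. s \<in> I \<Longrightarrow> a \<le> s \<Longrightarrow> \<gamma> s \<in> \<Omega>"
    using lim \<Omega> unfolding end_limit_def by blast
  have "is_interval I"
    using lip by (simp add: lip_curve_def cont_curve_def)
  then have "is_interval (I \<inter> {a..})"
    by (intro is_interval_Int) (auto simp: is_interval_ci)
  then have "lip_curve \<rho> (I \<inter> {a..}) \<gamma>"
    using a(1) lip_curve_compose[OF lip, of "\<lambda>t. t" 1 "I \<inter> {a..}"] by auto
  then have "causal_curve (lip_curve \<rho>) l (I \<inter> {a..}) \<gamma>"
    using \<gamma> by (simp add: causal_curve_def)
  then have arclength: "metric_arclength \<rho> (I \<inter> {a..}) \<gamma> \<le> ereal C"
    using a(2) by (intro C[rule_format]) auto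
  have "rectifiable_ray \<rho> I \<gamma> a C"
  proof
    fix N and q :: "nat \<Rightarrow> real"
    assume q: "\<And>i. i \<le> N \<Longrightarrow> q i \<in> I \<inter> {a..}" "\<And>i. i < N \<Longrightarrow> q i < q (Suc i)"
    have "ereal (\<Sum>i<N. mdist \<rho> (\<gamma> (q i)) (\<gamma> (q (Suc i)))) \<le> metric_arclength \<rho> (I \<inter> {a..}) \<gamma>"
      unfolding metric_arclength_def using q by (intro Sup_upper) blast
    from order_trans[OF this arclength] show "(\<Sum>i<N. mdist \<rho> (\<gamma> (q i)) (\<gamma> (q (Suc i)))) \<le> C"
      by (simp only: ereal_less_eq)
  qed (use lip a in auto)
  then interpret rectifiable_ray \<rho> I \<gamma> a C .
  interpret reparametrization I arc_param
    by (rule lip_curve_prolonged(1)[OF I lim])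
  show ?thesis
    by (rule future_extendible_prolonged[where C = "lip_curve \<rho>", OF \<gamma> le lip_curve_prolonged(2)[OF I lim]])
qed

section \<open>Compact diamonds and capturing neighbourhoods\<close>

lemma (in causally_simple_space) closedin_diamond:
  assumes "x \<in> topspace T" "y \<in> topspace T"
  shows "closedin T (J_plus T l x \<inter> J_minus T l y)"
  using simple assms by (simp add: causally_simple_def closedin_Int)

text \<open>Global hyperbolicity for the two-point set gives a compact set containing the diamond,
  and the diamond is closed.\<close>

lemma (in causally_simple_space) globally_hyperbolic_diamond:
  assumes "globally_hyperbolic T l" and xy: "x \<in> topspace T" "y \<in> topspace T"
  shows "compactin T (J_plus T l x \<inter> J_minus T l y)"
proof -
  have "compactin T {x, y}"
    using xy by (intro finite_imp_compactin) auto
  with assms(1) have "compactin T ((\<Union>z\<in>{x, y}. J_plus T l z) \<inter> (\<Union>z\<in>{x, y}. J_minus T l z))"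
    unfolding globally_hyperbolic_def by blast
  moreover have "J_plus T l x \<inter> J_minus T l y \<subseteq> (\<Union>z\<in>{x, y}. J_plus T l z) \<inter> (\<Union>z\<in>{x, y}. J_minus T l z)"
    by blast
  ultimately show ?thesis
    using closedin_diamond[OF xy] by (rule closed_compactin)
qed

text \<open>Without chronological boundary, the diamond of \<open>y\<close> and \<open>p\<close> lies between points
  \<open>x \<lless> x' \<lless> y\<close> and \<open>p \<lless> w\<close>. It is then contained in a slice, at \<open>x'\<close>, of the compact
  set of pairs of points between \<open>x\<close> and \<open>w\<close> at distance at least \<open>d x' y\<close>.\<close>

lemma (in causally_simple_space) BMS_diamond_compact:
  assumes bms: "BMS_lorentzian_metric_space T l" and bd: "chronological_boundary T l = {}"
    and yp: "y \<in> topspace T" "p \<in> topspace T"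
  shows "compactin T (J_plus T l y \<inter> J_minus T l p)"
proof (cases "causal_le l y p")
  case False
  then have "J_plus T l y \<inter> J_minus T l p = {}"
    using trans[OF yp(1) _ yp(2)] by (auto simp: J_plus_def J_minus_def)
  then show ?thesis by simp
next
  case y_le_p: True
  obtain d where d: "BMS_space (topspace T) d" "BMS_topology (topspace T) d T"
    "\<forall>x\<in>topspace T. \<forall>y\<in>topspace T. l x y = BMS_time_separation (topspace T) d x y"
    using bms unfolding BMS_lorentzian_metric_space_def by blast
  have d_pos: "0 < d u v" if "u \<in> topspace T" "v \<in> topspace T" "chron_less l u v" for u v
    using that d(3) by (auto simp: chron_less_iff BMS_time_separation_def split: if_splits)
  have d_le: "d z u \<le> d z v" "d v z \<le> d u z"
    if "u \<in> topspace T" "v \<in> topspace T" "z \<in> topspace T" "causal_le l u v" for u v z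
    using that d(3) by (auto simp: causal_le_def BMS_time_separation_def split: if_splits)
  have past: "\<exists>u\<in>topspace T. chron_less l u v" and future: "\<exists>u\<in>topspace T. chron_less l v u"
    if "v \<in> topspace T" for v
    using bd that by (auto simp: chronological_boundary_def I_plus_def I_minus_def)
  \<comment> \<open>The point \<open>x'\<close> will be the fixed first coordinate. A second step
    back, to \<open>x\<close>, puts \<open>x'\<close> itself inside the open diamond
    \<open>D\<close>.\<close>
  obtain x' where x': "x' \<in> topspace T" "chron_less l x' y"
    using past[OF yp(1)] by blast
  obtain x where x: "x \<in> topspace T" "chron_less l x x'"
    using past[OF x'(1)] by blast
  obtain w where w: "w \<in> topspace T" "chron_less l p w"
    using future[OF yp(2)] by blast
  define D where "D = BMS_diamond (topspace T) d x w"
  have D_closure: "D \<subseteq> T closure_of D"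
    by (rule closure_of_subset) (auto simp: D_def BMS_diamond_def)
  have D: "z \<in> D" if "z \<in> topspace T" "chron_less l x z" "chron_less l z w" for z
    using that d_pos x(1) w(1) by (simp add: D_def BMS_diamond_def)
  have "chron_less l y w"
    using causal_chron_trans[OF yp w(1) y_le_p w(2)] .
  then have x'D: "x' \<in> D"
    using chron_causal_trans[OF x'(1) yp(1) w(1) x'(2)] x x' by (intro D) (auto simp: chron_less_imp_causal_le)
  define K where "K = {(u, v). u \<in> topspace T \<and> v \<in> topspace T \<and> d x' y \<le> d u v} \<inter> (T closure_of D) \<times> (T closure_of D)"
  have "compactin (prod_topology T T) K"
    using d(2) x(1) w(1) d_pos[OF x'(1) yp(1) x'(2)] unfolding BMS_topology_def K_def D_def by blast
  then have "compactin T (snd ` K)"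
    by (rule image_compactin[OF _ continuous_map_snd])
  moreover have "J_plus T l y \<inter> J_minus T l p \<subseteq> snd ` K"
  proof
    fix z assume "z \<in> J_plus T l y \<inter> J_minus T l p"
    then have z: "z \<in> topspace T" "causal_le l y z" "causal_le l z p"
      by (auto simp: J_plus_def J_minus_def)
    have "chron_less l x z"
      using chron_causal_trans[OF x(1) x'(1) yp(1) x(2) chron_less_imp_causal_le[OF x'(2)]]
        chron_causal_trans[OF x(1) yp(1) z(1) _ z(2)] by blast
    moreover have "chron_less l z w"
      using causal_chron_trans[OF z(1) yp(2) w(1) z(3) w(2)] .
    ultimately have "z \<in> D"
      by (rule D[OF z(1)])
    moreover have "d x' y \<le> d x' z"
      by (rule d_le(1)[OF yp(1) z(1) x'(1) z(2)])
    ultimately have "(x', z) \<in> K"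
      using x'D D_closure x'(1) z(1) by (auto simp: K_def)
    then show "z \<in> snd ` K"
      by force
  qed
  ultimately show ?thesis
    using closedin_diamond[OF yp] by (rule closed_compactin)
qed

text \<open>\<open>U j\<close> lies in the futures of those among the dense points
  \<open>q 0, ..., q j\<close> that precede \<open>y j\<close>. Hence each dense point before some
  \<open>y j\<close> ends up before \<open>w k\<close> and so before \<open>p\<close>. Were
  \<open>y j\<close> not below \<open>p\<close>, the open complement of the past of \<open>p\<close>
  would contain a dense point before \<open>y j\<close>.\<close>

lemma (in curve_space) capture_separable:
  assumes sep: "separable_space T" and path: "timelike_path_connected C T l"
    and yT: "\<And>j. y j \<in> topspace T" and y_le: "\<And>i j. i \<le> j \<Longrightarrow> causal_le l (y i) (y j)"
    and x: "x \<in> topspace T" "chron_less l x (y 0)"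
  shows "\<exists>U. capturing T l y U"
proof -
  obtain S where S: "countable S" "S \<subseteq> topspace T" "T closure_of S = topspace T"
    using sep unfolding separable_space_def by blast
  have "S \<noteq> {}"
    using S(3) x(1) by auto
  then obtain q :: "nat \<Rightarrow> 'a" where q: "range q = S"
    using S(1) uncountable_def by blast
  then have qT: "q n \<in> topspace T" for n
    using S(2) by blast
  define U where "U = (\<lambda>j. \<Inter>n\<in>{..j}. if chron_less l (q n) (y j) then I_plus T l (q n) else topspace T)"
  have I_open: "openin T (I_plus T l (q n))" for n
    using pre_length qT by (simp add: lorentzian_pre_length_space_def)
  have "openin T (U j)" for j
    unfolding U_def using I_open by (intro openin_INT2) auto
  moreover have "y j \<in> U j" for j
    unfolding U_def using yT by (intro INT_I) (simp add: I_plus_def)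
  moreover have "causal_le l (y j) p"
    if w: "\<forall>j. w j \<in> U j \<and> causal_le l (w j) p" and lim: "limitin T w p sequentially" for w p j
  proof (rule ccontr)
    assume contr: "\<not> causal_le l (y j) p"
    have pT: "p \<in> topspace T"
      using lim by (rule limitin_topspace)
    have below: "causal_le l (q n) p" if qy: "chron_less l (q n) (y j)" for n
    proof -
      \<comment> \<open>At least \<open>n\<close>, so that \<open>q n\<close> takes part in the
        intersection \<open>U k\<close>; at least \<open>j\<close>, so that \<open>q n\<close>
        precedes \<open>y k\<close>.\<close>
      define k where "k = max n j"
      have "chron_less l (q n) (y k)"
        using chron_causal_trans[OF qT yT yT qy y_le[of j k]] by (simp add: k_def)
      moreover have "w k \<in> U k"
        using w by blast
      then have "w k \<in> (if chron_less l (q n) (y k) then I_plus T l (q n) else topspace T)"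
        unfolding U_def by (rule INT_D) (simp add: k_def)
      ultimately have "w k \<in> I_plus T l (q n)"
        by simp
      then have "w k \<in> topspace T" "causal_le l (q n) (w k)"
        by (auto simp: I_plus_def chron_less_imp_causal_le)
      then show ?thesis
        using trans[OF qT _ pT, of "w k" n] w by blast
    qed
    have "openin T (topspace T - J_minus T l p)"
      using simple pT by (intro openin_diff) (auto simp: causally_simple_def)
    moreover have "y j \<in> topspace T - J_minus T l p"
      using contr yT by (simp add: J_minus_def)
    moreover have "chron_less l x (y j)"
      using chron_causal_trans[OF x(1) yT yT x(2) y_le] by simp
    ultimately obtain z where z: "z \<in> topspace T - J_minus T l p" "chron_less l z (y j)"
      using chron_less_dense[OF path x(1) yT] by blast
    define V where "V = (topspace T - J_minus T l p) \<inter> I_minus T l (y j)"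
    have "openin T V"
      using \<open>openin T (topspace T - J_minus T l p)\<close> pre_length yT
      by (auto simp: V_def lorentzian_pre_length_space_def)
    moreover have "z \<in> V"
      using z by (simp add: V_def I_minus_def)
    moreover have "z \<in> T closure_of S"
      using S(3) z(1) by simp
    ultimately obtain s where s: "s \<in> S" "s \<in> V"
      using in_closure_of[THEN iffD1, THEN conjunct2, rule_format, of z T S V] by blast
    then obtain n where n: "s = q n"
      using q by blast
    with s(2) below[of n] show False
      by (auto simp: V_def I_minus_def J_minus_def)
  qed
  ultimately have "capturing T l y U"
    unfolding capturing_def by blast
  then show ?thesis by blast
qed

text \<open>With balls of radius tending to zero, \<open>y\<close> converges to the same limit as
  \<open>w\<close>, and the limit of a causal chain bounds the chain.\<close>

lemma (in curve_space) capture_metric: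
  assumes T: "mtopology_of \<rho> = T"
    and yT: "\<And>j. y j \<in> topspace T" and y_le: "\<And>i j. i \<le> j \<Longrightarrow> causal_le l (y i) (y j)"
  shows "\<exists>U. capturing T l y U"
proof -
  interpret M: Metric_space "mspace \<rho>" "mdist \<rho>"
    by simp
  have MT: "M.mtopology = T" and sT: "topspace T = mspace \<rho>"
    using T by (auto simp: mtopology_of_def)
  define U where "U = (\<lambda>j. M.mball (y j) (inverse (real (Suc j))))"
  have "openin T (U j)" "y j \<in> U j" for j
    using yT sT M.openin_mball MT by (auto simp: U_def)
  moreover have "causal_le l (y j) p"
    if w: "\<forall>j. w j \<in> U j \<and> causal_le l (w j) p" and lim: "limitin T w p sequentially" for w p j
  proof -
    have p: "p \<in> mspace \<rho>" and wp: "(\<lambda>j. mdist \<rho> (w j) p) \<longlonglongrightarrow> 0"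
      using lim unfolding MT[symmetric] M.limitin_metric_dist_null by auto
    have "(\<lambda>j. mdist \<rho> (y j) p) \<longlonglongrightarrow> 0"
    proof (rule tendsto_sandwich[of "\<lambda>_. 0"])
      show "(\<lambda>j. inverse (real (Suc j)) + mdist \<rho> (w j) p) \<longlonglongrightarrow> 0"
        using tendsto_add[OF LIMSEQ_inverse_real_of_nat wp] by simp
      have "mdist \<rho> (y j) p \<le> inverse (real (Suc j)) + mdist \<rho> (w j) p" for j
      proof -
        have wj: "w j \<in> mspace \<rho>" "y j \<in> mspace \<rho>" "mdist \<rho> (y j) (w j) < inverse (real (Suc j))"
          using w by (auto simp: U_def)
        from mdist_triangle[OF wj(2,1) p] wj(3) show ?thesis
          by linarith
      qed
      then show "\<forall>\<^sub>F j in sequentially. mdist \<rho> (y j) p \<le> inverse (real (Suc j)) + mdist \<rho> (w j) p"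
        by (simp add: always_eventually)
    qed (auto intro: always_eventually)
    then have "limitin T y p sequentially"
      unfolding MT[symmetric] M.limitin_metric_dist_null using p yT sT by simp
    then have "seq_accumulation_point T y p"
      by (rule limitin_imp_accumulation_point)
    moreover have "\<forall>\<^sub>\<infinity>k. causal_le l (y j) (y k)"
      using y_le[of j] MOST_nat_le by blast
    ultimately show ?thesis
      using accumulation_point_ge[of y p "y j"] yT by blast
  qed
  ultimately have "capturing T l y U"
    unfolding capturing_def by blast
  then show ?thesis by blast
qed

section \<open>The implications between the completeness conditions\<close>

lemma timelike_path_connected_rev_sep:
  assumes "reversible C" and "timelike_path_connected C T l"
  shows "timelike_path_connected C T (rev_sep l)"
  unfolding timelike_path_connected_def
proof (intro ballI impI)
  fix x y assume "x \<in> topspace T" "y \<in> topspace T" "chron_less (rev_sep l) x y"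
  then obtain a b \<gamma> where \<gamma>: "a < b" "timelike_curve C l {a..b} \<gamma>" "\<gamma> a = y" "\<gamma> b = x"
    using assms(2) unfolding timelike_path_connected_def rev_sep_simps by blast
  then have "timelike_curve C (rev_sep l) {- b..- a} (reverse_curve \<gamma>)"
    using timelike_curve_reverse[OF assms(1), of l "{a..b}" \<gamma>] by simp
  with \<gamma> show "\<exists>a b \<gamma>. a < b \<and> timelike_curve C (rev_sep l) {a..b} \<gamma> \<and> \<gamma> a = x \<and> \<gamma> b = y"
    by (intro exI[of _ "- b"] exI[of _ "- a"] exI[of _ "reverse_curve \<gamma>"]) (simp add: reverse_curve_def)
qed

lemma KS_locally_bounded_arclength:
  assumes "KS_length_space T \<rho> l"
  shows "locally_bounded_arclength \<rho> l"
  unfolding locally_bounded_arclength_def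
proof
  have T: "mtopology_of \<rho> = T"
    using assms by (simp add: KS_length_space_def KS_pre_length_space_def)
  fix x assume "x \<in> mspace \<rho>"
  then have "x \<in> topspace T"
    using T by auto
  then obtain \<Omega> where \<Omega>: "x \<in> \<Omega>" "KS_localizing_neighbourhood T \<rho> l \<Omega>"
    using assms unfolding KS_length_space_def by blast
  from \<Omega>(2) obtain C :: real where "openin T \<Omega>" and
    "\<forall>I \<gamma>. causal_curve (lip_curve \<rho>) l I \<gamma> \<and> \<gamma> ` I \<subseteq> \<Omega> \<longrightarrow> metric_arclength \<rho> I \<gamma> \<le> ereal C"
    unfolding KS_localizing_neighbourhood_def by (elim exE conjE) (rule that)
  with \<Omega>(1) T show "\<exists>\<Omega> C. openin (mtopology_of \<rho>) \<Omega> \<and> x \<in> \<Omega> \<and>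
      (\<forall>I \<gamma>. causal_curve (lip_curve \<rho>) l I \<gamma> \<and> \<gamma> ` I \<subseteq> \<Omega> \<longrightarrow> metric_arclength \<rho> I \<gamma> \<le> ereal C)"
    by (intro exI[of _ \<Omega>] exI[of _ C]) simp
qed

lemma (in causally_simple_space) cont_curve_space: "curve_space (cont_curve T) T l"
  by unfold_locales (auto intro: cont_curve_extend)

lemma (in causally_simple_space) lip_curve_space:
  assumes "mtopology_of \<rho> = T" and "locally_bounded_arclength \<rho> l"
  shows "curve_space (lip_curve \<rho>) T l"
  by unfold_locales (use assms in \<open>auto simp: lip_curve_def intro: lip_curve_extend\<close>)

lemma (in causally_simple_space) cont_escape_space:
  assumes sep: "separable_space T" and path: "timelike_path_connected (cont_curve T) T l"
    and diamond: "\<And>x y. x \<in> topspace T \<Longrightarrow> y \<in> topspace T \<Longrightarrow> compactin T (J_plus T l x \<inter> J_minus T l y)"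
  shows "escape_space (cont_curve T) T l"
proof -
  interpret curve_space "cont_curve T" T l
    by (rule cont_curve_space)
  show ?thesis
    by unfold_locales
      (fact cont_curve_cong cont_curve_affine cont_curve_concat path diamond
        | (rule capture_separable[OF sep path]; assumption))+
qed

lemma (in causally_simple_space) lip_escape_space:
  assumes \<rho>: "mtopology_of \<rho> = T" and arclength: "locally_bounded_arclength \<rho> l"
    and path: "timelike_path_connected (lip_curve \<rho>) T l"
    and diamond: "\<And>x y. x \<in> topspace T \<Longrightarrow> y \<in> topspace T \<Longrightarrow> compactin T (J_plus T l x \<inter> J_minus T l y)"
  shows "escape_space (lip_curve \<rho>) T l"
proof -
  interpret curve_space "lip_curve \<rho>" T l
    by (rule lip_curve_space[OF \<rho> arclength])
  show ?thesis
    by unfold_locales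
      (fact lip_curve_cong lip_curve_affine lip_curve_concat path diamond
        | (rule capture_metric[OF \<rho>]; assumption))+
qed

lemma condition_B_imp_A_star:
  assumes C: "reversible C" and "escape_space C T l" "escape_space C T (rev_sep l)"
    and B: "condition_B C l"
  shows "condition_A_star C T l"
  using assms by (intro condition_A_star_if_future[OF C] escape_space.condition_B_imp_escape)
    (simp_all add: condition_B_iff_future)

lemma timelike_cauchy_complete_imp_condition_B:
  assumes C: "reversible C" and "curve_space C T l" "curve_space C T (rev_sep l)"
    and "timelike_cauchy_complete T l"
  shows "condition_B C l"
  using assms curve_space.cauchy_complete_imp_condition_B
  by (auto simp: condition_B_iff_future[OF C] timelike_cauchy_complete_iff)

context causally_simple_space
begin

lemma finitely_compact_imp_timelike_cauchy_complete:
  "finitely_compact T l \<Longrightarrow> timelike_cauchy_complete T l"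
  using finitely_compact_imp_cauchy_complete causally_simple_space.finitely_compact_imp_cauchy_complete[OF rev]
  by (simp add: finitely_compact_iff timelike_cauchy_complete_iff)

lemma cont_condition_B_imp_A_star:
  assumes sep: "separable_space T" and path: "timelike_path_connected (cont_curve T) T l"
    and diamond: "\<And>x y. x \<in> topspace T \<Longrightarrow> y \<in> topspace T \<Longrightarrow> compactin T (J_plus T l x \<inter> J_minus T l y)"
    and B: "condition_B (cont_curve T) l"
  shows "condition_A_star (cont_curve T) T l"
proof (rule condition_B_imp_A_star[OF reversible_cont_curve _ _ B])
  show "escape_space (cont_curve T) T l"
    by (rule cont_escape_space[OF sep path diamond])
  show "escape_space (cont_curve T) T (rev_sep l)"
    using diamond timelike_path_connected_rev_sep[OF reversible_cont_curve path]
    by (intro causally_simple_space.cont_escape_space[OF rev sep]) (auto simp: Int_commute)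
qed

lemma KS_condition_B:
  assumes KS: "KS_length_space T \<rho> l" and "timelike_cauchy_complete T l"
  shows "condition_B (lip_curve \<rho>) l"
proof (rule timelike_cauchy_complete_imp_condition_B[OF reversible_lip_curve _ _ assms(2)])
  have \<rho>: "mtopology_of \<rho> = T"
    using KS by (simp add: KS_length_space_def KS_pre_length_space_def)
  note arclength = KS_locally_bounded_arclength[OF KS]
  show "curve_space (lip_curve \<rho>) T l"
    by (rule lip_curve_space[OF \<rho> arclength])
  show "curve_space (lip_curve \<rho>) T (rev_sep l)"
    by (rule causally_simple_space.lip_curve_space[OF rev \<rho> locally_bounded_arclength_rev_sep[OF arclength]])
qed

lemma KS_condition_B_imp_A_star:
  assumes gh: "globally_hyperbolic T l" and KS: "KS_length_space T \<rho> l" and B: "condition_B (lip_curve \<rho>) l"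
  shows "condition_A_star (lip_curve \<rho>) T l"
proof (rule condition_B_imp_A_star[OF reversible_lip_curve _ _ B])
  have \<rho>: "mtopology_of \<rho> = T" and path: "timelike_path_connected (lip_curve \<rho>) T l"
    using KS by (auto simp: KS_length_space_def KS_pre_length_space_def)
  note arclength = KS_locally_bounded_arclength[OF KS] and diamond = globally_hyperbolic_diamond[OF gh]
  show "escape_space (lip_curve \<rho>) T l"
    by (rule lip_escape_space[OF \<rho> arclength path diamond])
  show "escape_space (lip_curve \<rho>) T (rev_sep l)"
    using diamond locally_bounded_arclength_rev_sep[OF arclength]
      timelike_path_connected_rev_sep[OF reversible_lip_curve path]
    by (intro causally_simple_space.lip_escape_space[OF rev \<rho>]) (auto simp: Int_commute)
qed

end

theorem theorem1p2:
  fixes T :: "'a topology" and l :: "'a \<Rightarrow> 'a \<Rightarrow> ereal"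
  assumes "lorentzian_pre_length_space T l"
    and "first_countable T"
    and "causally_simple T l"
  shows "(finitely_compact T l \<longrightarrow> timelike_cauchy_complete T l) \<and>
    (timelike_cauchy_complete T l \<longrightarrow> condition_B (cont_curve T) l) \<and>
    (\<forall>\<rho>. globally_hyperbolic T l \<and> KS_length_space T \<rho> l \<longrightarrow>
       (timelike_cauchy_complete T l \<longrightarrow> condition_B (lip_curve \<rho>) l) \<and>
       (condition_B (lip_curve \<rho>) l \<longrightarrow> condition_A_star (lip_curve \<rho>) T l) \<and>
       (condition_A_star (lip_curve \<rho>) T l \<longrightarrow> condition_A (lip_curve \<rho>) T l)) \<and>
    ((separable_space T \<and> timelike_path_connected (cont_curve T) T l \<and>
        BMS_lorentzian_metric_space T l \<and> chronological_boundary T l = {}) \<or>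
     (separable_space T \<and> timelike_path_connected (cont_curve T) T l \<and>
        globally_hyperbolic T l \<and> BM_length_metric_spacetime T l) \<longrightarrow>
       (condition_B (cont_curve T) l \<longrightarrow> condition_A_star (cont_curve T) T l) \<and>
       (condition_A_star (cont_curve T) T l \<longrightarrow> condition_A (cont_curve T) T l))"
proof -
  interpret causally_simple_space T l
    using assms(1,3) by unfold_locales
  have "condition_B (cont_curve T) l" if "timelike_cauchy_complete T l"
    using that by (rule timelike_cauchy_complete_imp_condition_B[OF reversible_cont_curve
      cont_curve_space causally_simple_space.cont_curve_space[OF rev]])
  moreover have "condition_A_star (cont_curve T) T l"
    if "(separable_space T \<and> timelike_path_connected (cont_curve T) T l \<and>
        BMS_lorentzian_metric_space T l \<and> chronological_boundary T l = {}) \<or>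
     (separable_space T \<and> timelike_path_connected (cont_curve T) T l \<and>
        globally_hyperbolic T l \<and> BM_length_metric_spacetime T l)"
      and "condition_B (cont_curve T) l"
  proof (rule cont_condition_B_imp_A_star[OF _ _ _ that(2)])
    \<comment> \<open>The two settings obtain compact diamonds differently: from the compact sets of
      pairs at distance at least \<epsilon>, or from global hyperbolicity.\<close>
    show "compactin T (J_plus T l x \<inter> J_minus T l y)" if xy: "x \<in> topspace T" "y \<in> topspace T" for x y
      using \<open>_ \<or> _\<close> BMS_diamond_compact[OF _ _ xy] globally_hyperbolic_diamond[OF _ xy] by blast
  qed (use that(1) in blast)+
  ultimately show ?thesis
    using finitely_compact_imp_timelike_cauchy_complete KS_condition_B KS_condition_B_imp_A_star
      condition_A_star_imp_condition_A by blast
qed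

end
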